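(* Let $0<\beta\le 1$, $0<\alpha<2$, and let $B_{\alpha,\beta}(t)$, $t\ge 0$, be a generalized grey Brownian motion with parameters $\alpha,\beta$. Let $X_\alpha(t)$, $t\ge 0$, be a standard fractional Brownian motion (with Hurst exponent $\alpha/2$, normalized as in the context) and let $L_\beta$ be a non-negative random variable independent of the process $X_\alpha$ with probability density function $M_\beta(\tau)$, $\tau\ge 0$. Then the processes $$B_{\alpha,\beta}(t),\ t\ge 0,\qquad\text{and}\qquad \sqrt{L_\beta}\,X_\alpha(t),\ t\ge 0,$$ have the same finite-dimensional distributions.
   Context: **The $M$-function.** For $0<\beta<1$ and $r\ge 0$, $$M_\beta(r)=\sum_{k=0}^\infty \frac{(-r)^k}{k!\,\Gamma(-\beta k+(1-\beta))}$$ (with $1/\Gamma$ equal to $0$ at the poles of $\Gamma$). It is a probability density on $[0,\infty)$. For $\beta=1$, by convention, $M_1(\tau)\,d\tau=\delta(\tau-1)\,d\tau$ is the unit point mass at $\tau=1$, so $L_1=1$ almost surely. **Standard fractional Brownian motion.** $X_\alpha(t)$, $t\ge 0$, is the centered Gaussian process with covariance $E(X_\alpha(t)X_\alpha(s))=t^\alpha+s^\alpha-|t-s|^\alpha$, so that $E(X_\alpha(1)^2)=2$ ("standard" here means variance $2$ at time $1$). **Generalized grey Brownian motion (ggBm).** Let $0<\beta\le 1$, $0<\alpha<2$. Let $E_\beta(x)=\sum_{n\ge 0} x^n/\Gamma(\beta n+1)$ be the Mittag-Leffler function. For $f$ in the Schwartz space $\mathcal S(\mathbb R)$ (real-valued)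 put $$\|f\|_\alpha^2=\Gamma(1+\alpha)\sin\!\left(\tfrac{\pi\alpha}{2}\right)\int_{\mathbb R}|x|^{1-\alpha}|\widetilde f(x)|^2dx,\qquad \widetilde f(x)=\frac1{\sqrt{2\pi}}\int_{\mathbb R} e^{ixy}f(y)\,dy .$$ The generalized grey noise measure $\mu_{\alpha,\beta}$ is the probability measure on $\mathcal S'(\mathbb R)$ (tempered distributions, with the Borel $\sigma$-algebra generated by the weak topology) characterized by $$\int_{\mathcal S'(\mathbb R)}e^{i\langle\omega,\xi\rangle}\,d\mu_{\alpha,\beta}(\omega)=E_\beta(-\|\xi\|_\alpha^2),\qquad \xi\in\mathcal S(\mathbb R),$$ where $\langle\cdot,\cdot\rangle$ is the canonical bilinear pairing. The linear map $\xi\mapsto X_{\alpha,\beta}(\xi)=\langle\cdot,\xi\rangle\in L^2(\mathcal S'(\mathbb R),\mu_{\alpha,\beta})$ satisfies $E(X_{\alpha,\beta}(\xi)^2)=\frac{2}{\Gamma(1+\beta)}\|\xi\|_\alpha^2$ and is extended by continuity to the completion of $\mathcal S(\mathbb R)$ for $\|\cdot\|_\alpha$; this completion contains the indicator functions $1_{[a,b)}$, $0\le a<b$, for which $\|1_{[a,b)}\|_\alpha^2=(b-a)^\alpha$. The (canonical) ggBm is $B_{\alpha,\beta}(t)=X_{\alpha,\beta}(1_{[0,t)})$, $t\ge 0$. More generally, a process on an arbitrary probability space is called a generalized grey Brownian motion with parameters $\alpha,\beta$ if it has the same finite-dimensional distributions as this canonical process. *)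

theory Defs
  imports "HOL-Probability.Probability"
begin

definition mittag_leffler :: "real \<Rightarrow> real \<Rightarrow> real" where
  "mittag_leffler \<beta> x = (\<Sum>n. x ^ n / Gamma (\<beta> * real n + 1))"

text \<open>\<^const>\<open>rGamma\<close> is the reciprocal Gamma function, which vanishes at the poles of Gamma.\<close>

definition M_function :: "real \<Rightarrow> real \<Rightarrow> real" where
  "M_function \<beta> r = (\<Sum>k. (- r) ^ k / fact k * rGamma (- \<beta> * real k + (1 - \<beta>)))"

definition M_law :: "'a measure \<Rightarrow> real \<Rightarrow> ('a \<Rightarrow> real) \<Rightarrow> bool" where
  "M_law N \<beta> L \<longleftrightarrow> L \<in> borel_measurable N \<and>
     (if \<beta> = 1 then distr N borel L = return borel 1
      else distributed N lborel L (\<lambda>\<tau>. ennreal (indicator {0..} \<tau> * M_function \<beta> \<tau>)))"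

definition schwartz_space :: "(real \<Rightarrow> real) set" where
  "schwartz_space = {f. (\<forall>n x. (deriv ^^ n) f field_differentiable at x) \<and>
     (\<forall>k n. bounded (range (\<lambda>x. x ^ k * (deriv ^^ n) f x)))}"

definition schwartz_seminorm :: "nat \<Rightarrow> nat \<Rightarrow> (real \<Rightarrow> real) \<Rightarrow> real" where
  "schwartz_seminorm k n f = (SUP x. \<bar>x ^ k * (deriv ^^ n) f x\<bar>)"

definition schwartz_topology :: "(real \<Rightarrow> real) topology" where
  "schwartz_topology = topology_generated_by
     {{g \<in> schwartz_space. schwartz_seminorm k n (\<lambda>x. g x - f x) < e} | f k n e.
        f \<in> schwartz_space \<and> 0 < e}"

text \<open>
  Functionals on the Schwartz space are represented by functions that take the value
  \<^const>\<open>undefined\<close> outside it, so that two tempered distributions agreeing on all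
  Schwartz functions are equal. The canonical pairing of \<open>\<omega>\<close> and \<open>\<xi>\<close> is the application \<open>\<omega> \<xi>\<close>.
\<close>

definition tempered_distributions :: "((real \<Rightarrow> real) \<Rightarrow> real) set" where
  "tempered_distributions = {\<omega> \<in> extensional schwartz_space.
     (\<forall>f\<in>schwartz_space. \<forall>g\<in>schwartz_space. \<omega> (\<lambda>x. f x + g x) = \<omega> f + \<omega> g) \<and>
     (\<forall>c. \<forall>f\<in>schwartz_space. \<omega> (\<lambda>x. c * f x) = c * \<omega> f) \<and>
     continuous_map schwartz_topology euclideanreal \<omega>}"

definition weak_topology :: "((real \<Rightarrow> real) \<Rightarrow> real) topology" where
  "weak_topology = topology_generated_by
     {{\<omega> \<in> tempered_distributions. \<omega> \<xi> \<in> U} | \<xi> U. \<xi> \<in> schwartz_space \<and> open U}"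

definition tempered_borel :: "((real \<Rightarrow> real) \<Rightarrow> real) measure" where
  "tempered_borel = sigma tempered_distributions {U. openin weak_topology U}"

lemma zero_in_schwartz_space: "(\<lambda>x. 0) \<in> schwartz_space"
proof -
  have "(deriv ^^ n) (\<lambda>x::real. 0::real) = (\<lambda>x. 0)" for n
    by (induction n) auto
  then show ?thesis by (simp add: schwartz_space_def)
qed

lemma topspace_schwartz_topology: "topspace schwartz_topology = schwartz_space"
proof -
  have "schwartz_seminorm k n (\<lambda>x. f x - f x) = 0" for k n f
  proof -
    have "(deriv ^^ n) (\<lambda>x::real. 0::real) = (\<lambda>x. 0)"
      by (induction n) auto
    then show ?thesis by (simp add: schwartz_seminorm_def)
  qed
  then have "f \<in> \<Union>{{g \<in> schwartz_space. schwartz_seminorm k n (\<lambda>x. g x - f x) < e} | f k n e.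
      f \<in> schwartz_space \<and> 0 < e}" if "f \<in> schwartz_space" for f
    using that
    by (intro UnionI[of "{g \<in> schwartz_space. schwartz_seminorm 0 0 (\<lambda>x. g x - f x) < 1}"])
       (auto intro!: exI[of _ f] exI[of _ "0::nat"] exI[of _ "1::real"])
  then show ?thesis
    unfolding schwartz_topology_def topology_generated_by_topspace by blast
qed

lemma topspace_weak_topology: "topspace weak_topology = tempered_distributions"
  unfolding weak_topology_def topology_generated_by_topspace
  using zero_in_schwartz_space open_UNIV by blast

lemma openin_weak_topology_subset:
  "{U. openin weak_topology U} \<subseteq> Pow tempered_distributions"
  using openin_subset[of weak_topology] topspace_weak_topology by auto

lemma space_tempered_borel: "space tempered_borel = tempered_distributions"
  by (simp add: tempered_borel_def space_measure_of openin_weak_topology_subset)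

lemma sets_tempered_borel:
  "sets tempered_borel = sigma_sets tempered_distributions {U. openin weak_topology U}"
  by (simp add: tempered_borel_def sets_measure_of openin_weak_topology_subset)

definition fourier :: "(real \<Rightarrow> real) \<Rightarrow> real \<Rightarrow> complex" where
  "fourier f x = complex_of_real (1 / sqrt (2 * pi)) *
     (\<integral>y. iexp (x * y) * complex_of_real (f y) \<partial>lborel)"

text \<open>
  The square of the norm takes values in \<open>[0, \<infinity>]\<close>, so that it makes sense for every integrable
  function, in particular for differences of Schwartz functions and indicator functions.
\<close>

definition alpha_norm_sq :: "real \<Rightarrow> (real \<Rightarrow> real) \<Rightarrow> ennreal" where
  "alpha_norm_sq \<alpha> f = ennreal (Gamma (1 + \<alpha>) * sin (pi * \<alpha> / 2)) *
     (\<integral>\<^sup>+x. ennreal (\<bar>x\<bar> powr (1 - \<alpha>) * (cmod (fourier f x))\<^sup>2) \<partial>lborel)"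

definition grey_noise_measure ::
    "real \<Rightarrow> real \<Rightarrow> ((real \<Rightarrow> real) \<Rightarrow> real) measure \<Rightarrow> bool" where
  "grey_noise_measure \<alpha> \<beta> \<mu> \<longleftrightarrow> prob_space \<mu> \<and> sets \<mu> = sets tempered_borel \<and>
     (\<forall>\<xi>\<in>schwartz_space. (\<integral>\<omega>. iexp (\<omega> \<xi>) \<partial>\<mu>) =
        complex_of_real (mittag_leffler \<beta> (- enn2real (alpha_norm_sq \<alpha> \<xi>))))"

text \<open>
  \<open>grey_extension \<alpha> \<mu> h Y\<close> states that \<open>Y\<close> is (a representative of) the value at \<open>h\<close> of the
  extension by continuity of the map \<open>\<xi> \<mapsto> \<langle>\<cdot>, \<xi>\<rangle>\<close> from the Schwartz space to \<open>L\<^sup>2(\<mu>)\<close>: some sequence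
  of Schwartz functions converges to \<open>h\<close> in the norm above, and its images converge to \<open>Y\<close>
  in \<open>L\<^sup>2(\<mu>)\<close>.
\<close>

definition grey_extension :: "real \<Rightarrow> ((real \<Rightarrow> real) \<Rightarrow> real) measure \<Rightarrow> (real \<Rightarrow> real)
    \<Rightarrow> (((real \<Rightarrow> real) \<Rightarrow> real) \<Rightarrow> real) \<Rightarrow> bool" where
  "grey_extension \<alpha> \<mu> h Y \<longleftrightarrow>
     Y \<in> borel_measurable \<mu> \<and> integrable \<mu> (\<lambda>\<omega>. (Y \<omega>)\<^sup>2) \<and>
     (\<exists>\<xi> :: nat \<Rightarrow> real \<Rightarrow> real. (\<forall>n. \<xi> n \<in> schwartz_space) \<and>
        (\<lambda>n. alpha_norm_sq \<alpha> (\<lambda>x. \<xi> n x - h x)) \<longlonglongrightarrow> 0 \<and>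
        (\<lambda>n. \<integral>\<^sup>+\<omega>. ennreal ((\<omega> (\<xi> n) - Y \<omega>)\<^sup>2) \<partial>\<mu>) \<longlonglongrightarrow> 0)"

definition canonical_ggBm :: "real \<Rightarrow> real \<Rightarrow> ((real \<Rightarrow> real) \<Rightarrow> real) measure
    \<Rightarrow> (real \<Rightarrow> ((real \<Rightarrow> real) \<Rightarrow> real) \<Rightarrow> real) \<Rightarrow> bool" where
  "canonical_ggBm \<alpha> \<beta> \<mu> B \<longleftrightarrow> grey_noise_measure \<alpha> \<beta> \<mu> \<and>
     (\<forall>t\<ge>0. grey_extension \<alpha> \<mu> (indicator {0..<t}) (B t))"

definition same_fdd :: "'a measure \<Rightarrow> (real \<Rightarrow> 'a \<Rightarrow> real)
    \<Rightarrow> 'b measure \<Rightarrow> (real \<Rightarrow> 'b \<Rightarrow> real) \<Rightarrow> bool" where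
  "same_fdd M X N Y \<longleftrightarrow> (\<forall>J. finite J \<and> J \<subseteq> {0..} \<longrightarrow>
     distr M (Pi\<^sub>M J (\<lambda>_. borel)) (\<lambda>\<omega>. \<lambda>t\<in>J. X t \<omega>) =
     distr N (Pi\<^sub>M J (\<lambda>_. borel)) (\<lambda>\<omega>. \<lambda>t\<in>J. Y t \<omega>))"

definition ggBm :: "real \<Rightarrow> real \<Rightarrow> 'a measure \<Rightarrow> (real \<Rightarrow> 'a \<Rightarrow> real) \<Rightarrow> bool" where
  "ggBm \<alpha> \<beta> M B \<longleftrightarrow> prob_space M \<and> (\<forall>t\<ge>0. B t \<in> borel_measurable M) \<and>
     (\<exists>\<mu> C. canonical_ggBm \<alpha> \<beta> \<mu> C \<and> same_fdd M B \<mu> C)"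

text \<open>Constants count as Gaussian: the value of the process at time 0 is degenerate.\<close>

definition gaussian_rv :: "'a measure \<Rightarrow> ('a \<Rightarrow> real) \<Rightarrow> bool" where
  "gaussian_rv M X \<longleftrightarrow> X \<in> borel_measurable M \<and>
     ((\<exists>m \<sigma>. 0 < \<sigma> \<and> distributed M lborel X (\<lambda>x. ennreal (normal_density m \<sigma> x))) \<or>
      (\<exists>m. distr M borel X = return borel m))"

definition gaussian_process :: "'a measure \<Rightarrow> (real \<Rightarrow> 'a \<Rightarrow> real) \<Rightarrow> bool" where
  "gaussian_process M X \<longleftrightarrow> prob_space M \<and> (\<forall>t\<ge>0. X t \<in> borel_measurable M) \<and>
     (\<forall>J c. finite J \<and> J \<subseteq> {0..} \<longrightarrow> gaussian_rv M (\<lambda>\<omega>. \<Sum>t\<in>J. c t * X t \<omega>))"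

definition standard_fBm :: "real \<Rightarrow> 'a measure \<Rightarrow> (real \<Rightarrow> 'a \<Rightarrow> real) \<Rightarrow> bool" where
  "standard_fBm \<alpha> M X \<longleftrightarrow> gaussian_process M X \<and>
     (\<forall>t\<ge>0. (\<integral>\<omega>. X t \<omega> \<partial>M) = 0) \<and>
     (\<forall>t\<ge>0. \<forall>s\<ge>0. (\<integral>\<omega>. X t \<omega> * X s \<omega> \<partial>M) =
        t powr \<alpha> + s powr \<alpha> - \<bar>t - s\<bar> powr \<alpha>)"

text \<open>
  \<^const>\<open>prob_space.indep_var\<close> requires both variables to have the same type; here the
  generated sigma-algebras are compared instead.
\<close>

definition indep_of_process :: "'a measure \<Rightarrow> ('a \<Rightarrow> real) \<Rightarrow> (real \<Rightarrow> 'a \<Rightarrow> real) \<Rightarrow> bool" where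
  "indep_of_process M L X \<longleftrightarrow> prob_space.indep_set M
     (sets (vimage_algebra (space M) L borel))
     (sets (vimage_algebra (space M) (\<lambda>\<omega>. \<lambda>t\<in>{0..}. X t \<omega>) (Pi\<^sub>M {0..} (\<lambda>_. borel))))"

end

theory Submission
  imports Defs "HOL-Complex_Analysis.Complex_Analysis" "HOL-Real_Asymp.Real_Asymp"
begin

text \<open>
  By the Cramer-Wold device it suffices to compare the characteristic functions of linear combinations
  with coefficients \<open>c\<close>. Write \<open>Q\<close> for the variance of the combination of the fractional Brownian
  motion. On the grey side, approximating indicators by Schwartz functions and computing the norm of a
  step function give \<open>E\<^sub>\<beta>(-Q/2)\<close>; on the mixture side, conditioning on \<open>L\<close> gives the Laplace
  transform of \<open>L\<close> at \<open>Q/2\<close>. That \<open>M\<^sub>\<beta>\<close> has Laplace transform \<open>E\<^sub>\<beta>(-s)\<close> follows from a Hankel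
  formula for \<open>1/\<Gamma>\<close> along a ray \<open>\<sigma> = R + u cis \<theta>\<close> in the upper half plane: it turns the series of \<open>M\<^sub>\<beta>\<close>
  into an integral of \<open>exp(\<sigma> - r \<sigma>\<^sup>\<beta>) \<sigma>\<^sup>\<beta>\<^sup>-\<^sup>1\<close>, whose Laplace transform in \<open>r\<close> is a geometric series when \<open>R\<close> is large.
\<close>

section \<open>The Cramer-Wold device\<close>

text \<open>Integrating the series of \<open>M_function\<close> term by term against exp (- s r) is
  impossible: r^k contributes k!, which cancels the factorial and leaves
  \<open>rGamma (- \<beta> * real k + (1 - \<beta>))\<close> / s^(k+1), and by the reflection
  formula these terms are unbounded for every s. On the ray, however, \<sigma>^\<beta> has a
  positive lower bound for its real part, so the integral in r decays uniformly and Fubini's theorem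
  applies; R is chosen after s, so that |\<sigma>^\<beta>| > s all along the ray. Two facts needed
  on the grey side come from the mixture side: E_\<beta> is continuous on the negative half line
  because it is the Laplace transform of the given L, and Q is non-negative because it is a
  variance. The half in Q/2 arises because the indicator of [0,t) has squared norm t^\<alpha>, while
  the fractional Brownian motion has variance 2 t^\<alpha>.\<close>

text \<open>Levy's uniqueness theorem is applied to the laws of \<open>X\<close> and \<open>Y\<close> under the normalised weights.\<close>

lemma weighted_cos_transform_unique:
  fixes w X :: "'a \<Rightarrow> real" and v Y :: "'b \<Rightarrow> real"
  assumes "prob_space M" "prob_space N"
    and [measurable]: "w \<in> borel_measurable M" "X \<in> borel_measurable M"
      "v \<in> borel_measurable N" "Y \<in> borel_measurable N"
    and w: "\<And>x. 0 \<le> w x" "\<And>x. w x \<le> C" and v: "\<And>x. 0 \<le> v x" "\<And>x. v x \<le> C"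
    and eq: "\<And>c \<phi>. (\<integral>x. w x * cos (c * X x + \<phi>) \<partial>M) = (\<integral>x. v x * cos (c * Y x + \<phi>) \<partial>N)"
    and [measurable]: "B \<in> sets borel"
  shows "(\<integral>x. w x * indicator B (X x) \<partial>M) = (\<integral>x. v x * indicator B (Y x) \<partial>N)"
proof -
  interpret M: prob_space M by fact
  interpret N: prob_space N by fact
  have iw: "integrable M w" "integrable N v"
    using w v by (auto intro!: M.integrable_const_bound[of _ C] N.integrable_const_bound[of _ C])
  define W where "W = (\<integral>x. w x \<partial>M)"
  \<comment> \<open>The parameters c = 0 and \<phi> = 0 show that the total masses agree, so one
    constant normalises both weights.\<close>
  have W: "W = (\<integral>x. v x \<partial>N)"
    using eq[of 0 0] by (simp add: W_def)
  have "W \<ge> 0" unfolding W_def using w by (intro integral_nonneg_AE) auto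
  \<comment> \<open>A weight of total mass 0 cannot be normalised; both integrals then
    vanish.\<close>
  show ?thesis
  proof (cases "W = 0")
    case True
    have "AE x in M. w x = 0" "AE x in N. v x = 0"
      using True integral_nonneg_eq_0_iff_AE[OF iw(1)] integral_nonneg_eq_0_iff_AE[OF iw(2)] w v
      by (auto simp: W_def[symmetric] W[symmetric])
    then have "(\<integral>x. w x * indicator B (X x) \<partial>M) = 0" "(\<integral>x. v x * indicator B (Y x) \<partial>N) = 0"
      by (auto intro!: integral_eq_zero_AE)
    then show ?thesis by simp
  next
    case False
    with \<open>W \<ge> 0\<close> have "W > 0" by simp
    define M' where "M' = density M (\<lambda>x. ennreal (w x / W))"
    define N' where "N' = density N (\<lambda>x. ennreal (v x / W))"
    have "prob_space M'" "prob_space N'"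
      using iw w v \<open>W > 0\<close> unfolding M'_def N'_def
      by (auto intro!: prob_spaceI simp: emeasure_density nn_integral_eq_integral W_def[symmetric] W[symmetric])
    then interpret M': prob_space M' + N': prob_space N' .
    have meas: "X \<in> borel_measurable M'" "Y \<in> borel_measurable N'" by (simp_all add: M'_def N'_def)
    have iM: "(\<integral>x. f x \<partial>M') = (\<integral>x. (w x / W) *\<^sub>R f x \<partial>M)" if "f \<in> borel_measurable M"
      for f :: "'a \<Rightarrow> complex"
      unfolding M'_def using that w \<open>W > 0\<close> by (intro integral_density) auto
    have iN: "(\<integral>x. f x \<partial>N') = (\<integral>x. (v x / W) *\<^sub>R f x \<partial>N)" if "f \<in> borel_measurable N"
      for f :: "'b \<Rightarrow> complex"
      unfolding N'_def using that v \<open>W > 0\<close> by (intro integral_density) auto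
    have "distr M' borel X = distr N' borel Y"
    proof (rule Levy_uniqueness)
      show "real_distribution (distr M' borel X)" "real_distribution (distr N' borel Y)"
        using meas by auto
      show "char (distr M' borel X) = char (distr N' borel Y)"
      proof
        fix t
        have I: "integrable M (\<lambda>x. (w x / W) *\<^sub>R iexp (t * X x))"
          "integrable N (\<lambda>x. (v x / W) *\<^sub>R iexp (t * Y x))"
          using w v \<open>W > 0\<close>
          by (auto intro!: M.integrable_const_bound[of _ "C / W"] N.integrable_const_bound[of _ "C / W"]
              simp: divide_right_mono)
        have "char (distr M' borel X) t = (\<integral>x. (w x / W) *\<^sub>R iexp (t * X x) \<partial>M)"
          using meas unfolding char_def by (simp add: integral_distr iM)
        also have "\<dots> = (\<integral>x. (v x / W) *\<^sub>R iexp (t * Y x) \<partial>N)"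
        proof (rule complex_eqI)
          show "Re (\<integral>x. (w x / W) *\<^sub>R iexp (t * X x) \<partial>M) = Re (\<integral>x. (v x / W) *\<^sub>R iexp (t * Y x) \<partial>N)"
            using eq[of t 0] I
            by (simp flip: integral_Re add: Re_exp)
          show "Im (\<integral>x. (w x / W) *\<^sub>R iexp (t * X x) \<partial>M) = Im (\<integral>x. (v x / W) *\<^sub>R iexp (t * Y x) \<partial>N)"
            \<comment> \<open>The phase - pi/2 turns the cosine into a sine; this is why the
              hypothesis \<open>eq\<close> carries a phase.\<close>
            using eq[of t "- (pi / 2)"] I
            by (simp flip: integral_Im add: Im_exp cos_diff)
        qed
        also have "\<dots> = char (distr N' borel Y) t"
          using meas unfolding char_def by (simp add: integral_distr iN)
        finally show "char (distr M' borel X) t = char (distr N' borel Y) t" .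
      qed
    qed
    then have "measure (distr M' borel X) B = measure (distr N' borel Y) B" by simp
    moreover have "measure (distr M' borel X) B = (\<integral>x. w x * indicator B (X x) \<partial>M) / W"
    proof -
      have "measure (distr M' borel X) B = (\<integral>x. indicator B (X x) \<partial>M')"
        using meas by (simp flip: integral_distr[of X M' borel])
      also have "\<dots> = (\<integral>x. (w x / W) *\<^sub>R indicator B (X x) \<partial>M)"
        unfolding M'_def using w \<open>W > 0\<close> by (intro integral_density) auto
      finally show ?thesis by simp
    qed
    moreover have "measure (distr N' borel Y) B = (\<integral>x. v x * indicator B (Y x) \<partial>N) / W"
    proof -
      have "measure (distr N' borel Y) B = (\<integral>x. indicator B (Y x) \<partial>N')"
        using meas by (simp flip: integral_distr[of Y N' borel])
      also have "\<dots> = (\<integral>x. (v x / W) *\<^sub>R indicator B (Y x) \<partial>N)"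
        unfolding N'_def using v \<open>W > 0\<close> by (intro integral_density) auto
      finally show ?thesis by simp
    qed
    ultimately show ?thesis using False by simp
  qed
qed

text \<open>Rectangles generate the product sigma-algebra and are closed under intersection, so
  agreement on them suffices. The probability of a rectangle is an integral of a product of
  indicators, the case A = J of \<open>key\<close>; the hypothesis on characteristic functions is
  the case of empty A.\<close>

lemma Cramer_Wold:
  fixes X :: "'i \<Rightarrow> 'a \<Rightarrow> real" and Y :: "'i \<Rightarrow> 'b \<Rightarrow> real"
  assumes "prob_space M" "prob_space N" and fin: "finite J"
    and X: "\<And>t. t \<in> J \<Longrightarrow> X t \<in> borel_measurable M"
    and Y: "\<And>t. t \<in> J \<Longrightarrow> Y t \<in> borel_measurable N"
    and eq: "\<And>c. (\<integral>x. iexp (\<Sum>t\<in>J. c t * X t x) \<partial>M) = (\<integral>x. iexp (\<Sum>t\<in>J. c t * Y t x) \<partial>N)"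
  shows "distr M (Pi\<^sub>M J (\<lambda>_. borel)) (\<lambda>\<omega>. \<lambda>t\<in>J. X t \<omega>) =
         distr N (Pi\<^sub>M J (\<lambda>_. borel)) (\<lambda>\<omega>. \<lambda>t\<in>J. Y t \<omega>)"
proof -
  interpret M: prob_space M by fact
  interpret N: prob_space N by fact
  \<comment> \<open>Coordinates are moved one at a time from the cosine into the product of indicators; the weight
    \<open>1 + cos\<close> keeps the measures positive.\<close>
  have key: "(\<integral>x. (\<Prod>t\<in>A. indicator (B t) (X t x)) * cos ((\<Sum>t\<in>J - A. c t * X t x) + \<phi>) \<partial>M) =
        (\<integral>x. (\<Prod>t\<in>A. indicator (B t) (Y t x)) * cos ((\<Sum>t\<in>J - A. c t * Y t x) + \<phi>) \<partial>N)"
    if "A \<subseteq> J" "\<And>t. B t \<in> sets borel" for A c \<phi> and B :: "'i \<Rightarrow> real set"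
  proof -
    have "finite A" using that(1) fin finite_subset by blast
    then show ?thesis using that
    proof (induction A arbitrary: c \<phi> rule: finite_induct)
      case empty
      let ?SX = "\<lambda>x. \<Sum>t\<in>J. c t * X t x" and ?SY = "\<lambda>x. \<Sum>t\<in>J. c t * Y t x"
      have [measurable]: "?SX \<in> borel_measurable M" "?SY \<in> borel_measurable N"
        using X Y by (auto intro!: borel_measurable_sum)
      have I: "integrable M (\<lambda>x. exp (\<i> * \<phi>) * iexp (?SX x))" "integrable N (\<lambda>x. exp (\<i> * \<phi>) * iexp (?SY x))"
        by (auto intro!: M.integrable_const_bound[of _ 1] N.integrable_const_bound[of _ 1]
            simp: norm_mult simp del: of_real_sum)
      have "(\<integral>x. exp (\<i> * \<phi>) * iexp (?SX x) \<partial>M) = (\<integral>x. exp (\<i> * \<phi>) * iexp (?SY x) \<partial>N)"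
        by (simp only: integral_mult_right_zero eq)
      then have "(\<integral>x. Re (exp (\<i> * \<phi>) * iexp (?SX x)) \<partial>M) = (\<integral>x. Re (exp (\<i> * \<phi>) * iexp (?SY x)) \<partial>N)"
        using I by (simp only: integral_Re)
      then show ?case
        by (simp add: Re_exp Im_exp cos_add mult.commute)
    next
      case (insert s A)
      then have sJ: "s \<in> J" and AJ: "A \<subseteq> J" and J: "J - A = insert s (J - insert s A)" by auto
      have [measurable]: "X s \<in> borel_measurable M" "Y s \<in> borel_measurable N" using X Y sJ by auto
      have [measurable]: "B t \<in> sets borel" for t using insert by auto
      let ?PX = "\<lambda>x. \<Prod>t\<in>A. indicator (B t) (X t x) :: real"
      let ?PY = "\<lambda>x. \<Prod>t\<in>A. indicator (B t) (Y t x) :: real"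
      let ?SX = "\<lambda>x. \<Sum>t\<in>J - insert s A. c t * X t x"
      let ?SY = "\<lambda>x. \<Sum>t\<in>J - insert s A. c t * Y t x"
      have mm[measurable]: "?PX \<in> borel_measurable M" "?PY \<in> borel_measurable N"
        using X Y AJ by (auto intro!: borel_measurable_prod borel_measurable_indicator' simp: subset_eq)
      have [measurable]: "?SX \<in> borel_measurable M" "?SY \<in> borel_measurable N"
        using X Y by (auto intro!: borel_measurable_sum)
      have P: "0 \<le> ?PX x" "?PX x \<le> 1" "0 \<le> ?PY y" "?PY y \<le> 1" for x y
        by (auto intro!: prod_nonneg prod_le_1)
      have bd: "\<bar>p * q\<bar> \<le> 1" if "0 \<le> p" "p \<le> 1" "\<bar>q\<bar> \<le> 1" for p q :: real
        using that by (simp add: abs_mult mult_le_one)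
      have IX: "integrable M (\<lambda>x. ?PX x * f x)" if "f \<in> borel_measurable M" "\<And>x. \<bar>f x\<bar> \<le> 1" for f
        using that P by (intro M.integrable_const_bound[of _ 1]) (auto intro!: bd)
      have IY: "integrable N (\<lambda>x. ?PY x * f x)" if "f \<in> borel_measurable N" "\<And>x. \<bar>f x\<bar> \<le> 1" for f
        using that P by (intro N.integrable_const_bound[of _ 1]) (auto intro!: bd)
      \<comment> \<open>Coefficients 0 at all remaining coordinates except s leave the transform of
        \<open>X s\<close> weighted by the product of indicators alone.\<close>
      have e0: "(\<integral>x. ?PX x * cos (d * X s x + \<psi>) \<partial>M) = (\<integral>x. ?PY x * cos (d * Y s x + \<psi>) \<partial>N)" for d \<psi>
      proof -
        have "(\<Sum>t\<in>J - A. (if t = s then d else 0) * f t) = d * f s" for f :: "'i \<Rightarrow> real"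
          using fin insert(2) sJ by (subst sum.mono_neutral_cong_right[of _ "{s}" _ "\<lambda>t. d * f t"]) auto
        then show ?thesis
          using insert.IH[OF AJ insert.prems(2), of "\<lambda>t. if t = s then d else 0" \<psi>] by simp
      qed
      have e1: "(\<integral>x. ?PX x * cos (?SX x + d * X s x + \<psi>) \<partial>M) =
          (\<integral>x. ?PY x * cos (?SY x + d * Y s x + \<psi>) \<partial>N)" for d \<psi>
      proof -
        have "(\<Sum>t\<in>J - A. (c(s := d)) t * f t) = (\<Sum>t\<in>J - insert s A. c t * f t) + d * f s" for f :: "'i \<Rightarrow> real"
          unfolding J using fin by (subst sum.insert) (auto intro!: sum.cong)
        then show ?thesis
          using insert.IH[OF AJ insert.prems(2), of "c(s := d)" \<psi>] by simp
      qed
      have w01: "0 \<le> p * (1 + cos a)" "p * (1 + cos a) \<le> 2" if "0 \<le> p" "p \<le> 1" for p a :: real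
      proof -
        have "0 \<le> 1 + cos a" using cos_ge_minus_one[of a] by linarith
        then show "0 \<le> p * (1 + cos a)" "p * (1 + cos a) \<le> 2"
          using that mult_mono[of p 1 "1 + cos a" 2] by auto
      qed
      \<comment> \<open>Product-to-sum: the transform of \<open>X s\<close> under the weight
        \<open>p * (1 + cos a)\<close> splits into transforms known from \<open>e0\<close> and
        \<open>e1\<close>.\<close>
      have cc: "p * (1 + cos a) * cos b = p * cos b + (p * cos (a + b) + p * cos (a - b)) / 2" for p a b :: real
        by (simp add: cos_add cos_diff field_simps)
      have "(\<integral>x. (?PX x * (1 + cos (?SX x + \<phi>))) * indicator (B s) (X s x) \<partial>M) =
          (\<integral>x. (?PY x * (1 + cos (?SY x + \<phi>))) * indicator (B s) (Y s x) \<partial>N)"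
      proof (rule weighted_cos_transform_unique[where C = 2])
        fix d \<psi>
        have a: "a + \<phi> + (d * b + \<psi>) = a + d * b + (\<phi> + \<psi>)"
          "a + \<phi> - (d * b + \<psi>) = a + (- d) * b + (\<phi> - \<psi>)" for a b by (simp_all add: algebra_simps)
        show "(\<integral>x. (?PX x * (1 + cos (?SX x + \<phi>))) * cos (d * X s x + \<psi>) \<partial>M) =
          (\<integral>x. (?PY x * (1 + cos (?SY x + \<phi>))) * cos (d * Y s x + \<psi>) \<partial>N)"
          unfolding cc a
          by (simp add: IX IY del: minus_mult_minus mult_minus_left) (use e1[of "- d"] in \<open>simp add: e0 e1\<close>)
      qed (auto intro!: w01 P \<open>prob_space M\<close> \<open>prob_space N\<close>)
      \<comment> \<open>Subtracting this case removes the 1 that was added for positivity and leaves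
        the cosine term.\<close>
      moreover have "(\<integral>x. ?PX x * indicator (B s) (X s x) \<partial>M) = (\<integral>x. ?PY x * indicator (B s) (Y s x) \<partial>N)"
        by (rule weighted_cos_transform_unique[where C = 1])
           (use P e0 in \<open>auto simp: \<open>prob_space M\<close> \<open>prob_space N\<close>\<close>)
      moreover have "(\<integral>x. (?PX x * (1 + cos (?SX x + \<phi>))) * indicator (B s) (X s x) \<partial>M) =
          (\<integral>x. ?PX x * indicator (B s) (X s x) \<partial>M) + (\<integral>x. ?PX x * (indicator (B s) (X s x) * cos (?SX x + \<phi>)) \<partial>M)"
        by (subst Bochner_Integration.integral_add[symmetric], (rule IX; auto split: split_indicator)+)
           (simp add: algebra_simps)
      moreover have "(\<integral>x. (?PY x * (1 + cos (?SY x + \<phi>))) * indicator (B s) (Y s x) \<partial>N) =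
          (\<integral>x. ?PY x * indicator (B s) (Y s x) \<partial>N) + (\<integral>x. ?PY x * (indicator (B s) (Y s x) * cos (?SY x + \<phi>)) \<partial>N)"
        by (subst Bochner_Integration.integral_add[symmetric], (rule IY; auto split: split_indicator)+)
           (simp add: algebra_simps)
      ultimately show ?case
        using insert(1,2) by (simp add: mult_ac)
    qed
  qed
  have mX: "(\<lambda>\<omega>. \<lambda>t\<in>J. X t \<omega>) \<in> M \<rightarrow>\<^sub>M Pi\<^sub>M J (\<lambda>_. borel)"
    and mY: "(\<lambda>\<omega>. \<lambda>t\<in>J. Y t \<omega>) \<in> N \<rightarrow>\<^sub>M Pi\<^sub>M J (\<lambda>_. borel)"
    using X Y by (auto intro!: measurable_restrict)
  show ?thesis
  proof (rule measure_eqI_PiM_finite[OF fin])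
    show "range (\<lambda>_::nat. space (Pi\<^sub>M J (\<lambda>_. borel :: real measure))) \<subseteq> prod_algebra J (\<lambda>_. borel)"
      using prod_algebraI_finite[OF fin, of "\<lambda>_. UNIV" "\<lambda>_. borel :: real measure"] by (auto simp: space_PiM)
    fix B :: "'i \<Rightarrow> real set"
    assume B: "\<And>i. i \<in> J \<Longrightarrow> B i \<in> sets borel"
    \<comment> \<open>\<open>key\<close> asks for Borel sets at every index, but outside J nothing
      is known about B.\<close>
    define B' where "B' i = (if i \<in> J then B i else {})" for i
    have B': "B' i \<in> sets borel" for i using B by (auto simp: B'_def)
    have PB: "Pi\<^sub>E J B \<in> sets (Pi\<^sub>M J (\<lambda>_. borel))" using B fin by (auto intro!: sets_PiM_I_finite)
    have ind: "indicator ((\<lambda>\<omega>. \<lambda>t\<in>J. Z t \<omega>) -` Pi\<^sub>E J B \<inter> S) x = (\<Prod>t\<in>J. indicator (B' t) (Z t x) :: real)"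
      if "x \<in> S" for Z :: "'i \<Rightarrow> 'c \<Rightarrow> real" and x S
      using that fin by (auto simp: indicator_def B'_def PiE_iff prod.neutral intro!: prod_zero[symmetric])
    have "measure M ((\<lambda>\<omega>. \<lambda>t\<in>J. X t \<omega>) -` Pi\<^sub>E J B \<inter> space M) = (\<integral>x. (\<Prod>t\<in>J. indicator (B' t) (X t x)) \<partial>M)"
      using measurable_sets[OF mX PB] by (subst Bochner_Integration.integral_cong[OF refl ind[symmetric]]) auto
    moreover have "measure N ((\<lambda>\<omega>. \<lambda>t\<in>J. Y t \<omega>) -` Pi\<^sub>E J B \<inter> space N) = (\<integral>x. (\<Prod>t\<in>J. indicator (B' t) (Y t x)) \<partial>N)"
      using measurable_sets[OF mY PB] by (subst Bochner_Integration.integral_cong[OF refl ind[symmetric]]) auto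
    ultimately show "emeasure (distr M (Pi\<^sub>M J (\<lambda>_. borel)) (\<lambda>\<omega>. \<lambda>t\<in>J. X t \<omega>)) (Pi\<^sub>E J B) =
        emeasure (distr N (Pi\<^sub>M J (\<lambda>_. borel)) (\<lambda>\<omega>. \<lambda>t\<in>J. Y t \<omega>)) (Pi\<^sub>E J B)"
      using key[of J B' "\<lambda>_. 0" 0] B'
      by (simp add: emeasure_distr mX mY PB M.emeasure_eq_measure N.emeasure_eq_measure)
  qed (auto simp: emeasure_distr mX mY M.emeasure_eq_measure)
qed

section \<open>A Hankel formula for the reciprocal Gamma function\<close>

lemma set_integrable_exp_decay:
  fixes k :: real
  assumes "0 < k"
  shows "set_integrable lborel {0..} (\<lambda>u. exp (- k * u))"
proof -
  have "(\<integral>\<^sup>+u. ennreal (exp (- k * u)) * indicator {0..} u \<partial>lborel) = 0 - (- exp (- k * 0) / k)"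
  proof (rule nn_integral_FTC_atLeast[where F = "\<lambda>u. - exp (- k * u) / k"])
    show "((\<lambda>u. - exp (- k * u) / k) \<longlongrightarrow> 0) at_top"
      using assms by real_asymp
  qed (use assms in \<open>auto intro!: derivative_eq_intros\<close>)
  then show ?thesis
    unfolding set_integrable_def integrable_iff_bounded
    by (simp add: ennreal_mult' ennreal_indicator abs_mult mult.commute ennreal_mult'' less_top)
qed

lemma set_integrable_exp_bound:
  fixes f :: "real \<Rightarrow> complex"
  assumes "0 < k" "continuous_on {0..} f" "\<And>u. 0 \<le> u \<Longrightarrow> norm (f u) \<le> C * exp (- k * u)"
  shows "set_integrable lborel {0..} f"
proof (rule set_integrable_bound)
  show "set_integrable lborel {0..} (\<lambda>u. C * exp (- k * u))"
    using set_integrable_exp_decay[OF assms(1)] by (rule set_integrable_mult_right)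
  show "set_borel_measurable lborel {0..} f"
    using assms(2) unfolding set_borel_measurable_def
    using borel_measurable_continuous_on_indicator[of "{0..}" f] by simp
  show "AE u in lborel. u \<in> {0..} \<longrightarrow> norm (f u) \<le> norm (C * exp (- k * u))"
    using order_trans[OF assms(3) abs_ge_self] by (intro AE_I2) auto
qed

text \<open>This is y \<le> exp y at y = k x / a, raised to the power a. As k is free, a power costs
  only an arbitrarily small part of an exponential decay rate.\<close>

lemma powr_le_exp:
  fixes x a k :: real
  assumes "0 \<le> x" "0 < a" "0 < k"
  shows "x powr a \<le> (a / k) powr a * exp (k * x)"
proof -
  have "x powr a = (a / k) powr a * (k * x / a) powr a"
    using assms by (simp flip: powr_mult)
  also have "(k * x / a) powr a \<le> exp (k * x / a) powr a"
    using assms exp_ge_add_one_self[of "k * x / a"] by (intro powr_mono2) (auto simp del: exp_ge_add_one_self)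
  also have "exp (k * x / a) powr a = exp (k * x)"
    using assms by (simp add: powr_def)
  finally show ?thesis using assms by simp
qed

lemma primitive_along_ray:
  fixes f g :: "complex \<Rightarrow> complex"
  assumes g: "\<And>s. s \<in> S \<Longrightarrow> (g has_field_derivative f s) (at s within S)"
    and S: "\<And>u. 0 \<le> u \<Longrightarrow> a + of_real u * d \<in> S"
    and f: "continuous_on {0..} (\<lambda>u. f (a + of_real u * d))"
    and k: "0 < k" and bd: "\<And>u. 0 \<le> u \<Longrightarrow> norm (f (a + of_real u * d)) \<le> C * exp (- k * u)"
  shows "set_integrable lborel {0..} (\<lambda>u. f (a + of_real u * d) * d)"
    and "((\<lambda>u. g (a + of_real u * d)) \<longlongrightarrow> g a + (LBINT u:{0..}. f (a + of_real u * d) * d)) at_top"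
proof -
  have "norm (f (a + of_real u * d) * d) \<le> (C * norm d) * exp (- k * u)" if "0 \<le> u" for u
    using mult_right_mono[OF bd[OF that] norm_ge_zero[of d]] by (simp add: norm_mult mult_ac)
  then show int: "set_integrable lborel {0..} (\<lambda>u. f (a + of_real u * d) * d)"
    using f k by (intro set_integrable_exp_bound[of k _ "C * norm d"] continuous_intros) auto
  have "((\<lambda>b. LBINT u:{0..b}. f (a + of_real u * d) * d) \<longlongrightarrow> (LBINT u:{0..}. f (a + of_real u * d) * d)) at_top"
    using int by (intro tendsto_set_lebesgue_integral_at_top) auto
  moreover have "eventually (\<lambda>b. (LBINT u:{0..b}. f (a + of_real u * d) * d) = g (a + of_real b * d) - g a) at_top"
    using eventually_ge_at_top[of 0]
  proof eventually_elim
    case (elim b)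
    have "(LBINT u:{0..b}. f (a + of_real u * d) * d) = g (a + of_real b * d) - g (a + of_real 0 * d)"
      unfolding set_lebesgue_integral_def
    proof (rule integral_FTC_atLeastAtMost[OF elim])
      show "continuous_on {0..b} (\<lambda>u. f (a + of_real u * d) * d)"
        by (intro continuous_intros continuous_on_subset[OF f]) auto
      fix u assume u: "0 \<le> u" "u \<le> b"
      have "(g has_field_derivative f (a + of_real u * d)) (at (a + of_real u * d) within (\<lambda>u. a + of_real u * d) ` {0..b})"
        by (rule DERIV_subset[OF g]) (use S u in auto)
      moreover have "((\<lambda>u. a + of_real u * d) has_vector_derivative d) (at u within {0..b})"
        by (auto intro!: derivative_eq_intros simp: has_vector_derivative_def fun_eq_iff scaleR_conv_of_real)
      ultimately have "(g \<circ> (\<lambda>u. a + of_real u * d) has_vector_derivative d * f (a + of_real u * d)) (at u within {0..b})"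
        by (intro field_vector_diff_chain_within)
      then show "((\<lambda>u. g (a + of_real u * d)) has_vector_derivative f (a + of_real u * d) * d) (at u within {0..b})"
        by (simp add: o_def mult.commute)
    qed
    then show ?case by simp
  qed
  ultimately have "((\<lambda>u. g (a + of_real u * d) - g a) \<longlongrightarrow> (LBINT u:{0..}. f (a + of_real u * d) * d)) at_top"
    by (rule Lim_transform_eventually)
  from tendsto_add[OF tendsto_const[of "g a"] this]
  show "((\<lambda>u. g (a + of_real u * d)) \<longlongrightarrow> g a + (LBINT u:{0..}. f (a + of_real u * d) * d)) at_top"
    by simp
qed

text \<open>An angle beyond pi/2 makes \<open>exp\<close> decay along the ray. Starting at R > 0
  instead of 0 keeps the ray away from the branch point, so that every real power can be
  integrated.\<close>

locale hankel_ray =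
  fixes R \<theta> :: real
  assumes R: "0 < R" and \<theta>: "pi / 2 < \<theta>" "\<theta> < pi"
begin

definition ray :: "real \<Rightarrow> complex" where "ray u = of_real R + of_real u * cis \<theta>"

lemma cos_neg: "cos \<theta> < 0"
  using \<theta> cos_monotone_0_pi[of "pi/2" \<theta>] by simp

lemma sin_pos: "0 < sin \<theta>"
  using \<theta> by (intro sin_gt_zero) (auto intro: less_trans[OF pi_half_gt_zero])

lemma Re_ray: "Re (ray u) = R + u * cos \<theta>" by (simp add: ray_def)

lemma Im_ray: "Im (ray u) = u * sin \<theta>" by (simp add: ray_def)

lemma norm_ray_le: "0 \<le> u \<Longrightarrow> norm (ray u) \<le> R + u"
  using norm_triangle_ineq[of "of_real R" "of_real u * cis \<theta>"] R by (simp add: ray_def norm_mult)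

text \<open>The bound is the distance from 0 to the line that carries the ray: rotating by -
  \<theta> makes the line horizontal, at height - R sin \<theta>.\<close>

lemma norm_ray_ge: "R * sin \<theta> \<le> norm (ray u)"
proof -
  have "norm (ray u) = norm (cis (- \<theta>) * ray u)" by (simp add: norm_mult)
  also have "cis (- \<theta>) * ray u = of_real R * cis (- \<theta>) + of_real u"
    by (simp add: ray_def algebra_simps cis_mult)
  also have "norm \<dots> \<ge> \<bar>Im (of_real R * cis (- \<theta>) + of_real u)\<bar>" by (rule abs_Im_le_cmod)
  finally show ?thesis using R sin_pos by simp
qed

lemma ray_nonzero: "ray u \<noteq> 0"
proof -
  have "0 < norm (ray u)" using norm_ray_ge[of u] R sin_pos by (smt (verit) mult_pos_pos)
  then show ?thesis by auto
qed

lemma ray_slit: "0 \<le> u \<Longrightarrow> ray u \<notin> \<real>\<^sub>\<le>\<^sub>0"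
  using sin_pos R by (auto simp: complex_nonpos_Reals_iff Re_ray Im_ray)

text \<open>Rotation by - \<theta> sends the ray into the lower half plane, so the sine of Arg -
  \<theta> is negative; since Arg - \<theta> < pi, it cannot be non-negative.\<close>

lemma Arg_ray: "0 \<le> u \<Longrightarrow> 0 \<le> Arg (ray u) \<and> Arg (ray u) \<le> \<theta>"
proof -
  assume u: "0 \<le> u"
  let ?p = "Arg (ray u)"
  have p: "0 \<le> ?p" using u sin_pos Arg_less_0[of "ray u"] by (simp add: Im_ray not_less)
  have "Im (cis (- \<theta>) * ray u) < 0" using R sin_pos by (simp add: Re_ray Im_ray algebra_simps)
  moreover have "cis (- \<theta>) * ray u = of_real (norm (ray u)) * cis (?p - \<theta>)"
  proof -
    have "ray u = of_real (norm (ray u)) * cis ?p"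
      using rcis_cmod_Arg[of "ray u"] by (simp add: rcis_def)
    then have "cis (- \<theta>) * ray u = of_real (norm (ray u)) * (cis (- \<theta>) * cis ?p)"
      by (metis mult.left_commute)
    then show ?thesis by (simp add: cis_mult)
  qed
  ultimately have "sin (?p - \<theta>) < 0" using norm_ge_zero[of "ray u"] by (simp add: mult_less_0_iff)
  moreover have "?p - \<theta> < pi" using Arg_bounded[of "ray u"] \<theta> by (smt (verit) pi_half_gt_zero)
  ultimately show "0 \<le> ?p \<and> ?p \<le> \<theta>"
    using p sin_ge_zero[of "?p - \<theta>"] by (auto simp: not_le[symmetric])
qed

lemma continuous_on_ray [continuous_intros]: "continuous_on A ray"
  unfolding ray_def by (intro continuous_intros)

lemma norm_exp_ray: "norm (exp (ray u)) = exp R * exp (cos \<theta> * u)"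
  by (simp add: Re_ray exp_add mult.commute)

lemma powr_ray_bound:
  assumes "0 < k"
  obtains C where "0 < C" "\<And>u. 0 \<le> u \<Longrightarrow> norm (ray u) powr a \<le> C * exp (k * u)"
proof (cases "a > 0")
  case True
  show thesis
  proof (rule that[of "(a / k) powr a * exp (k * R)"])
    fix u :: real assume "0 \<le> u"
    then have "norm (ray u) powr a \<le> (R + u) powr a"
      using True norm_ray_le by (intro powr_mono2) auto
    also have "\<dots> \<le> (a / k) powr a * exp (k * (R + u))"
      using \<open>0 \<le> u\<close> R True assms by (intro powr_le_exp) auto
    finally show "norm (ray u) powr a \<le> (a / k) powr a * exp (k * R) * exp (k * u)"
      by (simp add: algebra_simps exp_add)
  qed (use True assms in auto)
next
  case False
  show thesis
  proof (rule that[of "(R * sin \<theta>) powr a"])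
    show "0 < (R * sin \<theta>) powr a" using R sin_pos by simp
    fix u :: real assume "0 \<le> u"
    have "norm (ray u) powr a \<le> (R * sin \<theta>) powr a"
      using False norm_ray_ge[of u] R sin_pos by (intro powr_mono2') auto
    moreover have "1 \<le> exp (k * u)" using \<open>0 \<le> u\<close> assms by simp
    ultimately show "norm (ray u) powr a \<le> (R * sin \<theta>) powr a * exp (k * u)"
      by (smt (verit) mult_le_cancel_left1 powr_ge_zero)
  qed
qed

text \<open>Half of the decay rate - cos \<theta> of the exponential is spent on absorbing the
  power, the other half remains.\<close>

lemma exp_powr_ray_bound:
  obtains C where "0 < C" "\<And>u. 0 \<le> u \<Longrightarrow>
    norm (exp (ray u) * ray u powr (of_real a)) \<le> C * exp (- (- cos \<theta> / 2) * u)"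
proof -
  obtain C where C: "0 < C" "\<And>u. 0 \<le> u \<Longrightarrow> norm (ray u) powr a \<le> C * exp ((- cos \<theta> / 2) * u)"
    using powr_ray_bound[of "- cos \<theta> / 2" a] cos_neg by auto
  show thesis
  proof (rule that[of "exp R * C"])
    fix u :: real assume "0 \<le> u"
    have "norm (exp (ray u) * ray u powr (of_real a)) = exp R * exp (cos \<theta> * u) * norm (ray u) powr a"
      by (simp add: norm_mult norm_exp_ray norm_powr_real_powr' del: norm_exp_eq_Re)
    also have "\<dots> \<le> exp R * exp (cos \<theta> * u) * (C * exp ((- cos \<theta> / 2) * u))"
      using C(2)[OF \<open>0 \<le> u\<close>] by (intro mult_left_mono) auto
    also have "\<dots> = exp R * C * exp (- (- cos \<theta> / 2) * u)"
      by (simp add: exp_add[symmetric] mult_ac field_simps)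
    finally show "norm (exp (ray u) * ray u powr (of_real a)) \<le> exp R * C * exp (- (- cos \<theta> / 2) * u)" .
  qed (use C in auto)
qed

lemma continuous_on_powr_ray [continuous_intros]:
  "continuous_on {0..} (\<lambda>u. ray u powr (of_real a))"
  unfolding powr_def using ray_slit ray_nonzero
  by (auto intro!: continuous_on_exp continuous_on_mult continuous_on_const continuous_on_Ln' continuous_on_ray)

lemma integrable_hankel:
  "set_integrable lborel {0..} (\<lambda>u. exp (ray u) * ray u powr (of_real a) * cis \<theta>)"
proof -
  obtain C where C: "0 < C" "\<And>u. 0 \<le> u \<Longrightarrow>
    norm (exp (ray u) * ray u powr (of_real a)) \<le> C * exp (- (- cos \<theta> / 2) * u)"
    using exp_powr_ray_bound by blast
  show ?thesis
    using cos_neg C by (intro set_integrable_exp_bound[of "- cos \<theta> / 2" _ C] continuous_intros)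
      (auto simp: norm_mult)
qed

text \<open>The Hankel contour consists of the ray and its mirror image in the real axis. The two
  contributions are conjugate, so 1/(2 pi i) times their difference is the imaginary part over pi,
  and the upper half alone is enough.\<close>

definition hankel :: "real \<Rightarrow> real" where
  "hankel z = Im (LBINT u:{0..}. exp (ray u) * ray u powr (of_real (- z)) * cis \<theta>) / pi"

text \<open>Integration by parts: the derivative of exp s s^(-z) combines the integrands for z and z
  + 1. It is the recursion satisfied by \<open>rGamma\<close>.\<close>

lemma hankel_rec: "hankel z = z * hankel (z + 1)"
proof -
  let ?f = "\<lambda>z u. exp (ray u) * ray u powr (of_real z) * cis \<theta>"
  define F where "F s = exp s * s powr (of_real (- z))" for s :: complex
  define f where "f s = exp s * s powr (of_real (- z)) + (- of_real z) * (exp s * s powr (of_real (- z - 1)))" for s :: complex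
  define S where "S = ray ` {0..}"
  obtain C1 where C1: "0 < C1" "\<And>u. 0 \<le> u \<Longrightarrow>
    norm (exp (ray u) * ray u powr (of_real (- z))) \<le> C1 * exp (- (- cos \<theta> / 2) * u)"
    using exp_powr_ray_bound by blast
  obtain C2 where C2: "0 < C2" "\<And>u. 0 \<le> u \<Longrightarrow>
    norm (exp (ray u) * ray u powr (of_real (- z - 1))) \<le> C2 * exp (- (- cos \<theta> / 2) * u)"
    using exp_powr_ray_bound by blast
  have A: "((\<lambda>u. F (ray u)) \<longlongrightarrow> F R + (LBINT u:{0..}. f (ray u) * cis \<theta>)) at_top"
    unfolding ray_def
  proof (rule primitive_along_ray(2)[where S = S and k = "- cos \<theta> / 2" and C = "C1 + \<bar>z\<bar> * C2"])
    fix s assume "s \<in> S"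
    then have "s \<notin> \<real>\<^sub>\<le>\<^sub>0" using ray_slit by (auto simp: S_def)
    then show "(F has_field_derivative f s) (at s within S)"
      unfolding F_def f_def
      by (auto intro!: derivative_eq_intros simp: algebra_simps)
  next
    fix u :: real assume u: "0 \<le> u"
    have "norm (f (ray u)) \<le> norm (exp (ray u) * ray u powr (of_real (- z))) + \<bar>z\<bar> * norm (exp (ray u) * ray u powr (of_real (- z - 1)))"
      unfolding f_def by (rule norm_triangle_le) (simp add: norm_mult)
    also have "\<dots> \<le> C1 * exp (- (- cos \<theta> / 2) * u) + \<bar>z\<bar> * (C2 * exp (- (- cos \<theta> / 2) * u))"
      by (intro add_mono mult_left_mono C1 C2 u) auto
    finally show "norm (f (of_real R + of_real u * cis \<theta>)) \<le> (C1 + \<bar>z\<bar> * C2) * exp (- (- cos \<theta> / 2) * u)"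
      by (simp add: algebra_simps ray_def)
  next
    show "continuous_on {0..} (\<lambda>u. f (of_real R + of_real u * cis \<theta>))"
      unfolding f_def ray_def[symmetric]
      by (intro continuous_on_add continuous_on_mult continuous_on_exp continuous_on_ray
          continuous_on_powr_ray continuous_on_const)
  qed (use cos_neg in \<open>auto simp: S_def ray_def[symmetric]\<close>)
  have B: "((\<lambda>u. F (ray u)) \<longlongrightarrow> 0) at_top"
  proof (rule Lim_null_comparison)
    show "eventually (\<lambda>u. norm (F (ray u)) \<le> C1 * exp (- (- cos \<theta> / 2) * u)) at_top"
      using eventually_ge_at_top[of 0] by eventually_elim (use C1 in \<open>auto simp: F_def\<close>)
    show "((\<lambda>u. C1 * exp (- (- cos \<theta> / 2) * u)) \<longlongrightarrow> 0) at_top"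
      using cos_neg C1(1) by real_asymp
  qed
  have "F R + (LBINT u:{0..}. f (ray u) * cis \<theta>) = 0"
    using tendsto_unique[OF _ A B] by simp
  moreover have "(LBINT u:{0..}. f (ray u) * cis \<theta>) =
      (LBINT u:{0..}. ?f (- z) u) - of_real z * (LBINT u:{0..}. ?f (- z - 1) u)"
  proof -
    have "(LBINT u:{0..}. f (ray u) * cis \<theta>) = (LBINT u:{0..}. ?f (- z) u - of_real z * ?f (- z - 1) u)"
      by (simp add: f_def algebra_simps)
    also have "\<dots> = (LBINT u:{0..}. ?f (- z) u) - (LBINT u:{0..}. of_real z * ?f (- z - 1) u)"
      by (intro set_integral_diff integrable_hankel set_integrable_mult_right)
    finally show ?thesis by simp
  qed
  \<comment> \<open>The boundary term at the real starting point R is real, so it disappears from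
    \<open>hankel\<close>.\<close>
  moreover have "Im (F R) = 0"
    unfolding F_def using R by (simp add: powr_of_real exp_of_real flip: of_real_minus of_real_mult)
  ultimately have "Im (LBINT u:{0..}. ?f (- z) u) = z * Im (LBINT u:{0..}. ?f (- z - 1) u)"
    by (simp add: complex_eq_iff)
  moreover have "- z - 1 = - (z + 1)" by simp
  ultimately show ?thesis
    unfolding hankel_def by (simp only: times_divide_eq_right)
qed


text \<open>
  The factors \<open>exp (\<i> a \<pi> / 2)\<close> and \<open>- \<i>\<close> rotate the branch cut of \<open>s powr a\<close> from the negative real axis to
  the negative imaginary axis, so that the function is continuous on the closed upper half plane.
\<close>

definition hankel_integrand :: "real \<Rightarrow> complex \<Rightarrow> complex" where
  "hankel_integrand a s = exp s * (exp (\<i> * of_real (a * pi / 2)) * (- \<i> * s) powr (of_real a))"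

text \<open>Here s has argument in [0, pi), and a quarter turn clockwise takes it to [- pi/2, pi/2)
  without crossing the cut of \<open>Ln\<close>.\<close>

lemma hankel_integrand_eq: "0 < Im s \<or> Im s = 0 \<and> 0 < Re s \<Longrightarrow> hankel_integrand a s = exp s * s powr (of_real a)"
proof -
  assume s: "0 < Im s \<or> Im s = 0 \<and> 0 < Re s"
  then have "s \<noteq> 0" by auto
  have "Ln (- \<i> * s) = Ln s - \<i> * of_real (pi / 2)"
    using s Ln_times_ii[of "- \<i> * s"] Ln_times_ii[of s] \<open>s \<noteq> 0\<close>
    by (auto simp: complex_eq_iff)
  then show ?thesis
    using \<open>s \<noteq> 0\<close> unfolding hankel_integrand_def powr_def by (simp add: exp_add[symmetric] right_diff_distrib)
qed

lemma hankel_integrand_neg: "0 < u \<Longrightarrow> hankel_integrand a (- of_real u) = of_real (exp (- u) * u powr a) * cis (pi * a)"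
proof -
  assume u: "0 < u"
  have "Ln (\<i> * of_real u) = of_real (ln u) + \<i> * of_real (pi / 2)"
    using u Ln_times_ii[of "of_real u"] by (simp add: Ln_of_real)
  then show ?thesis
    using u by (simp add: hankel_integrand_def powr_def cis_conv_exp exp_add[symmetric] exp_of_real[symmetric] algebra_simps)
qed

lemma norm_hankel_integrand: "norm (hankel_integrand a s) = exp (Re s) * norm s powr a"
  by (simp add: hankel_integrand_def norm_mult norm_powr_real_powr')

text \<open>At s = 0 the power is continuous only for a positive exponent. This is why the Hankel
  formula is first proved for negative z, where a = - z.\<close>

lemma continuous_on_hankel_integrand:
  assumes "0 < a"
  shows "continuous_on {s. 0 \<le> Im s} (hankel_integrand a)"
  unfolding hankel_integrand_def using assms
  by (intro continuous_intros continuous_on_powr_complex) auto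

text \<open>
  A primitive on the upper half plane compares the ray with the negative real axis, where the integral
  is a Gamma integral; the two start in \<open>R\<close> and \<open>0\<close>, and the integral from \<open>0\<close> to \<open>R\<close> is real.
\<close>

lemma hankel_eq_rGamma_neg:
  assumes "z < 0"
  shows "hankel z = rGamma z"
proof -
  define a where "a = - z"
  have a: "0 < a" using assms by (simp add: a_def)
  let ?S = "{s. 0 \<le> Im s}"
  have conv: "convex ?S" by (rule convex_halfspace_Im_ge)
  have cont: "continuous_on ?S (hankel_integrand a)" by (rule continuous_on_hankel_integrand[OF a])
  obtain g where g: "\<And>s. s \<in> ?S \<Longrightarrow> (g has_field_derivative hankel_integrand a s) (at s within ?S)"
  proof (rule holomorphic_convex_primitive[OF conv _ cont, of "{}"])
    fix s assume "s \<in> interior ?S - {}"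
    then have "0 < Im s" using interior_halfspace_ge[of \<i> 0] by (simp add: inner_complex_def)
    then have "- \<i> * s \<notin> \<real>\<^sub>\<le>\<^sub>0" by (auto simp: complex_nonpos_Reals_iff)
    then show "hankel_integrand a field_differentiable at s"
      unfolding hankel_integrand_def field_differentiable_def by (auto intro!: derivative_eq_intros)
  qed auto
  have ray_S: "of_real R + of_real u * cis \<theta> \<in> ?S" if "0 \<le> u" for u
    using that sin_pos by simp
  have uf: "hankel_integrand a (ray u) = exp (ray u) * ray u powr (of_real a)" if "0 \<le> u" for u
    using that sin_pos R by (intro hankel_integrand_eq) (auto simp: Re_ray Im_ray zero_less_mult_iff)
  obtain C1 where C1: "0 < C1" "\<And>u. 0 \<le> u \<Longrightarrow>
    norm (exp (ray u) * ray u powr (of_real a)) \<le> C1 * exp (- (- cos \<theta> / 2) * u)"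
    using exp_powr_ray_bound by blast
  have bd1: "norm (hankel_integrand a (of_real R + of_real u * cis \<theta>)) \<le> C1 * exp (- (- cos \<theta> / 2) * u)" if "0 \<le> u" for u
    unfolding ray_def[symmetric] uf[OF that] by (rule C1(2)[OF that])
  have P1: "((\<lambda>u. g (ray u)) \<longlongrightarrow> g R + (LBINT u:{0..}. hankel_integrand a (ray u) * cis \<theta>)) at_top"
    unfolding ray_def
  proof (rule primitive_along_ray(2)[where S = ?S and k = "- cos \<theta> / 2" and C = C1 and f = "hankel_integrand a" and g = g
        and a = "of_real R" and d = "cis \<theta>"])
    show "continuous_on {0..} (\<lambda>u. hankel_integrand a (of_real R + of_real u * cis \<theta>))"
      by (rule continuous_on_compose2[OF cont]) (intro continuous_intros, rule image_subsetI, rule ray_S, simp)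
    show "0 < - cos \<theta> / 2" using cos_neg by linarith
    show "(g has_field_derivative hankel_integrand a s) (at s within ?S)" if "s \<in> ?S" for s using that by (rule g)
    show "of_real R + of_real u * cis \<theta> \<in> ?S" if "0 \<le> u" for u using that by (rule ray_S)
  qed (rule bd1)
  have P2: "((\<lambda>u. g (0 + of_real u * (- 1))) \<longlongrightarrow> g 0 + (LBINT u:{0..}. hankel_integrand a (0 + of_real u * (- 1)) * (- 1))) at_top"
  proof (rule primitive_along_ray(2)[where S = ?S and k = "1/2" and C = "(a / (1/2)) powr a" and f = "hankel_integrand a" and g = g
        and a = 0 and d = "- 1"])
    fix u :: real assume u: "0 \<le> u"
    have "u powr a \<le> (a / (1/2)) powr a * exp (1/2 * u)" by (rule powr_le_exp) (use a u in auto)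
    from mult_left_mono[OF this, of "exp (- u)"]
    have "exp (- u) * u powr a \<le> (a / (1/2)) powr a * (exp (- u) * exp (1/2 * u))"
      by (simp add: mult_ac)
    also have "exp (- u) * exp (1/2 * u) = exp (- (1/2) * u)"
      by (simp flip: exp_add)
    finally show "norm (hankel_integrand a (0 + of_real u * (- 1))) \<le> (a / (1/2)) powr a * exp (- (1/2) * u)"
      using u by (simp add: norm_hankel_integrand)
  next
    show "continuous_on {0..} (\<lambda>u. hankel_integrand a (0 + of_real u * (- 1)))"
      by (rule continuous_on_compose2[OF cont]) (intro continuous_intros, auto)
    show "(g has_field_derivative hankel_integrand a s) (at s within ?S)" if "s \<in> ?S" for s using that by (rule g)
  qed simp_all
  \<comment> \<open>The far ends of the two paths are joined by a segment inside the half plane. Its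
    points have real part at most R - m u and its length is at most R + 2 u, so the exponential wins
    over length and power.\<close>
  have D: "((\<lambda>u. g (ray u) - g (- of_real u)) \<longlongrightarrow> 0) at_top"
  proof (rule Lim_null_comparison)
    define m where "m = min 1 (- cos \<theta>)"
    have m: "0 < m" "m \<le> 1" "m \<le> - cos \<theta>" using cos_neg by (auto simp: m_def)
    show "eventually (\<lambda>u. norm (g (ray u) - g (- of_real u)) \<le>
        exp (R - m * u) * (R + u) powr a * (R + 2 * u)) at_top"
      using eventually_ge_at_top[of 0]
    proof eventually_elim
      case (elim u)
      have T: "closed_segment (- of_real u) (ray u) \<subseteq> ?S"
        using elim sin_pos by (intro closed_segment_subset conv) (auto simp: Im_ray)
      have "norm (g (ray u) - g (- of_real u)) \<le> exp (R - m * u) * (R + u) powr a * norm (ray u - (- of_real u))"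
      proof (rule field_differentiable_bound[where S = "closed_segment (- of_real u) (ray u)" and f' = "hankel_integrand a"])
        fix s assume s: "s \<in> closed_segment (- of_real u) (ray u)"
        then show "(g has_field_derivative hankel_integrand a s) (at s within closed_segment (- of_real u) (ray u))"
          using T g by (blast intro: DERIV_subset)
        obtain t where t: "0 \<le> t" "t \<le> 1" "s = (1 - t) *\<^sub>R (- of_real u) + t *\<^sub>R ray u"
          using s by (auto simp: closed_segment_def)
        have "Re s = t * R - (1 - t) * u + t * (u * cos \<theta>)"
          unfolding t(3) by (simp add: Re_ray algebra_simps)
        also have "\<dots> \<le> R - (1 - t) * (m * u) - t * (m * u)"
        proof -
          have "t * R \<le> R" using t R by (simp add: mult_left_le_one_le)
          moreover have "(1 - t) * (m * u) \<le> (1 - t) * u"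
            using t m elim by (intro mult_left_mono) (auto simp: mult_left_le_one_le)
          moreover have "t * (u * cos \<theta>) \<le> t * (- (m * u))"
            using t m elim mult_right_mono[OF m(3) elim] by (intro mult_left_mono) (auto simp: mult_ac)
          ultimately show ?thesis by simp
        qed
        finally have "Re s \<le> R - m * u" by (simp add: algebra_simps)
        moreover have "norm s \<le> (1 - t) * u + t * (R + u)"
        proof -
          have "norm s \<le> norm ((1 - t) *\<^sub>R (- of_real u) :: complex) + norm (t *\<^sub>R ray u)"
            unfolding t(3) by (rule norm_triangle_ineq)
          also have "\<dots> \<le> (1 - t) * u + t * (R + u)"
            using t elim norm_ray_le[OF elim] by (auto simp: mult_left_mono)
          finally show ?thesis .
        qed
        moreover have "(1 - t) * u + t * (R + u) = u + t * R" by (simp add: algebra_simps)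
        moreover have "t * R \<le> R" using t R by (simp add: mult_left_le_one_le)
        ultimately have "Re s \<le> R - m * u" "norm s \<le> R + u" by linarith+
        then show "norm (hankel_integrand a s) \<le> exp (R - m * u) * (R + u) powr a"
          using a by (auto simp: norm_hankel_integrand intro!: mult_mono powr_mono2)
      qed auto
      also have "\<dots> \<le> exp (R - m * u) * (R + u) powr a * (R + 2 * u)"
        using norm_triangle_ineq[of "ray u" "of_real u"] norm_ray_le[OF elim] elim
        by (intro mult_left_mono) auto
      finally show ?case .
    qed
    show "((\<lambda>u. exp (R - m * u) * (R + u) powr a * (R + 2 * u)) \<longlongrightarrow> 0) at_top"
      using m(1) by real_asymp
  qed
  have "((\<lambda>u. g (ray u) - g (- of_real u)) \<longlongrightarrow>
      (g R + (LBINT u:{0..}. hankel_integrand a (ray u) * cis \<theta>)) - (g 0 + (LBINT u:{0..}. - hankel_integrand a (- of_real u)))) at_top"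
    using tendsto_diff[OF P1 P2] by simp
  from tendsto_unique[OF _ this D]
  have E: "(LBINT u:{0..}. hankel_integrand a (ray u) * cis \<theta>) = (LBINT u:{0..}. - hankel_integrand a (- of_real u)) - (g R - g 0)"
    by (simp add: algebra_simps)
  \<comment> \<open>The starting points differ by an integral over the real interval [0, R], where
    the integrand is real.\<close>
  have "Im (g R - g 0) = 0"
  proof -
    have "g (of_real R) - g (of_real 0) = (\<integral>u. indicator {0..R} u *\<^sub>R hankel_integrand a (of_real u) \<partial>lborel)"
    proof (rule integral_FTC_atLeastAtMost[symmetric])
      show "continuous_on {0..R} (\<lambda>u. hankel_integrand a (of_real u))"
        by (rule continuous_on_compose2[OF cont]) (intro continuous_intros, auto)
      fix u :: real
      have "(g has_field_derivative hankel_integrand a (of_real u)) (at (of_real u) within of_real ` {0..R})"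
        by (rule DERIV_subset[OF g]) auto
      then show "((\<lambda>u. g (of_real u)) has_vector_derivative hankel_integrand a (of_real u)) (at u within {0..R})"
        using field_vector_diff_chain_within[of of_real 1 u "{0..R}" g] has_vector_derivative_of_real[of "\<lambda>x. x" 1 "at u within {0..R}"]
        by (auto simp: o_def has_real_derivative_iff_has_vector_derivative)
    qed (use R in auto)
    also have "\<dots> = (\<integral>u. of_real (indicator {0..R} u * (exp u * u powr a)) \<partial>lborel)"
    proof (rule Bochner_Integration.integral_cong[OF refl])
      fix u :: real
      show "indicator {0..R} u *\<^sub>R hankel_integrand a (of_real u) = complex_of_real (indicator {0..R} u * (exp u * u powr a))"
        using hankel_integrand_eq[of "of_real u" a] a
        by (cases "u = 0") (auto simp: hankel_integrand_def powr_of_real exp_of_real split: split_indicator)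
    qed
    finally show ?thesis unfolding integral_complex_of_real by simp
  qed
  moreover have "(LBINT u:{0..}. - hankel_integrand a (- of_real u)) = of_real (- Gamma (a + 1)) * cis (pi * a)"
  proof -
    have nn: "(\<integral>\<^sup>+u. ennreal (indicator {0..} u * (exp (- u) * u powr a)) \<partial>lborel) = ennreal (Gamma (a + 1))"
      using a by (subst Gamma_conv_nn_integral_real) (auto simp: exp_minus field_simps intro!: nn_integral_cong)
    have "integral\<^sup>L lborel (\<lambda>u. indicator {0..} u * (exp (- u) * u powr a)) = Gamma (a + 1)"
      using nn a by (subst integral_eq_nn_integral) auto
    moreover have "(LBINT u:{0..}. - hankel_integrand a (- of_real u)) =
        (\<integral>u. - (of_real (indicator {0..} u * (exp (- u) * u powr a)) * cis (pi * a)) \<partial>lborel)"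
      unfolding set_lebesgue_integral_def
    proof (rule Bochner_Integration.integral_cong[OF refl])
      fix u :: real
      show "indicator {0..} u *\<^sub>R - hankel_integrand a (- of_real u) =
          - (of_real (indicator {0..} u * (exp (- u) * u powr a)) * cis (pi * a))"
        using hankel_integrand_neg[of u a] a by (cases "u = 0") (auto simp: hankel_integrand_def split: split_indicator)
    qed
    ultimately show ?thesis
      by (simp add: integral_complex_of_real flip: of_real_mult)
  qed
  moreover have "(LBINT u:{0..}. hankel_integrand a (ray u) * cis \<theta>) =
      (LBINT u:{0..}. exp (ray u) * ray u powr (of_real a) * cis \<theta>)"
    by (rule set_lebesgue_integral_cong) (auto simp: uf)
  ultimately have "hankel z = - Gamma (a + 1) * sin (pi * a) / pi"
    using E by (simp add: hankel_def a_def)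
  \<comment> \<open>This is the reflection formula at z = - a, with 1 - z = a + 1.\<close>
  also have "\<dots> = rGamma z"
  proof -
    have "complex_of_real (rGamma z * rGamma (1 - z)) = of_real (sin (pi * z) / pi)"
    proof -
      have "1 - complex_of_real z = of_real (1 - z)" by simp
      moreover have "sin (of_real pi * complex_of_real z) = of_real (sin (pi * z))"
        by (simp add: sin_of_real flip: of_real_mult)
      ultimately show ?thesis
        using rGamma_reflection_complex[of "of_real z"]
        by (simp only: rGamma_complex_of_real of_real_mult of_real_divide)
    qed
    then have "rGamma z * rGamma (1 - z) = sin (pi * z) / pi" using of_real_eq_iff by blast
    moreover have "rGamma (1 - z) = 1 / Gamma (a + 1)"
      by (simp add: rGamma_inverse_Gamma a_def inverse_eq_divide add.commute)
    moreover have "Gamma (a + 1) > 0" using a by (simp add: Gamma_real_pos)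
    ultimately show ?thesis by (simp add: a_def field_simps)
  qed
  finally show ?thesis .
qed

text \<open>Dominated convergence: the exponents stay in [-1, 0], and since the ray keeps the
  distance R sin \<theta> from 0, all these powers are bounded by \<open>?K\<close>. The offset 2
  keeps the arguments between 0 and 1 and different from 1.\<close>

lemma hankel_tendsto_1: "(\<lambda>n. hankel (1 - 1 / (real n + 2))) \<longlonglongrightarrow> hankel 1"
proof -
  let ?z = "\<lambda>n. 1 - 1 / (real n + 2)"
  let ?K = "1 + 1 / (R * sin \<theta>)"
  have Rs: "0 < R * sin \<theta>" using R sin_pos by simp
  have "(\<lambda>n. LBINT u:{0..}. exp (ray u) * ray u powr (of_real (- ?z n)) * cis \<theta>) \<longlonglongrightarrow>
      (LBINT u:{0..}. exp (ray u) * ray u powr (of_real (- 1)) * cis \<theta>)"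
    unfolding set_lebesgue_integral_def
  proof (rule integral_dominated_convergence)
    show "integrable lborel (\<lambda>u. indicator {0..} u * (exp R * ?K * exp (- (- cos \<theta>) * u)))"
      using set_integrable_mult_right[OF set_integrable_exp_decay[of "- cos \<theta>"], of "exp R * ?K"] cos_neg
      by (simp add: set_integrable_def)
    show "(\<lambda>u. indicator {0..} u *\<^sub>R (exp (ray u) * ray u powr (of_real (- 1)) * cis \<theta>)) \<in> borel_measurable lborel"
      using integrable_hankel[of "- 1"] unfolding set_integrable_def by (rule borel_measurable_integrable)
    show "(\<lambda>u. indicator {0..} u *\<^sub>R (exp (ray u) * ray u powr (of_real (- ?z n)) * cis \<theta>)) \<in> borel_measurable lborel" for n
      using integrable_hankel[of "- ?z n"] unfolding set_integrable_def by (rule borel_measurable_integrable)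
    show "AE u in lborel. (\<lambda>n. indicator {0..} u *\<^sub>R (exp (ray u) * ray u powr (of_real (- ?z n)) * cis \<theta>)) \<longlonglongrightarrow>
        indicator {0..} u *\<^sub>R (exp (ray u) * ray u powr (of_real (- 1)) * cis \<theta>)"
    proof (rule AE_I2)
      fix u
      have "(\<lambda>n. - ?z n) \<longlonglongrightarrow> - 1" by real_asymp
      then have "(\<lambda>n. exp (of_real (- ?z n) * Ln (ray u))) \<longlonglongrightarrow> exp (of_real (- 1) * Ln (ray u))"
        by (intro tendsto_exp tendsto_mult tendsto_of_real tendsto_const)
      then have "(\<lambda>n. ray u powr (of_real (- ?z n))) \<longlonglongrightarrow> ray u powr (of_real (- 1))"
        using ray_nonzero[of u] by (simp add: powr_def)
      then show "(\<lambda>n. indicator {0..} u *\<^sub>R (exp (ray u) * ray u powr (of_real (- ?z n)) * cis \<theta>)) \<longlonglongrightarrow>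
        indicator {0..} u *\<^sub>R (exp (ray u) * ray u powr (of_real (- 1)) * cis \<theta>)"
        by (intro tendsto_scaleR tendsto_mult tendsto_const)
    qed
    fix n
    have z: "0 \<le> ?z n" "?z n \<le> 1" by (auto simp: field_simps)
    show "AE u in lborel. norm (indicator {0..} u *\<^sub>R (exp (ray u) * ray u powr (of_real (- ?z n)) * cis \<theta>)) \<le>
        indicator {0..} u * (exp R * ?K * exp (- (- cos \<theta>) * u))"
    proof (rule AE_I2)
      fix u
      have "norm (ray u) powr (- ?z n) \<le> ?K"
      proof (cases "1 \<le> norm (ray u)")
        case True
        then have "norm (ray u) powr (- ?z n) \<le> norm (ray u) powr 0" using z by (intro powr_mono) auto
        then have "norm (ray u) powr (- ?z n) \<le> 1" using ray_nonzero[of u] by simp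
        moreover have "1 \<le> ?K" using Rs by simp
        ultimately show ?thesis by linarith
      next
        case False
        then have "norm (ray u) powr (- ?z n) \<le> norm (ray u) powr (- 1)"
          using z by (intro powr_mono') auto
        also have "\<dots> \<le> (R * sin \<theta>) powr (- 1)" using norm_ray_ge Rs by (intro powr_mono2') auto
        finally show ?thesis using Rs by (simp add: powr_minus inverse_eq_divide)
      qed
      from mult_left_mono[OF this, of "exp R * exp (cos \<theta> * u)"]
      show "norm (indicator {0..} u *\<^sub>R (exp (ray u) * ray u powr (of_real (- ?z n)) * cis \<theta>)) \<le>
        indicator {0..} u * (exp R * ?K * exp (- (- cos \<theta>) * u))"
        by (auto simp: norm_mult norm_exp_ray norm_powr_real_powr' mult_ac simp del: norm_exp_eq_Re split: split_indicator)
    qed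
  qed
  then show ?thesis
    unfolding hankel_def by (intro tendsto_intros) auto
qed

text \<open>At \<open>z = 1\<close> the recursion would divide by zero, hence the limit.\<close>

theorem hankel_eq_rGamma: "hankel z = rGamma z"
proof -
  \<comment> \<open>The recursion carries the formula from z - 1 to z, so each step lengthens the
    half line of validity by 1, starting from the negative numbers.\<close>
  have "\<forall>z < real n. hankel z = rGamma z" for n
  proof (induction n)
    case 0
    then show ?case using hankel_eq_rGamma_neg by simp
  next
    case (Suc n)
    have A: "hankel z = rGamma z" if "z < real (Suc n)" "z \<noteq> 1" for z
    proof -
      have "(z - 1) * hankel z = hankel (z - 1)" using hankel_rec[of "z - 1"] by simp
      also have "\<dots> = rGamma (z - 1)" using Suc that by simp
      also have "\<dots> = (z - 1) * rGamma z" using rGamma_plus1[of "z - 1"] by simp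
      finally show ?thesis using that by simp
    qed
    moreover have "hankel 1 = rGamma 1" if "1 < real (Suc n)"
    proof (rule LIMSEQ_unique[OF hankel_tendsto_1])
      have "hankel (1 - 1 / (real k + 2)) = rGamma (1 - 1 / (real k + 2))" for k
        using that by (intro A) (auto simp: field_simps intro: less_le_trans[of _ 1])
      moreover have "(\<lambda>k. 1 - 1 / (real k + 2)) \<longlonglongrightarrow> 1" by real_asymp
      then have "(\<lambda>k. rGamma (1 - 1 / (real k + 2))) \<longlonglongrightarrow> rGamma (1 :: real)"
        by (rule continuous_on_tendsto_compose[OF continuous_on_rGamma[of UNIV]]) auto
      ultimately show "(\<lambda>k. hankel (1 - 1 / (real k + 2))) \<longlonglongrightarrow> rGamma 1" by simp
    qed
    ultimately show ?case by metis
  qed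
  moreover obtain n where "z < real n" using reals_Archimedean2 by blast
  ultimately show ?thesis by blast
qed

end

section \<open>The Laplace transform of the M-function\<close>

text \<open>The threshold e^(-1/(1-b)) is where x^b and e x cross. Because b < 1 the slope e may be
  as small as desired; this lets exp (r |\<sigma>|^\<beta>) be absorbed by the decay of exp \<sigma>
  for any fixed r.\<close>

lemma powr_le_linear:
  fixes b e x :: real
  assumes "0 < b" "b < 1" "0 < e" "0 \<le> x"
  shows "x powr b \<le> e * x + (e powr (- 1 / (1 - b))) powr b"
proof (cases "x \<le> e powr (- 1 / (1 - b))")
  case True
  then have "x powr b \<le> (e powr (- 1 / (1 - b))) powr b" using assms by (intro powr_mono2) auto
  then show ?thesis using assms by (simp add: add_increasing)
next
  case False
  then have "0 < x" using powr_ge_zero[of e "- 1 / (1 - b)"] by linarith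
  have "x powr (b - 1) \<le> (e powr (- 1 / (1 - b))) powr (b - 1)"
    using False assms by (intro powr_mono2') auto
  also have "\<dots> = e"
  proof -
    have "- 1 / (1 - b) * (b - 1) = 1" using assms by (simp add: field_simps)
    then show ?thesis using assms by (simp only: powr_powr powr_one)
  qed
  finally have "x powr (b - 1) * x \<le> e * x" using \<open>0 < x\<close> by simp
  also have "x powr (b - 1) * x = x powr b" using \<open>0 < x\<close> by (simp add: powr_diff)
  finally show ?thesis by (simp add: add_increasing2)
qed

lemma set_integral_sum:
  fixes f :: "'i \<Rightarrow> 'a \<Rightarrow> 'b::{banach, second_countable_topology}"
  assumes "\<And>i. i \<in> I \<Longrightarrow> set_integrable M A (f i)"
  shows "(LINT x:A|M. (\<Sum>i\<in>I. f i x)) = (\<Sum>i\<in>I. LINT x:A|M. f i x)"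
  using assms unfolding set_lebesgue_integral_def set_integrable_def
  by (simp add: scaleR_sum_right)

lemma integral_exp_complex:
  fixes c :: complex
  assumes "0 < Re c"
  shows "set_integrable lborel {0..} (\<lambda>r. exp (- c * of_real r))"
    and "(LBINT r:{0..}. exp (- c * of_real r)) = 1 / c"
proof -
  have c: "c \<noteq> 0" using assms by auto
  let ?f = "\<lambda>z. exp (- c * z)" and ?g = "\<lambda>z. - exp (- c * z) / c"
  have g: "(?g has_field_derivative ?f s) (at s within UNIV)" for s
    using c by (auto intro!: derivative_eq_intros)
  have ct: "continuous_on {0..} (\<lambda>u. ?f (0 + of_real u * 1))" by (intro continuous_intros)
  have bd: "norm (?f (0 + of_real u * 1)) \<le> 1 * exp (- Re c * u)" for u by simp
  note P = primitive_along_ray[where S = UNIV and f = ?f and g = ?g and a = 0 and d = 1, OF g UNIV_I ct assms bd]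
  from P(1) show "set_integrable lborel {0..} (\<lambda>r. exp (- c * of_real r))" by simp
  have "((\<lambda>u. ?g (0 + of_real u * 1)) \<longlongrightarrow> 0) at_top"
  proof (rule Lim_null_comparison)
    show "eventually (\<lambda>u. norm (?g (0 + of_real u * 1)) \<le> exp (- Re c * u) / norm c) at_top"
      by (simp add: norm_divide)
    show "((\<lambda>u. exp (- Re c * u) / norm c) \<longlongrightarrow> 0) at_top" using assms c by real_asymp
  qed
  from tendsto_unique[OF _ P(2) this]
  have "- (1 / c) + (LBINT u:{0..}. ?f (0 + of_real u * 1) * 1) = 0" by simp
  then have "(LBINT u:{0..}. ?f (0 + of_real u * 1) * 1) = 1 / c" by (simp add: add_eq_0_iff)
  then show "(LBINT r:{0..}. exp (- c * of_real r)) = 1 / c" by simp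
qed

text \<open>With \<beta> \<theta> < pi/2 the powers \<sigma>^\<beta> of the points of the ray stay
  in the right half plane, so that exp (- r \<sigma>^\<beta>) decays in r.\<close>

locale hankel_ray_power = hankel_ray +
  fixes \<beta> :: real
  assumes \<beta>: "0 < \<beta>" "\<beta> < 1" and \<beta>\<theta>: "\<beta> * \<theta> < pi / 2"
begin

text \<open>With \<sigma> = \<open>ray u\<close> this is exp \<sigma> \<sigma>^(\<beta>-1) d\<sigma>
  in the parameter u; \<open>cis \<theta>\<close> is the derivative of \<open>ray\<close>.\<close>

definition E :: "real \<Rightarrow> complex" where "E u = exp (ray u) * ray u powr (of_real (\<beta> - 1)) * cis \<theta>"
definition w :: "real \<Rightarrow> complex" where "w u = ray u powr (of_real \<beta>)"
text \<open>A lower bound for the modulus of \<open>w\<close>, needed for the geometric series;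
  \<open>\<delta>\<close> below is one for its real part, needed for the integral in r.\<close>

definition c0 :: real where "c0 = (R * sin \<theta>) powr \<beta>"
definition \<delta> :: real where "\<delta> = c0 * cos (\<beta> * \<theta>)"

lemma c0_pos: "0 < c0" unfolding c0_def using R sin_pos by simp

lemma norm_w: "norm (w u) = norm (ray u) powr \<beta>" by (simp add: w_def norm_powr_real_powr')

lemma w_nonzero: "w u \<noteq> 0" using ray_nonzero by (simp add: w_def)

lemma norm_w_ge: "c0 \<le> norm (w u)"
  unfolding c0_def norm_w using R sin_pos \<beta> norm_ray_ge by (intro powr_mono2) auto

lemma norm_w_le: "0 \<le> u \<Longrightarrow> norm (w u) \<le> (R + u) powr \<beta>"
  unfolding norm_w using \<beta> norm_ray_le by (intro powr_mono2) auto

lemma \<delta>_pos: "0 < \<delta>"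
proof -
  have "0 < \<beta> * \<theta>" using \<beta> \<theta> pi_half_gt_zero by (intro mult_pos_pos) auto
  then show ?thesis unfolding \<delta>_def using c0_pos \<beta>\<theta> by (intro mult_pos_pos cos_gt_zero_pi) auto
qed

lemma Re_w_ge: "0 \<le> u \<Longrightarrow> \<delta> \<le> Re (w u)"
proof -
  assume u: "0 \<le> u"
  have "w u = exp (of_real \<beta> * Ln (ray u))" using ray_nonzero[of u] by (simp add: w_def powr_def)
  then have "Re (w u) = norm (w u) * cos (\<beta> * Arg (ray u))"
    using ray_nonzero[of u] by (simp add: Re_exp Arg_eq_Im_Ln)
  moreover have "cos (\<beta> * \<theta>) \<le> cos (\<beta> * Arg (ray u))"
  proof (rule cos_monotone_0_pi_le)
    show "0 \<le> \<beta> * Arg (ray u)" "\<beta> * Arg (ray u) \<le> \<beta> * \<theta>" using Arg_ray[OF u] \<beta> by auto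
    show "\<beta> * \<theta> \<le> pi" using \<beta>\<theta> pi_half_gt_zero by linarith
  qed
  moreover have "0 \<le> cos (\<beta> * \<theta>)" using \<delta>_pos c0_pos by (auto simp: \<delta>_def zero_less_mult_iff)
  ultimately show ?thesis
    unfolding \<delta>_def using norm_w_ge c0_pos by (auto intro!: mult_mono)
qed

lemma continuous_on_w: "continuous_on {0..} w"
  unfolding w_def by (rule continuous_on_powr_ray)

lemma continuous_on_E: "continuous_on {0..} E"
  unfolding E_def by (intro continuous_on_mult continuous_on_exp continuous_on_ray continuous_on_powr_ray continuous_on_const)

lemma integrable_E: "set_integrable lborel {0..} E"
  unfolding E_def by (rule integrable_hankel)

text \<open>The right-hand side is the integrand of \<open>hankel\<close> at the
  \<open>rGamma\<close> argument of the k-th term of \<open>M_function\<close>.\<close>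

lemma E_times_w_power: "E u * w u ^ k = exp (ray u) * ray u powr (of_real (- (- \<beta> * real k + (1 - \<beta>)))) * cis \<theta>"
proof -
  have "- (- \<beta> * real k + (1 - \<beta>)) = (\<beta> - 1) + real k * \<beta>" by (simp add: algebra_simps)
  then show ?thesis
    using ray_nonzero[of u]
    by (simp add: E_def w_def powr_def exp_add[symmetric] exp_of_nat_mult[symmetric] algebra_simps)
qed

text \<open>The counterpart for the Mittag-Leffler series: the integrand of \<open>hankel\<close> at
  \<beta> n + 1.\<close>

lemma E_div_w_power: "E u / w u ^ Suc n = exp (ray u) * ray u powr (of_real (- (\<beta> * real n + 1))) * cis \<theta>"
proof -
  have "- (\<beta> * real n + 1) = (\<beta> - 1) - real (Suc n) * \<beta>" by (simp add: algebra_simps)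
  then show ?thesis
    using ray_nonzero[of u]
    by (simp add: E_def w_def powr_def exp_diff exp_minus exp_add exp_of_nat_mult[symmetric] field_simps)
qed

text \<open>This majorises all partial sums of the exponential series at once. Of the decay rate -
  cos \<theta>, half goes to the power in \<open>E\<close>, a quarter to the exponential of r |w|,
  and a quarter is left.\<close>

lemma E_exp_bound:
  assumes "0 \<le> r"
  obtains C where "\<And>u. 0 \<le> u \<Longrightarrow> norm (E u) * exp (r * norm (w u)) \<le> C * exp (- (- cos \<theta> / 4) * u)"
proof -
  obtain C1 where C1: "0 < C1" "\<And>u. 0 \<le> u \<Longrightarrow>
    norm (exp (ray u) * ray u powr (of_real (\<beta> - 1))) \<le> C1 * exp (- (- cos \<theta> / 2) * u)"
    using exp_powr_ray_bound by blast
  \<comment> \<open>The slope for \<open>powr_le_linear\<close>: r e is at most the quarter of the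
    rate that may be spent; r + 1 instead of r covers r = 0.\<close>
  define e where "e = - cos \<theta> / 4 / (r + 1)"
  have e: "0 < e" "r * e \<le> - cos \<theta> / 4" using cos_neg assms by (auto simp: e_def field_simps)
  define K where "K = (e powr (- 1 / (1 - \<beta>))) powr \<beta>"
  show thesis
  proof (rule that[of "C1 * exp (r * (e * R + K))"])
    fix u :: real assume u: "0 \<le> u"
    have "norm (w u) \<le> e * (R + u) + K"
      using powr_le_linear[OF \<beta> e(1), of "R + u"] R u norm_w_le[OF u] by (simp add: K_def)
    then have "r * norm (w u) \<le> r * (e * (R + u) + K)" using assms by (rule mult_left_mono)
    also have "\<dots> \<le> - cos \<theta> / 4 * u + r * (e * R + K)"
      using mult_right_mono[OF e(2) u] by (simp add: algebra_simps)
    finally have "exp (r * norm (w u)) \<le> exp (- cos \<theta> / 4 * u) * exp (r * (e * R + K))"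
      by (simp flip: exp_add)
    moreover have "norm (E u) \<le> C1 * exp (- (- cos \<theta> / 2) * u)"
      using C1(2)[OF u] by (simp add: E_def norm_mult)
    ultimately have "norm (E u) * exp (r * norm (w u)) \<le>
        (C1 * exp (- (- cos \<theta> / 2) * u)) * (exp (- cos \<theta> / 4 * u) * exp (r * (e * R + K)))"
      by (intro mult_mono) (use C1 in auto)
    also have "\<dots> = C1 * exp (r * (e * R + K)) * (exp (- (- cos \<theta> / 2) * u) * exp (- cos \<theta> / 4 * u))"
      by (simp add: mult_ac)
    also have "exp (- (- cos \<theta> / 2) * u) * exp (- cos \<theta> / 4 * u) = exp (- (- cos \<theta> / 4) * u)"
      by (simp flip: exp_add)
    finally show "norm (E u) * exp (r * norm (w u)) \<le> C1 * exp (r * (e * R + K)) * exp (- (- cos \<theta> / 4) * u)" .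
  qed
qed

text \<open>Expanding exp (- r w) under the integral gives, by \<open>hankel_eq_rGamma\<close>, the
  defining series term by term. The convergence of that series is a by-product.\<close>

lemma M_function_eq_integral:
  assumes r: "0 \<le> r"
  shows "M_function \<beta> r = Im (LBINT u:{0..}. E u * exp (- of_real r * w u)) / pi"
proof -
  obtain C where C: "\<And>u. 0 \<le> u \<Longrightarrow> norm (E u) * exp (r * norm (w u)) \<le> C * exp (- (- cos \<theta> / 4) * u)"
    using E_exp_bound[OF r] by blast
  let ?t = "\<lambda>k u. E u * ((- of_real r * w u) ^ k /\<^sub>R fact k)"
  have ct: "continuous_on {0..} (\<lambda>u. \<Sum>k<n. ?t k u)" for n
    by (intro continuous_intros continuous_on_E continuous_on_w)
  have lim: "(\<lambda>n. LBINT u:{0..}. \<Sum>k<n. ?t k u) \<longlonglongrightarrow> (LBINT u:{0..}. E u * exp (- of_real r * w u))"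
    unfolding set_lebesgue_integral_def
  proof (rule integral_dominated_convergence)
    show "integrable lborel (\<lambda>u. indicator {0..} u * (C * exp (- (- cos \<theta> / 4) * u)))"
      using set_integrable_mult_right[OF set_integrable_exp_decay[of "- cos \<theta> / 4"], of C] cos_neg
      by (simp add: set_integrable_def)
    have "continuous_on {0..} (\<lambda>u. E u * exp (- of_real r * w u))"
      by (intro continuous_intros continuous_on_E continuous_on_w)
    from borel_measurable_continuous_on_indicator[OF _ this]
    show "(\<lambda>u. indicator {0..} u *\<^sub>R (E u * exp (- of_real r * w u))) \<in> borel_measurable lborel" by simp
    show "(\<lambda>u. indicator {0..} u *\<^sub>R (\<Sum>k<n. ?t k u)) \<in> borel_measurable lborel" for n
      using borel_measurable_continuous_on_indicator[OF _ ct] by simp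
    show "AE u in lborel. (\<lambda>n. indicator {0..} u *\<^sub>R (\<Sum>k<n. ?t k u)) \<longlonglongrightarrow>
        indicator {0..} u *\<^sub>R (E u * exp (- of_real r * w u))"
    proof (rule AE_I2)
      fix u
      show "(\<lambda>n. indicator {0..} u *\<^sub>R (\<Sum>k<n. ?t k u)) \<longlonglongrightarrow> indicator {0..} u *\<^sub>R (E u * exp (- of_real r * w u))"
        using exp_converges[of "- of_real r * w u"] unfolding sum_distrib_left[symmetric] sums_def
        by (intro tendsto_scaleR tendsto_mult tendsto_const)
    qed
    fix n
    show "AE u in lborel. norm (indicator {0..} u *\<^sub>R (\<Sum>k<n. ?t k u)) \<le> indicator {0..} u * (C * exp (- (- cos \<theta> / 4) * u))"
    proof (rule AE_I2)
      fix u :: real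
      have "norm (\<Sum>k<n. ?t k u) \<le> C * exp (- (- cos \<theta> / 4) * u)" if u: "0 \<le> u"
      proof -
        have "norm (\<Sum>k<n. (- of_real r * w u) ^ k /\<^sub>R fact k) \<le> (\<Sum>k<n. (r * norm (w u)) ^ k /\<^sub>R fact k)"
          by (rule sum_norm_le) (use r in \<open>simp add: norm_mult norm_power divide_inverse power_mult_distrib\<close>)
        also have "\<dots> \<le> exp (r * norm (w u))"
          unfolding exp_def by (rule sum_le_suminf[OF summable_exp_generic]) (use r in auto)
        finally have "norm (E u * (\<Sum>k<n. (- of_real r * w u) ^ k /\<^sub>R fact k)) \<le> norm (E u) * exp (r * norm (w u))"
          by (simp add: norm_mult mult_left_mono)
        then show ?thesis using C[OF u] by (simp add: sum_distrib_left)
      qed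
      then show "norm (indicator {0..} u *\<^sub>R (\<Sum>k<n. ?t k u)) \<le> indicator {0..} u * (C * exp (- (- cos \<theta> / 4) * u))"
        by (auto split: split_indicator)
    qed
  qed
  have int: "set_integrable lborel {0..} (\<lambda>u. E u * w u ^ k)" for k
    unfolding E_times_w_power by (rule integrable_hankel)
  have "Im (LBINT u:{0..}. \<Sum>k<n. ?t k u) / pi = (\<Sum>k<n. (- r) ^ k / fact k * rGamma (- \<beta> * real k + (1 - \<beta>)))" for n
  proof -
    have "(LBINT u:{0..}. \<Sum>k<n. ?t k u) = (LBINT u:{0..}. \<Sum>k<n. of_real ((- r) ^ k / fact k) * (E u * w u ^ k))"
      unfolding power_mult_distrib by (simp add: scaleR_conv_of_real divide_inverse mult_ac)
    also have "\<dots> = (\<Sum>k<n. of_real ((- r) ^ k / fact k) * (LBINT u:{0..}. E u * w u ^ k))"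
      using int by (simp add: set_integral_sum set_integrable_mult_right flip: set_integral_mult_right)
    finally have *: "(LBINT u:{0..}. \<Sum>k<n. ?t k u) = (\<Sum>k<n. of_real ((- r) ^ k / fact k) * (LBINT u:{0..}. E u * w u ^ k))" .
    have "Im (LBINT u:{0..}. E u * w u ^ k) / pi = rGamma (- \<beta> * real k + (1 - \<beta>))" for k
      using hankel_eq_rGamma[of "- \<beta> * real k + (1 - \<beta>)"] unfolding E_times_w_power hankel_def .
    moreover have "Im (of_real a * z) / pi = a * (Im z / pi)" for a z by simp
    ultimately show ?thesis
      unfolding * by (simp only: Im_sum sum_divide_distrib)
  qed
  then have "(\<lambda>k. (- r) ^ k / fact k * rGamma (- \<beta> * real k + (1 - \<beta>))) sums (Im (LBINT u:{0..}. E u * exp (- of_real r * w u)) / pi)"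
    unfolding sums_def using tendsto_divide[OF tendsto_Im[OF lim] tendsto_const[of pi]] by simp
  then show ?thesis unfolding M_function_def by (rule sums_unique[symmetric])
qed

text \<open>Fubini's theorem moves the integral in r inside, where it gives 1 / (s + w). Since s <
  \<open>c0\<close> \<le> |w|, this expands into a geometric series in s / w, whose terms integrate
  to the reciprocal Gamma values of the Mittag-Leffler series.\<close>

lemma
  assumes s: "0 \<le> s" "s < c0"
  shows set_integrable_exp_M_function: "set_integrable lborel {0..} (\<lambda>r. exp (- s * r) * M_function \<beta> r)"
    and laplace_M_function: "(LBINT r:{0..}. exp (- s * r) * M_function \<beta> r) = mittag_leffler \<beta> (- s)"
proof -
  \<comment> \<open>Extension by 0 to the whole line, so that measurability and Fubini's theorem can
    be used on the full plane.\<close>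
  define E' where "E' u = indicator {0..} u *\<^sub>R E u" for u
  define W where "W u = indicator {0..} u *\<^sub>R w u" for u
  have [measurable]: "E' \<in> borel_measurable borel" "W \<in> borel_measurable borel"
    unfolding E'_def W_def using continuous_on_E continuous_on_w
    by (auto intro!: borel_measurable_continuous_on_indicator)
  have iE': "integrable lborel E'" using integrable_E by (simp add: set_integrable_def E'_def[abs_def])
  define G where "G u r = E' u * (indicator {0..} r *\<^sub>R exp (- (of_real s + W u) * of_real r))" for u r
  have G0: "G u r = 0" if "u < 0" for u r using that by (simp add: G_def E'_def)
  have Re: "0 < Re (of_real s + w u)" if "0 \<le> u" for u using Re_w_ge[OF that] \<delta>_pos s by simp
  have G_r: "integrable lborel (G u)" "(\<integral>r. G u r \<partial>lborel) = E' u / (of_real s + W u)" for u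
  proof -
    have "integrable lborel (G u) \<and> (\<integral>r. G u r \<partial>lborel) = E' u / (of_real s + W u)"
    proof (cases "0 \<le> u")
      case True
      note I = integral_exp_complex[OF Re[OF True]]
      have "G u = (\<lambda>r. E u * (indicator {0..} r *\<^sub>R exp (- (of_real s + w u) * of_real r)))"
        using True by (simp add: G_def E'_def W_def fun_eq_iff)
      moreover have "integrable lborel (\<lambda>r. E u * (indicator {0..} r *\<^sub>R exp (- (of_real s + w u) * of_real r)))"
        using I(1) unfolding set_integrable_def by (rule integrable_mult_right)
      moreover have "(\<integral>r. E u * (indicator {0..} r *\<^sub>R exp (- (of_real s + w u) * of_real r)) \<partial>lborel) =
          E u * (1 / (of_real s + w u))"
        using I(2) unfolding set_lebesgue_integral_def by (simp only: integral_mult_right_zero)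
      moreover have "E u * (1 / (of_real s + w u)) = E' u / (of_real s + W u)"
        using True by (simp add: E'_def W_def)
      ultimately show ?thesis by simp
    next
      case False
      then have "G u = (\<lambda>r. 0)" by (simp add: G0 fun_eq_iff)
      then show ?thesis using False by (simp add: E'_def)
    qed
    then show "integrable lborel (G u)" "(\<integral>r. G u r \<partial>lborel) = E' u / (of_real s + W u)" by auto
  qed
  \<comment> \<open>The decay in r comes from Re w \<ge> \<delta> alone, so s = 0 is included; that
    case later yields the total mass of \<open>M_function\<close>.\<close>
  have G_le: "norm (G u r) \<le> norm (E' u) * (indicator {0..} r * exp (- \<delta> * r))" for u r
  proof (cases "0 \<le> u \<and> 0 \<le> r")
    case True
    have "exp (- (s + Re (w u)) * r) \<le> exp (- \<delta> * r)"
      using mult_right_mono[of "- (s + Re (w u))" "- \<delta>" r] Re_w_ge[of u] s True by simp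
    then show ?thesis using True by (simp add: G_def W_def norm_mult mult_left_mono)
  qed (auto simp: G_def E'_def split: split_indicator)
  have iexp: "integrable lborel (\<lambda>r. indicator {0..} r * exp (- \<delta> * r))"
    using set_integrable_exp_decay[OF \<delta>_pos] by (simp add: set_integrable_def)
  have iG: "integrable (lborel \<Otimes>\<^sub>M lborel) (\<lambda>(u, r). G u r)"
  proof (rule lborel_pair.Fubini_integrable)
    show meas: "(\<lambda>(u, r). G u r) \<in> borel_measurable (lborel \<Otimes>\<^sub>M lborel)"
      unfolding G_def by measurable
    show "integrable lborel (\<lambda>u. \<integral>r. norm (case (u, r) of (u, r) \<Rightarrow> G u r) \<partial>lborel)"
    proof (rule Bochner_Integration.integrable_bound)
      show "integrable lborel (\<lambda>u. norm (E' u) * (\<integral>r. indicator {0..} r * exp (- \<delta> * r) \<partial>lborel))"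
        using iE' by auto
      show "(\<lambda>u. \<integral>r. norm (case (u, r) of (u, r) \<Rightarrow> G u r) \<partial>lborel) \<in> borel_measurable lborel"
        unfolding G_def by measurable
      show "AE u in lborel. norm (\<integral>r. norm (case (u, r) of (u, r) \<Rightarrow> G u r) \<partial>lborel) \<le>
          norm (norm (E' u) * (\<integral>r. indicator {0..} r * exp (- \<delta> * r) \<partial>lborel))"
      proof (rule AE_I2)
        fix u
        have "(\<integral>r. norm (G u r) \<partial>lborel) \<le> (\<integral>r. norm (E' u) * (indicator {0..} r * exp (- \<delta> * r)) \<partial>lborel)"
          using G_r(1) iexp G_le by (intro integral_mono) auto
        then show "norm (\<integral>r. norm (case (u, r) of (u, r) \<Rightarrow> G u r) \<partial>lborel) \<le>
          norm (norm (E' u) * (\<integral>r. indicator {0..} r * exp (- \<delta> * r) \<partial>lborel))"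
          by (auto intro: order_trans[OF _ abs_ge_self])
      qed
    qed
    show "AE u in lborel. integrable lborel (\<lambda>r. case (u, r) of (u, r) \<Rightarrow> G u r)"
      using G_r(1) by simp
  qed
  have M_eq: "indicator {0..} r * (exp (- s * r) * M_function \<beta> r) = Im (\<integral>u. G u r \<partial>lborel) / pi" for r
  proof (cases "0 \<le> r")
    case True
    have "(\<integral>u. G u r \<partial>lborel) = (\<integral>u. of_real (exp (- s * r)) * (indicator {0..} u *\<^sub>R (E u * exp (- of_real r * w u))) \<partial>lborel)"
      by (rule Bochner_Integration.integral_cong)
        (use True in \<open>auto simp: G_def E'_def W_def exp_of_real[symmetric] exp_add[symmetric] algebra_simps split: split_indicator\<close>)
    also have "\<dots> = of_real (exp (- s * r)) * (LBINT u:{0..}. E u * exp (- of_real r * w u))"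
      unfolding set_lebesgue_integral_def by (rule integral_mult_right_zero)
    finally show ?thesis using True by (simp add: M_function_eq_integral del: of_real_exp)
  qed (simp add: G_def)
  show "set_integrable lborel {0..} (\<lambda>r. exp (- s * r) * M_function \<beta> r)"
    unfolding set_integrable_def real_scaleR_def M_eq
    using lborel_pair.integrable_snd[OF iG] by (intro integrable_divide integrable_Im) auto
  have "(LBINT r:{0..}. exp (- s * r) * M_function \<beta> r) = (\<integral>r. Im (\<integral>u. G u r \<partial>lborel) / pi \<partial>lborel)"
    unfolding set_lebesgue_integral_def real_scaleR_def M_eq ..
  also have "\<dots> = Im (\<integral>r. \<integral>u. G u r \<partial>lborel \<partial>lborel) / pi"
    using lborel_pair.integrable_snd[OF iG] by (simp add: integral_Im)
  also have "(\<integral>r. \<integral>u. G u r \<partial>lborel \<partial>lborel) = (\<integral>u. \<integral>r. G u r \<partial>lborel \<partial>lborel)"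
    by (rule lborel_pair.Fubini_integral[OF iG])
  also have "\<dots> = (LBINT u:{0..}. E u / (of_real s + w u))"
    unfolding G_r set_lebesgue_integral_def
    by (rule Bochner_Integration.integral_cong) (auto simp: E'_def W_def split: split_indicator)
  finally have L: "(LBINT r:{0..}. exp (- s * r) * M_function \<beta> r) = Im (LBINT u:{0..}. E u / (of_real s + w u)) / pi" .
  \<comment> \<open>The terms of E / (s + w) expanded in powers of - s / w; the modulus of this
    ratio is at most q = s / \<open>c0\<close> < 1 for all u.\<close>
  let ?t = "\<lambda>n u. of_real ((- s) ^ n) * (E u / w u ^ Suc n)"
  define q where "q = s / c0"
  have q: "0 \<le> q" "q < 1" using s c0_pos by (auto simp: q_def)
  have qn: "norm (- of_real s / w u) \<le> q" for u
    using s c0_pos norm_w_ge[of u] by (auto simp: q_def norm_divide intro!: divide_left_mono mult_pos_pos)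
  have t_eq: "?t n u = E u / w u * (- of_real s / w u) ^ n" for n u
    unfolding power_divide by simp
  have int: "set_integrable lborel {0..} (\<lambda>u. E u / w u ^ Suc n)" for n
    unfolding E_div_w_power by (rule integrable_hankel)
  have ct: "continuous_on {0..} (\<lambda>u. \<Sum>k<n. ?t k u)" for n
    using w_nonzero by (intro continuous_intros continuous_on_E continuous_on_w) auto
  have lim: "(\<lambda>n. LBINT u:{0..}. \<Sum>k<n. ?t k u) \<longlonglongrightarrow> (LBINT u:{0..}. E u / (of_real s + w u))"
    unfolding set_lebesgue_integral_def
  proof (rule integral_dominated_convergence)
    show "integrable lborel (\<lambda>u. norm (E' u) * (1 / c0 * (1 / (1 - q))))" using iE' by auto
    have "of_real s + w u \<noteq> 0" if "0 \<le> u" for u using Re[OF that] by (metis less_irrefl zero_complex.sel(1))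
    then have "continuous_on {0..} (\<lambda>u. E u / (of_real s + w u))"
      by (intro continuous_intros continuous_on_E continuous_on_w) auto
    from borel_measurable_continuous_on_indicator[OF _ this]
    show "(\<lambda>u. indicator {0..} u *\<^sub>R (E u / (of_real s + w u))) \<in> borel_measurable lborel" by simp
    show "(\<lambda>u. indicator {0..} u *\<^sub>R (\<Sum>k<n. ?t k u)) \<in> borel_measurable lborel" for n
      using borel_measurable_continuous_on_indicator[OF _ ct] by simp
    show "AE u in lborel. (\<lambda>n. indicator {0..} u *\<^sub>R (\<Sum>k<n. ?t k u)) \<longlonglongrightarrow> indicator {0..} u *\<^sub>R (E u / (of_real s + w u))"
    proof (rule AE_I2)
      fix u
      have "(\<lambda>n. (- of_real s / w u) ^ n) sums (1 / (1 - (- of_real s / w u)))"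
        by (rule geometric_sums) (use qn[of u] q in linarith)
      then have "(\<lambda>n. \<Sum>k<n. ?t k u) \<longlonglongrightarrow> E u / w u * (1 / (1 - (- of_real s / w u)))"
        unfolding t_eq sum_distrib_left[symmetric] sums_def by (intro tendsto_mult tendsto_const)
      also have "E u / w u * (1 / (1 - (- of_real s / w u))) = E u / (of_real s + w u)"
        using w_nonzero[of u] by (simp add: field_simps)
      finally show "(\<lambda>n. indicator {0..} u *\<^sub>R (\<Sum>k<n. ?t k u)) \<longlonglongrightarrow> indicator {0..} u *\<^sub>R (E u / (of_real s + w u))"
        by (intro tendsto_scaleR tendsto_const)
    qed
    fix n
    show "AE u in lborel. norm (indicator {0..} u *\<^sub>R (\<Sum>k<n. ?t k u)) \<le> norm (E' u) * (1 / c0 * (1 / (1 - q)))"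
    proof (rule AE_I2)
      fix u :: real
      have "norm (\<Sum>k<n. (- of_real s / w u) ^ k) \<le> (\<Sum>k<n. q ^ k)"
        by (rule sum_norm_le) (simp only: norm_power, rule power_mono[OF qn norm_ge_zero])
      also have "\<dots> \<le> 1 / (1 - q)"
        using q sum_le_suminf[of "\<lambda>k. q ^ k" "{..<n}"] by (simp add: suminf_geometric summable_geometric)
      finally have "norm (\<Sum>k<n. (- of_real s / w u) ^ k) \<le> 1 / (1 - q)" .
      moreover have "norm (E u / w u) \<le> norm (E u) * (1 / c0)"
        using norm_w_ge[of u] c0_pos w_nonzero[of u]
        by (auto simp: norm_divide intro!: divide_left_mono mult_pos_pos)
      ultimately have "norm (\<Sum>k<n. ?t k u) \<le> norm (E u) * (1 / c0) * (1 / (1 - q))"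
        unfolding t_eq sum_distrib_left[symmetric] norm_mult using c0_pos by (intro mult_mono) auto
      then show "norm (indicator {0..} u *\<^sub>R (\<Sum>k<n. ?t k u)) \<le> norm (E' u) * (1 / c0 * (1 / (1 - q)))"
        by (auto simp: E'_def split: split_indicator)
    qed
  qed
  have "Im (LBINT u:{0..}. \<Sum>k<n. ?t k u) / pi = (\<Sum>k<n. (- s) ^ k / Gamma (\<beta> * real k + 1))" for n
  proof -
    have *: "(LBINT u:{0..}. \<Sum>k<n. ?t k u) = (\<Sum>k<n. of_real ((- s) ^ k) * (LBINT u:{0..}. E u / w u ^ Suc k))"
      unfolding set_integral_mult_right[symmetric]
      by (rule set_integral_sum) (intro set_integrable_mult_right int)
    have "Im (LBINT u:{0..}. E u / w u ^ Suc k) / pi = rGamma (\<beta> * real k + 1)" for k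
      using hankel_eq_rGamma[of "\<beta> * real k + 1"] unfolding E_div_w_power hankel_def .
    moreover have "Im (of_real a * z) / pi = a * (Im z / pi)" for a z by simp
    moreover have "a * rGamma z = a / Gamma z" for a z :: real
      by (simp add: rGamma_inverse_Gamma divide_inverse)
    ultimately show ?thesis
      unfolding * by (simp only: Im_sum sum_divide_distrib)
  qed
  then have "(\<lambda>k. (- s) ^ k / Gamma (\<beta> * real k + 1)) sums (Im (LBINT u:{0..}. E u / (of_real s + w u)) / pi)"
    unfolding sums_def using tendsto_divide[OF tendsto_Im[OF lim] tendsto_const[of pi]] by simp
  then show "(LBINT r:{0..}. exp (- s * r) * M_function \<beta> r) = mittag_leffler \<beta> (- s)"
    unfolding L mittag_leffler_def by (rule sums_unique)
qed

end

theorem M_function_laplace_transform: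
  fixes \<beta> s :: real
  assumes "0 < \<beta>" "\<beta> < 1" "0 \<le> s"
  shows "set_integrable lborel {0..} (\<lambda>r. exp (- s * r) * M_function \<beta> r)"
    and "(LBINT r:{0..}. exp (- s * r) * M_function \<beta> r) = mittag_leffler \<beta> (- s)"
proof -
  \<comment> \<open>The admissible angles form the interval from pi/2 to t, which is non-empty
    because \<beta> < 1; \<theta> is its midpoint.\<close>
  define t where "t = min pi (pi / (2 * \<beta>))"
  have t: "pi / 2 < t" "t \<le> pi" "t \<le> pi / (2 * \<beta>)" using assms by (auto simp: t_def field_simps)
  define \<theta> where "\<theta> = (pi / 2 + t) / 2"
  have \<theta>: "pi / 2 < \<theta>" "\<theta> < pi" "\<theta> < pi / (2 * \<beta>)" using t by (auto simp: \<theta>_def)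
  then have "\<beta> * \<theta> < pi / 2" using assms by (simp add: field_simps)
  have "0 < sin \<theta>" using \<theta> pi_half_gt_zero by (intro sin_gt_zero) linarith+
  \<comment> \<open>This choice makes \<open>c0\<close> equal to s + 1, hence larger than s.\<close>
  define R where "R = (s + 1) powr (1 / \<beta>) / sin \<theta>"
  have R: "0 < R" using assms \<open>0 < sin \<theta>\<close> by (simp add: R_def)
  interpret hankel_ray_power R \<theta> \<beta>
    by unfold_locales (use R \<theta> assms \<open>\<beta> * \<theta> < pi / 2\<close> in auto)
  have "R * sin \<theta> = (s + 1) powr (1 / \<beta>)" using \<open>0 < sin \<theta>\<close> by (simp add: R_def)
  then have "s < c0" using assms by (simp add: c0_def powr_powr)
  with assms(3) show "set_integrable lborel {0..} (\<lambda>r. exp (- s * r) * M_function \<beta> r)"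
    and "(LBINT r:{0..}. exp (- s * r) * M_function \<beta> r) = mittag_leffler \<beta> (- s)"
    by (rule set_integrable_exp_M_function laplace_M_function)+
qed

section \<open>The scale mixture of Gaussians\<close>

lemma mittag_leffler_0: "mittag_leffler \<beta> 0 = 1"
  using powser_zero[of "\<lambda>n. 1 / Gamma (\<beta> * real n + 1)"] by (simp add: mittag_leffler_def)

lemma M_law_laplace:
  fixes \<beta> s :: real
  assumes N: "prob_space N" and \<beta>: "0 < \<beta>" "\<beta> \<le> 1" and law: "M_law N \<beta> L" and s: "0 \<le> s"
  shows "(\<integral>\<omega>. exp (- s * L \<omega>) \<partial>N) = mittag_leffler \<beta> (- s)"
proof -
  interpret N: prob_space N by fact
  have [measurable]: "L \<in> borel_measurable N" using law by (simp add: M_law_def)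
  show ?thesis
  proof (cases "\<beta> = 1")
    case True
    then have D: "distr N borel L = return borel 1" using law by (simp add: M_law_def)
    have "(\<integral>\<omega>. exp (- s * L \<omega>) \<partial>N) = (\<integral>x. exp (- s * x) \<partial>distr N borel L)"
      by (simp add: integral_distr)
    also have "\<dots> = exp (- s)" unfolding D by (subst integral_return) auto
    \<comment> \<open>For \<beta> = 1 the Gamma values are factorials and the Mittag-Leffler series
      is the exponential series.\<close>
    also have "\<dots> = mittag_leffler \<beta> (- s)"
      using Gamma_fact[where 'a = real] unfolding True mittag_leffler_def exp_def
      by (simp add: add.commute divide_inverse mult.commute)
    finally show ?thesis .
  next
    case False
    then have \<beta>1: "\<beta> < 1" using \<beta> by simp
    let ?M = "\<lambda>\<tau>. indicator {0..} \<tau> * M_function \<beta> \<tau>"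
    have D: "distributed N lborel L (\<lambda>\<tau>. ennreal (?M \<tau>))" using law False by (simp add: M_law_def)
    note LT = M_function_laplace_transform[OF \<beta>(1) \<beta>1]
    have i0: "integrable lborel ?M" and I0: "(\<integral>\<tau>. ?M \<tau> \<partial>lborel) = 1"
      using LT[of 0] by (simp_all add: set_integrable_def set_lebesgue_integral_def mittag_leffler_0)
    have is': "integrable lborel (\<lambda>\<tau>. ?M \<tau> * exp (- s * \<tau>))"
      and Is: "(\<integral>\<tau>. ?M \<tau> * exp (- s * \<tau>) \<partial>lborel) = mittag_leffler \<beta> (- s)"
      using LT[OF s] by (simp_all add: set_integrable_def set_lebesgue_integral_def mult_ac)
    \<comment> \<open>The density in \<open>M_law\<close> truncates negative values to 0, but both the truncated and the true function
      have integral 1.\<close>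
    have M_pos: "AE \<tau> in lborel. 0 \<le> ?M \<tau>"
    proof -
      have "(\<integral>\<^sup>+\<tau>. ennreal (max 0 (?M \<tau>)) \<partial>lborel) = (\<integral>\<^sup>+\<tau>. ennreal (?M \<tau>) * 1 \<partial>lborel)"
        by (intro nn_integral_cong) (simp add: ennreal_max_0)
      also have "\<dots> = (\<integral>\<^sup>+\<omega>. 1 \<partial>N)" by (rule distributed_nn_integral[OF D]) simp
      also have "\<dots> = 1" by (simp add: N.emeasure_space_1)
      finally have "(\<integral>\<^sup>+\<tau>. ennreal (max 0 (?M \<tau>)) \<partial>lborel) = 1" .
      moreover have imax: "integrable lborel (\<lambda>\<tau>. max 0 (?M \<tau>))" using i0 by simp
      ultimately have "(\<integral>\<tau>. max 0 (?M \<tau>) \<partial>lborel) = 1"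
        by (subst integral_eq_nn_integral) auto
      then have "(\<integral>\<tau>. max 0 (?M \<tau>) - ?M \<tau> \<partial>lborel) = 0"
        using i0 imax I0 by (subst Bochner_Integration.integral_diff) auto
      then have "AE \<tau> in lborel. max 0 (?M \<tau>) - ?M \<tau> = 0"
        using i0 imax by (subst (asm) integral_nonneg_eq_0_iff_AE) auto
      then show ?thesis by eventually_elim (simp add: max_def split: if_splits)
    qed
    have "(\<integral>\<^sup>+\<omega>. ennreal (exp (- s * L \<omega>)) \<partial>N) = (\<integral>\<^sup>+\<tau>. ennreal (?M \<tau>) * ennreal (exp (- s * \<tau>)) \<partial>lborel)"
      by (rule distributed_nn_integral[OF D, symmetric]) simp
    also have "\<dots> = (\<integral>\<^sup>+\<tau>. ennreal (?M \<tau> * exp (- s * \<tau>)) \<partial>lborel)"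
      by (simp add: ennreal_mult'')
    also have "\<dots> = ennreal (\<integral>\<tau>. ?M \<tau> * exp (- s * \<tau>) \<partial>lborel)"
      by (rule nn_integral_eq_integral[OF is']) (use M_pos in \<open>eventually_elim, auto\<close>)
    finally have nn: "(\<integral>\<^sup>+\<omega>. ennreal (exp (- s * L \<omega>)) \<partial>N) = ennreal (mittag_leffler \<beta> (- s))"
      unfolding Is .
    have "0 \<le> mittag_leffler \<beta> (- s)"
      unfolding Is[symmetric] by (rule integral_nonneg_AE) (use M_pos in \<open>eventually_elim, auto\<close>)
    then show ?thesis using nn by (subst integral_eq_nn_integral) auto
  qed
qed

text \<open>Dominated convergence in the Laplace transform of L, with majorant 1 as L is
  non-negative; no estimate of the coefficients of the power series is needed.\<close>

lemma M_law_mittag_leffler_continuous: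
  fixes \<beta> :: real
  assumes N: "prob_space N" and \<beta>: "0 < \<beta>" "\<beta> \<le> 1" and law: "M_law N \<beta> L"
    and pos: "AE \<omega> in N. 0 \<le> L \<omega>" and s: "\<And>n. 0 \<le> s n" "s \<longlonglongrightarrow> s0"
  shows "(\<lambda>n. mittag_leffler \<beta> (- s n)) \<longlonglongrightarrow> mittag_leffler \<beta> (- s0)"
proof -
  interpret N: prob_space N by fact
  have [measurable]: "L \<in> borel_measurable N" using law by (simp add: M_law_def)
  have "0 \<le> s0" using s by (intro LIMSEQ_le_const[OF s(2)]) auto
  have "(\<lambda>n. \<integral>\<omega>. exp (- s n * L \<omega>) \<partial>N) \<longlonglongrightarrow> (\<integral>\<omega>. exp (- s0 * L \<omega>) \<partial>N)"
  proof (rule integral_dominated_convergence[where w = "\<lambda>_. 1"])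
    show "AE \<omega> in N. (\<lambda>n. exp (- s n * L \<omega>)) \<longlonglongrightarrow> exp (- s0 * L \<omega>)"
      by (intro AE_I2 tendsto_intros s)
    show "AE \<omega> in N. norm (exp (- s n * L \<omega>)) \<le> 1" for n
      using pos by eventually_elim (use s(1) in auto)
  qed auto
  then show ?thesis
    by (simp only: M_law_laplace[OF N \<beta> law s(1)] M_law_laplace[OF N \<beta> law \<open>0 \<le> s0\<close>])
qed

text \<open>Allowing \<sigma> = 0 here puts constants and variables with a normal density under the
  same formulas.\<close>

lemma gaussian_rv_cases:
  assumes "prob_space M" "gaussian_rv M Z"
  obtains m \<sigma> :: real where "integrable M Z" "integrable M (\<lambda>x. (Z x)\<^sup>2)"
    "(\<integral>x. Z x \<partial>M) = m" "(\<integral>x. (Z x)\<^sup>2 \<partial>M) = m\<^sup>2 + \<sigma>\<^sup>2"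
    "\<And>y. (\<integral>x. iexp (y * Z x) \<partial>M) = iexp (y * m) * of_real (exp (- (\<sigma>\<^sup>2 * y\<^sup>2) / 2))"
proof -
  interpret prob_space M by fact
  have Z[measurable]: "Z \<in> borel_measurable M" using assms(2) by (simp add: gaussian_rv_def)
  consider m \<sigma> where "0 < \<sigma>" "distributed M lborel Z (\<lambda>x. ennreal (normal_density m \<sigma> x))"
    | m where "distr M borel Z = return borel m"
    using assms(2) by (auto simp: gaussian_rv_def)
  then show thesis
  proof cases
    case 1
    define U where "U x = (Z x - m) / \<sigma>" for x
    have [measurable]: "U \<in> borel_measurable M" unfolding U_def by measurable
    have ZU: "Z x = m + \<sigma> * U x" for x using 1 by (simp add: U_def)
    have "distributed M lborel U (\<lambda>x. ennreal (std_normal_density x))"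
      using 1 normal_standard_normal_convert[of \<sigma> Z m] by (simp add: U_def[abs_def])
    then have "distr M lborel U = std_normal_distribution" by (simp add: distributed_def)
    then have D: "distr M borel U = std_normal_distribution" by (simp cong: distr_cong)
    have moment: "integrable M (\<lambda>x. U x ^ k)" for k
      using integrable_std_normal_distribution_moment[of k] unfolding D[symmetric] by (simp add: integrable_distr_eq)
    have iU: "integrable M U" "integrable M (\<lambda>x. (U x)\<^sup>2)" using moment[of 1] moment[of 2] by auto
    have U1: "(\<integral>x. U x \<partial>M) = 0"
      using integral_std_normal_distribution_moment_odd[of 1] unfolding D[symmetric] by (simp add: integral_distr)
    have U2: "(\<integral>x. (U x)\<^sup>2 \<partial>M) = 1"
      using std_normal_distribution_even_moments[of 1] unfolding D[symmetric]
      by (simp add: has_bochner_integral_iff integral_distr)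
    have Z2: "(Z x)\<^sup>2 = m\<^sup>2 + 2 * m * \<sigma> * U x + \<sigma>\<^sup>2 * (U x)\<^sup>2" for x
      unfolding ZU by (simp add: power2_eq_square algebra_simps)
    show thesis
    proof (rule that[of m \<sigma>])
      show "integrable M Z" using iU unfolding ZU[abs_def] by auto
      show "integrable M (\<lambda>x. (Z x)\<^sup>2)" using iU unfolding Z2 by auto
      show "(\<integral>x. Z x \<partial>M) = m" using iU U1 unfolding ZU[abs_def] by (simp add: prob_space)
      show "(\<integral>x. (Z x)\<^sup>2 \<partial>M) = m\<^sup>2 + \<sigma>\<^sup>2" using iU U1 U2 unfolding Z2 by (simp add: prob_space)
      fix y
      have "(\<integral>x. iexp (y * Z x) \<partial>M) = (\<integral>x. iexp (y * m) * iexp (y * \<sigma> * U x) \<partial>M)"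
        unfolding ZU by (simp add: exp_add[symmetric] algebra_simps)
      also have "\<dots> = iexp (y * m) * (\<integral>x. iexp (y * \<sigma> * U x) \<partial>M)" by (rule integral_mult_right_zero)
      also have "(\<integral>x. iexp (y * \<sigma> * U x) \<partial>M) = char (distr M borel U) (y * \<sigma>)"
        by (simp add: char_def integral_distr)
      also have "\<dots> = of_real (exp (- (\<sigma>\<^sup>2 * y\<^sup>2) / 2))"
        unfolding D char_std_normal_distribution by (simp add: power_mult_distrib mult.commute)
      finally show "(\<integral>x. iexp (y * Z x) \<partial>M) = iexp (y * m) * of_real (exp (- (\<sigma>\<^sup>2 * y\<^sup>2) / 2))" .
    qed
  next
    case 2
    have "AE x in distr M borel Z. x = m" unfolding 2 by (simp add: AE_return)
    then have ae: "AE x in M. Z x = m" by (simp add: AE_distr_iff)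
    have int_c: "integral\<^sup>L M f = c" if "f \<in> borel_measurable M" "AE x in M. f x = c"
      for f :: "'a \<Rightarrow> complex" and c
      using that integral_cong_AE[of f M "\<lambda>_. c"] by (auto simp: prob_space)
    have ae2: "AE x in M. (Z x)\<^sup>2 = m\<^sup>2" using ae by eventually_elim simp
    show thesis
    proof (rule that[of m 0])
      show "integrable M Z" "integrable M (\<lambda>x. (Z x)\<^sup>2)"
        using ae ae2 integrable_cong_AE[of Z M "\<lambda>_. m"] integrable_cong_AE[of "\<lambda>x. (Z x)\<^sup>2" M "\<lambda>_. m\<^sup>2"] by auto
      show "(\<integral>x. Z x \<partial>M) = m" "(\<integral>x. (Z x)\<^sup>2 \<partial>M) = m\<^sup>2 + 0\<^sup>2"
        using ae ae2 integral_cong_AE[of Z M "\<lambda>_. m"] integral_cong_AE[of "\<lambda>x. (Z x)\<^sup>2" M "\<lambda>_. m\<^sup>2"]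
        by (auto simp: prob_space)
      show "(\<integral>x. iexp (y * Z x) \<partial>M) = iexp (y * m) * of_real (exp (- (0\<^sup>2 * y\<^sup>2) / 2))" for y
        using ae by (subst int_c[of _ "iexp (y * m)"]) auto
    qed
  qed
qed

lemma centered_gaussian_rv_char:
  assumes "prob_space M" "gaussian_rv M Z" "(\<integral>x. Z x \<partial>M) = 0"
  shows "(\<integral>x. iexp (y * Z x) \<partial>M) = of_real (exp (- (y\<^sup>2 * (\<integral>x. (Z x)\<^sup>2 \<partial>M)) / 2))"
proof -
  obtain m \<sigma> where "(\<integral>x. Z x \<partial>M) = m" "(\<integral>x. (Z x)\<^sup>2 \<partial>M) = m\<^sup>2 + \<sigma>\<^sup>2"
    "\<And>y. (\<integral>x. iexp (y * Z x) \<partial>M) = iexp (y * m) * of_real (exp (- (\<sigma>\<^sup>2 * y\<^sup>2) / 2))"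
    using gaussian_rv_cases[OF assms(1,2)] by metis
  then show ?thesis using assms(3) by (simp add: mult.commute)
qed

text \<open>The quantity Q: the quadratic form of the covariance of the fractional Brownian motion.
  That it is non-negative is not visible from the formula and follows from its being a
  variance.\<close>

definition fBm_form :: "real \<Rightarrow> real set \<Rightarrow> (real \<Rightarrow> real) \<Rightarrow> real" where
  "fBm_form \<alpha> J c = (\<Sum>s\<in>J. \<Sum>t\<in>J. c s * c t * (s powr \<alpha> + t powr \<alpha> - \<bar>s - t\<bar> powr \<alpha>))"

text \<open>The covariance condition prescribes values of integrals but not integrability. The
  latter comes from the Gaussian law of each \<open>X t\<close>, regarded as a linear combination
  with one term.\<close>

lemma standard_fBm_linear_combination:
  fixes c :: "real \<Rightarrow> real"
  assumes "standard_fBm \<alpha> N X" "finite J" "J \<subseteq> {0..}"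
  defines "Z \<equiv> \<lambda>\<omega>. \<Sum>t\<in>J. c t * X t \<omega>"
  shows "gaussian_rv N Z" "(\<integral>\<omega>. Z \<omega> \<partial>N) = 0" "(\<integral>\<omega>. (Z \<omega>)\<^sup>2 \<partial>N) = fBm_form \<alpha> J c"
proof -
  have gp: "gaussian_process N X" using assms(1) by (simp add: standard_fBm_def)
  then have N: "prob_space N" by (simp add: gaussian_process_def)
  show "gaussian_rv N Z" using gp assms(2,3) by (simp add: gaussian_process_def Z_def)
  have X: "gaussian_rv N (X t)" if "t \<in> J" for t
  proof -
    have "gaussian_rv N (\<lambda>\<omega>. \<Sum>u\<in>{t}. 1 * X u \<omega>)"
      using gp that assms(3) unfolding gaussian_process_def by (elim conjE allE[of _ "{t}"] allE[of _ "\<lambda>_. 1"]) auto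
    then show ?thesis by simp
  qed
  have iX: "integrable N (X t)" if "t \<in> J" for t
    by (rule gaussian_rv_cases[OF N X[OF that]])
  have iX2: "integrable N (\<lambda>\<omega>. (X t \<omega>)\<^sup>2)" if "t \<in> J" for t
    by (rule gaussian_rv_cases[OF N X[OF that]])
  have iXX: "integrable N (\<lambda>\<omega>. X s \<omega> * X t \<omega>)" if "s \<in> J" "t \<in> J" for s t
  proof (rule Bochner_Integration.integrable_bound)
    show "integrable N (\<lambda>\<omega>. (X s \<omega>)\<^sup>2 + (X t \<omega>)\<^sup>2)" using iX2 that by simp
    show "(\<lambda>\<omega>. X s \<omega> * X t \<omega>) \<in> borel_measurable N" using iX that by (intro borel_measurable_times) auto
    have "\<bar>a * b\<bar> \<le> \<bar>a\<^sup>2 + b\<^sup>2\<bar>" for a b :: real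
    proof -
      have "0 \<le> \<bar>a\<bar> * \<bar>b\<bar>" by simp
      then show ?thesis using sum_squares_bound[of "\<bar>a\<bar>" "\<bar>b\<bar>"] unfolding abs_mult power2_abs by linarith
    qed
    then show "AE \<omega> in N. norm (X s \<omega> * X t \<omega>) \<le> norm ((X s \<omega>)\<^sup>2 + (X t \<omega>)\<^sup>2)" by simp
  qed
  show "(\<integral>\<omega>. Z \<omega> \<partial>N) = 0"
    using iX assms unfolding Z_def standard_fBm_def
    by (subst Bochner_Integration.integral_sum) (auto intro!: sum.neutral)
  have "(Z \<omega>)\<^sup>2 = (\<Sum>s\<in>J. \<Sum>t\<in>J. c s * c t * (X s \<omega> * X t \<omega>))" for \<omega>
    by (simp add: Z_def power2_eq_square sum_product mult_ac)
  then have "(\<integral>\<omega>. (Z \<omega>)\<^sup>2 \<partial>N) = (\<Sum>s\<in>J. \<Sum>t\<in>J. c s * c t * (\<integral>\<omega>. X s \<omega> * X t \<omega> \<partial>N))"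
    using iXX by simp
  also have "\<dots> = fBm_form \<alpha> J c"
    unfolding fBm_form_def using assms(1,3) by (auto simp: standard_fBm_def subset_eq intro!: sum.cong)
  finally show "(\<integral>\<omega>. (Z \<omega>)\<^sup>2 \<partial>N) = fBm_form \<alpha> J c" .
qed

text \<open>A finite combination is measurable with respect to the sigma-algebra generated by the
  whole process, so its own sigma-algebra inherits the independence from L.\<close>

lemma indep_of_process_linear_combination:
  assumes N: "prob_space N" and L: "L \<in> borel_measurable N" and X: "\<And>t. 0 \<le> t \<Longrightarrow> X t \<in> borel_measurable N"
    and indep: "indep_of_process N L X" and J: "J \<subseteq> {0..}"
  shows "prob_space.indep_var N borel L borel (\<lambda>\<omega>. \<Sum>t\<in>J. c t * X t \<omega>)"
proof -
  interpret prob_space N by fact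
  let ?Z = "\<lambda>\<omega>. \<Sum>t\<in>J. c t * X t \<omega>"
  let ?V = "vimage_algebra (space N) (\<lambda>\<omega>. \<lambda>t\<in>{0..}. X t \<omega>) (Pi\<^sub>M {0..} (\<lambda>_. borel))"
  have *: "(\<lambda>\<omega>. \<lambda>t\<in>{0..}. X t \<omega>) \<in> ?V \<rightarrow>\<^sub>M Pi\<^sub>M {0..} (\<lambda>_. borel)"
    by (rule measurable_vimage_algebra1) (auto simp: space_PiM)
  have "X t \<in> borel_measurable ?V" if "t \<in> J" for t
  proof -
    have "t \<in> {0..}" using J that by auto
    from measurable_compose[OF * measurable_component_singleton[OF this]] this
    show ?thesis by simp
  qed
  then have Z: "?Z \<in> borel_measurable ?V" by measurable
  have sub: "sigma_sets (space N) {?Z -` A \<inter> space N |A. A \<in> sets borel} \<subseteq> sets ?V"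
  proof -
    have "{?Z -` A \<inter> space N |A. A \<in> sets borel} \<subseteq> sets ?V"
      using measurable_sets[OF Z] by auto
    then show ?thesis using sets.sigma_sets_subset[of _ ?V] by simp
  qed
  have I: "indep_set (sets (vimage_algebra (space N) L borel)) (sets ?V)"
    using indep by (simp add: indep_of_process_def)
  have "indep_set (sigma_sets (space N) {L -` A \<inter> space N |A. A \<in> sets borel})
      (sigma_sets (space N) {?Z -` A \<inter> space N |A. A \<in> sets borel})"
    using I sub unfolding indep_sets2_eq sets_vimage_algebra[of _ L] by blast
  moreover have "?Z \<in> borel_measurable N" using X J by (auto intro!: borel_measurable_sum)
  ultimately show ?thesis unfolding indep_var_eq using L by simp
qed

text \<open>By independence the joint law of L and Z is a product, so the inner integral at fixed l
  is the characteristic function of a centred Gaussian at sqrt l.\<close>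

lemma scale_mixture_char:
  fixes L Z :: "'a \<Rightarrow> real"
  assumes N: "prob_space N" and Z: "gaussian_rv N Z" "(\<integral>x. Z x \<partial>N) = 0"
    and indep: "prob_space.indep_var N borel L borel Z" and pos: "AE \<omega> in N. 0 \<le> L \<omega>"
  shows "(\<integral>\<omega>. iexp (sqrt (L \<omega>) * Z \<omega>) \<partial>N) = of_real (\<integral>\<omega>. exp (- ((\<integral>x. (Z x)\<^sup>2 \<partial>N) / 2) * L \<omega>) \<partial>N)"
proof -
  interpret N: prob_space N by fact
  let ?q = "\<integral>x. (Z x)\<^sup>2 \<partial>N"
  have L[measurable]: "L \<in> borel_measurable N" and Zm[measurable]: "Z \<in> borel_measurable N"
    using indep by (auto dest: N.indep_var_rv1 N.indep_var_rv2)
  let ?DL = "distr N borel L" and ?DZ = "distr N borel Z"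
  interpret DL: prob_space ?DL by (rule N.prob_space_distr) simp
  interpret DZ: prob_space ?DZ by (rule N.prob_space_distr) simp
  interpret P: pair_prob_space ?DL ?DZ ..
  have joint: "distr N (borel \<Otimes>\<^sub>M borel) (\<lambda>\<omega>. (L \<omega>, Z \<omega>)) = ?DL \<Otimes>\<^sub>M ?DZ"
    using indep N.indep_var_distribution_eq[of borel L borel Z] by simp
  have "(\<integral>\<omega>. iexp (sqrt (L \<omega>) * Z \<omega>) \<partial>N) =
      (\<integral>p. iexp (sqrt (fst p) * snd p) \<partial>distr N (borel \<Otimes>\<^sub>M borel) (\<lambda>\<omega>. (L \<omega>, Z \<omega>)))"
    by (subst integral_distr) auto
  also have "\<dots> = (\<integral>p. (case p of (l, z) \<Rightarrow> iexp (sqrt l * z)) \<partial>(?DL \<Otimes>\<^sub>M ?DZ))"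
    unfolding joint by (simp add: case_prod_beta')
  also have "\<dots> = (\<integral>l. \<integral>z. iexp (sqrt l * z) \<partial>?DZ \<partial>?DL)"
  proof (rule P.integral_fst[symmetric])
    have "sets (?DL \<Otimes>\<^sub>M ?DZ) = sets (borel \<Otimes>\<^sub>M borel)" by (intro sets_pair_measure_cong) auto
    then have [measurable_cong]: "sets (?DL \<Otimes>\<^sub>M ?DZ) = sets (borel \<Otimes>\<^sub>M borel)" .
    show "integrable (?DL \<Otimes>\<^sub>M ?DZ) (\<lambda>(l, z). iexp (sqrt l * z))"
      by (rule P.integrable_const_bound[of _ 1]) auto
  qed
  also have "\<dots> = (\<integral>\<omega>. \<integral>x. iexp (sqrt (L \<omega>) * Z x) \<partial>N \<partial>N)"
    by (subst integral_distr, simp, simp)+ simp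
  also have "\<dots> = (\<integral>\<omega>. of_real (exp (- ((sqrt (L \<omega>))\<^sup>2 * ?q) / 2)) \<partial>N)"
    by (simp only: centered_gaussian_rv_char[OF N Z])
  \<comment> \<open>The square of sqrt L is L only where L is non-negative, hence almost
    everywhere.\<close>
  also have "\<dots> = (\<integral>\<omega>. of_real (exp (- (?q / 2) * L \<omega>)) \<partial>N)"
    by (rule integral_cong_AE) (use pos in \<open>auto elim!: eventually_mono simp: mult.commute\<close>)
  finally show ?thesis unfolding integral_complex_of_real .
qed

lemma scaled_fBm_char:
  assumes N: "prob_space N" and \<beta>: "0 < \<beta>" "\<beta> \<le> 1" and X: "standard_fBm \<alpha> N X"
    and pos: "AE \<omega> in N. 0 \<le> L \<omega>" and law: "M_law N \<beta> L" and indep: "indep_of_process N L X"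
    and J: "finite J" "J \<subseteq> {0..}"
  shows "(\<integral>\<omega>. iexp (\<Sum>t\<in>J. c t * (sqrt (L \<omega>) * X t \<omega>)) \<partial>N) = of_real (mittag_leffler \<beta> (- (fBm_form \<alpha> J c / 2)))"
proof -
  let ?Z = "\<lambda>\<omega>. \<Sum>t\<in>J. c t * X t \<omega>"
  note Z = standard_fBm_linear_combination[OF X J, of c]
  have L: "L \<in> borel_measurable N" using law by (simp add: M_law_def)
  have Xm: "X t \<in> borel_measurable N" if "0 \<le> t" for t
    using X that by (simp add: standard_fBm_def gaussian_process_def)
  have "0 \<le> fBm_form \<alpha> J c" unfolding Z(3)[symmetric] by simp
  have "(\<integral>\<omega>. iexp (\<Sum>t\<in>J. c t * (sqrt (L \<omega>) * X t \<omega>)) \<partial>N) = (\<integral>\<omega>. iexp (sqrt (L \<omega>) * ?Z \<omega>) \<partial>N)"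
    by (simp add: sum_distrib_left mult_ac)
  also have "\<dots> = of_real (\<integral>\<omega>. exp (- (fBm_form \<alpha> J c / 2) * L \<omega>) \<partial>N)"
    unfolding Z(3)[symmetric]
    by (rule scale_mixture_char[OF N Z(1,2) indep_of_process_linear_combination[OF N L Xm indep J(2)] pos])
  also have "(\<integral>\<omega>. exp (- (fBm_form \<alpha> J c / 2) * L \<omega>) \<partial>N) = mittag_leffler \<beta> (- (fBm_form \<alpha> J c / 2))"
    by (rule M_law_laplace[OF N \<beta> law]) (use \<open>0 \<le> fBm_form \<alpha> J c\<close> in simp)
  finally show ?thesis .
qed

section \<open>The normalising integral\<close>

lemma nn_integral_Gamma_scaled:
  fixes s x :: real
  assumes "0 < s" "0 < x"
  shows "(\<integral>\<^sup>+u. ennreal (indicator {0<..} u * (u powr (s - 1) * exp (- x * u))) \<partial>lborel) = ennreal (Gamma s * x powr (- s))"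
proof -
  have "ennreal (Gamma s) = (\<integral>\<^sup>+t. ennreal (indicator {0..} t * t powr (s - 1) / exp t) \<partial>lborel)"
    by (rule Gamma_conv_nn_integral_real[OF assms(1)])
  also have "\<dots> = ennreal \<bar>x\<bar> * (\<integral>\<^sup>+u. ennreal (indicator {0..} (0 + x * u) * (0 + x * u) powr (s - 1) / exp (0 + x * u)) \<partial>lborel)"
    using assms by (intro nn_integral_real_affine) auto
  also have "\<dots> = (\<integral>\<^sup>+u. ennreal x * ennreal (indicator {0..} (0 + x * u) * (0 + x * u) powr (s - 1) / exp (0 + x * u)) \<partial>lborel)"
    using assms by (subst nn_integral_cmult) auto
  also have "\<dots> = (\<integral>\<^sup>+u. ennreal (x powr s) * ennreal (indicator {0<..} u * (u powr (s - 1) * exp (- x * u))) \<partial>lborel)"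
  proof (rule nn_integral_cong)
    fix u :: real
    show "ennreal x * ennreal (indicator {0..} (0 + x * u) * (0 + x * u) powr (s - 1) / exp (0 + x * u)) =
      ennreal (x powr s) * ennreal (indicator {0<..} u * (u powr (s - 1) * exp (- x * u)))"
    proof (cases "0 < u")
      case True
      have "x * (x * u) powr (s - 1) = x powr s * u powr (s - 1)"
        using True assms by (simp add: powr_mult powr_diff)
      then show ?thesis
        using True assms by (simp add: ennreal_mult''[symmetric] exp_minus divide_inverse mult.assoc[symmetric])
    next
      case False
      then have "indicator {0..} (x * u) * (x * u) powr (s - 1) = 0"
        using assms by (cases "u = 0") (auto simp: zero_le_mult_iff)
      then show ?thesis using False by simp
    qed
  qed
  also have "\<dots> = ennreal (x powr s) * (\<integral>\<^sup>+u. ennreal (indicator {0<..} u * (u powr (s - 1) * exp (- x * u))) \<partial>lborel)"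
    by (rule nn_integral_cmult) auto
  finally have *: "ennreal (Gamma s) = ennreal (x powr s) * (\<integral>\<^sup>+u. ennreal (indicator {0<..} u * (u powr (s - 1) * exp (- x * u))) \<partial>lborel)" .
  have "ennreal (Gamma s * x powr (- s)) = ennreal (x powr (- s)) * ennreal (Gamma s)"
    using assms by (simp add: ennreal_mult mult.commute Gamma_real_nonneg)
  also have "\<dots> = ennreal (x powr (- s) * x powr s) * (\<integral>\<^sup>+u. ennreal (indicator {0<..} u * (u powr (s - 1) * exp (- x * u))) \<partial>lborel)"
    unfolding * by (simp add: ennreal_mult' mult.assoc)
  also have "x powr (- s) * x powr s = 1" using assms by (simp flip: powr_add)
  finally show ?thesis by simp
qed

text \<open>The substitution y = v u^2 turns the Gamma integral at a / 2 into this one.\<close>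

lemma nn_integral_gaussian_moment:
  fixes a v :: real
  assumes "0 < a" "0 < v"
  shows "(\<integral>\<^sup>+u. ennreal (indicator {0<..} u * (u powr (a - 1) * exp (- v * u\<^sup>2))) \<partial>lborel) =
    ennreal (Gamma (a / 2) / 2 * v powr (- a / 2))"
proof -
  let ?f = "\<lambda>y. y powr (a / 2 - 1) * exp (- y) :: real"
  let ?g = "\<lambda>u. v * u\<^sup>2" and ?g' = "\<lambda>u. 2 * v * u"
  have "?f = (\<lambda>y. y powr (a / 2 - 1) / exp y)" by (simp add: fun_eq_iff exp_minus field_simps)
  then have "(?f has_integral Gamma (a / 2)) {0..}"
    using Gamma_integral_real[of "a / 2"] assms by simp
  then have f0: "(?f has_integral Gamma (a / 2)) {0<..}"
    by (rule has_integral_spike_set_eq[THEN iffD1, rotated -1]) (auto intro: negligible_subset[of "{0}"])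
  have f_abs: "?f absolutely_integrable_on {0<..}"
    using f0 by (intro nonnegative_absolutely_integrable_1) (auto simp: integrable_on_def)
  have img: "?g ` {0<..} = {0<..}"
  proof (intro equalityI subsetI)
    fix y :: real assume "y \<in> {0<..}"
    then have "y = ?g (sqrt (y / v))" "sqrt (y / v) \<in> {0<..}" using assms by auto
    then show "y \<in> ?g ` {0<..}" by (rule image_eqI)
  qed (use assms in auto)
  have "(\<lambda>u. \<bar>?g' u\<bar> * ?f (?g u)) absolutely_integrable_on {0<..} \<and>
      integral {0<..} (\<lambda>u. \<bar>?g' u\<bar> * ?f (?g u)) = Gamma (a / 2)"
  proof (rule iffD2[OF has_absolute_integral_change_of_variables_1'[where S = "{0<..}" and g = ?g and g' = ?g' and f = ?f]])
    show "(?g has_field_derivative ?g' u) (at u within {0<..})" for u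
      by (auto intro!: derivative_eq_intros)
    show "inj_on ?g {0<..}" using assms by (auto simp: inj_on_def)
    show "?f absolutely_integrable_on ?g ` {0<..} \<and> integral (?g ` {0<..}) ?f = Gamma (a / 2)"
      unfolding img using f_abs f0 by (simp add: integral_unique)
  qed auto
  then have "((\<lambda>u. \<bar>?g' u\<bar> * ?f (?g u)) has_integral Gamma (a / 2)) {0<..}"
    unfolding has_integral_iff using set_lebesgue_integral_eq_integral(1) by blast
  then have "((\<lambda>u. (\<bar>?g' u\<bar> * ?f (?g u)) * (v powr (- a / 2) / 2)) has_integral Gamma (a / 2) * (v powr (- a / 2) / 2)) {0<..}"
    by (rule has_integral_mult_left)
  also have "?this \<longleftrightarrow> ((\<lambda>u. u powr (a - 1) * exp (- v * u\<^sup>2)) has_integral Gamma (a / 2) * (v powr (- a / 2) / 2)) {0<..}"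
  proof (rule has_integral_cong)
    fix u :: real assume "u \<in> {0<..}"
    then have u: "0 < u" by simp
    have "2 * v * u * (v * u\<^sup>2) powr (a / 2 - 1) * (v powr (- a / 2) / 2)
        = (v * v powr (a / 2 - 1) * v powr (- a / 2)) * (u * (u\<^sup>2) powr (a / 2 - 1))"
      using u assms by (simp add: powr_mult)
    also have "v * v powr (a / 2 - 1) * v powr (- a / 2) = 1"
    proof -
      have "v powr 1 * v powr (a / 2 - 1) * v powr (- a / 2) = v powr (1 + (a / 2 - 1) + (- a / 2))"
        by (simp only: powr_add)
      also have "1 + (a / 2 - 1) + (- a / 2) = 0" by simp
      finally show ?thesis using assms by simp
    qed
    also have "u * (u\<^sup>2) powr (a / 2 - 1) = u powr (a - 1)"
    proof -
      have "(u\<^sup>2) powr (a / 2 - 1) = u powr (a - 2)"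
        using u by (simp add: powr_powr algebra_simps flip: powr_numeral)
      then show ?thesis using u by (simp add: powr_diff power2_eq_square)
    qed
    finally have "2 * v * u * (v * u\<^sup>2) powr (a / 2 - 1) * (v powr (- a / 2) / 2) = u powr (a - 1)" by simp
    moreover have "(\<bar>?g' u\<bar> * ?f (?g u)) * (v powr (- a / 2) / 2) =
        (2 * v * u * (v * u\<^sup>2) powr (a / 2 - 1) * (v powr (- a / 2) / 2)) * exp (- v * u\<^sup>2)"
      using u assms by simp
    ultimately show "(\<bar>?g' u\<bar> * ?f (?g u)) * (v powr (- a / 2) / 2) = u powr (a - 1) * exp (- v * u\<^sup>2)"
      by simp
  qed
  finally have "((\<lambda>u. u powr (a - 1) * exp (- v * u\<^sup>2)) has_integral Gamma (a / 2) / 2 * v powr (- a / 2)) {0<..}"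
    by simp
  then show ?thesis by (subst nn_integral_has_integral_lebesgue) auto
qed

text \<open>The difference of the Laplace transforms of 1 and cos, read off as the real part of 1/u
  - 1/(u - i).\<close>

lemma nn_integral_one_minus_cos_exp:
  fixes u :: real
  assumes "0 < u"
  shows "(\<integral>\<^sup>+x. ennreal (indicator {0<..} x * ((1 - cos x) * exp (- x * u))) \<partial>lborel) = ennreal (1 / (u * (1 + u\<^sup>2)))"
proof -
  note I1 = integral_exp_complex[of "of_real u", simplified, OF assms]
  note I2 = integral_exp_complex[of "of_real u - \<i>", simplified, OF assms]
  have eq: "indicator {0..} x * ((1 - cos x) * exp (- x * u)) =
      Re (indicator {0..} x *\<^sub>R exp (- (of_real u * of_real x)) - indicator {0..} x *\<^sub>R exp ((\<i> - of_real u) * of_real x))" for x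
    by (simp add: Re_exp algebra_simps)
  have int: "integrable lborel (\<lambda>x. indicator {0..} x * ((1 - cos x) * exp (- x * u)))"
    unfolding eq using I1(1) I2(1) by (intro integrable_Re) (simp add: set_integrable_def)
  have "(\<integral>x. indicator {0..} x * ((1 - cos x) * exp (- x * u)) \<partial>lborel) = Re (1 / of_real u - 1 / (of_real u - \<i>))"
    unfolding eq using I1 I2 by (subst integral_Re) (simp_all add: set_integrable_def set_lebesgue_integral_def)
  also have "\<dots> = 1 / (u * (1 + u\<^sup>2))"
  proof -
    have pos: "0 < 1 + u\<^sup>2" by (simp add: add_pos_nonneg)
    have "Re (1 / of_real u - 1 / (of_real u - \<i>)) = 1 / u - u / (1 + u\<^sup>2)"
      using assms by (simp add: Re_divide add.commute power2_eq_square)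
    also have "\<dots> = (1 * (1 + u\<^sup>2) - u * u) / (u * (1 + u\<^sup>2))"
      using pos assms by (intro diff_frac_eq) auto
    finally show ?thesis by (simp add: power2_eq_square)
  qed
  finally have *: "(\<integral>x. indicator {0..} x * ((1 - cos x) * exp (- x * u)) \<partial>lborel) = 1 / (u * (1 + u\<^sup>2))" .
  have "(\<integral>\<^sup>+x. ennreal (indicator {0<..} x * ((1 - cos x) * exp (- x * u))) \<partial>lborel) =
      (\<integral>\<^sup>+x. ennreal (indicator {0..} x * ((1 - cos x) * exp (- x * u))) \<partial>lborel)"
    by (intro nn_integral_cong) (auto split: split_indicator)
  also have "\<dots> = ennreal (1 / (u * (1 + u\<^sup>2)))"
    using int * by (subst nn_integral_eq_integral) auto
  finally show ?thesis .
qed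

lemma Gamma_reflection_real:
  fixes a :: real
  assumes "0 < a" "a < 1"
  shows "Gamma a * Gamma (1 - a) = pi / sin (pi * a)"
proof -
  have "complex_of_real (Gamma a * Gamma (1 - a)) = of_real (pi / sin (pi * a))"
  proof -
    have "1 - complex_of_real a = of_real (1 - a)" by simp
    moreover have "sin (of_real pi * complex_of_real a) = of_real (sin (pi * a))"
      by (simp add: sin_of_real flip: of_real_mult)
    ultimately show ?thesis
      using Gamma_reflection_complex[of "of_real a"]
      by (simp only: Gamma_complex_of_real of_real_mult of_real_divide)
  qed
  then show ?thesis using of_real_eq_iff by blast
qed

text \<open>
  Both \<open>x powr (- 1 - \<alpha>)\<close> and \<open>1 / (1 + u\<^sup>2)\<close> are written as Laplace integrals, so that Tonelli's theorem
  reduces the claim to Gamma integrals and the reflection formula.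
\<close>

lemma nn_integral_one_minus_cos_powr:
  fixes \<alpha> :: real
  assumes \<alpha>: "0 < \<alpha>" "\<alpha> < 2"
  shows "(\<integral>\<^sup>+x. ennreal (indicator {0<..} x * (x powr (- 1 - \<alpha>) * (1 - cos x))) \<partial>lborel) =
    ennreal (pi / (2 * Gamma (1 + \<alpha>) * sin (pi * \<alpha> / 2)))"
proof -
  let ?p = "indicator {0<..} :: real \<Rightarrow> real"
  have G: "0 < Gamma (1 + \<alpha>)" "0 < Gamma (\<alpha> / 2)" using \<alpha> by (auto intro: Gamma_real_pos)
  have sn: "0 < sin (pi * \<alpha> / 2)" using \<alpha> by (intro sin_gt_zero) auto
  let ?J = "\<integral>\<^sup>+x. ennreal (?p x * (x powr (- 1 - \<alpha>) * (1 - cos x))) \<partial>lborel"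
  have "ennreal (Gamma (1 + \<alpha>)) * ?J = (\<integral>\<^sup>+x. ennreal (Gamma (1 + \<alpha>)) * ennreal (?p x * (x powr (- 1 - \<alpha>) * (1 - cos x))) \<partial>lborel)"
    by (rule nn_integral_cmult[symmetric]) auto
  also have "\<dots> = (\<integral>\<^sup>+x. \<integral>\<^sup>+u. ennreal (?p x * (1 - cos x) * (?p u * (u powr \<alpha> * exp (- x * u)))) \<partial>lborel \<partial>lborel)"
  proof (rule nn_integral_cong)
    fix x :: real
    show "ennreal (Gamma (1 + \<alpha>)) * ennreal (?p x * (x powr (- 1 - \<alpha>) * (1 - cos x))) =
      (\<integral>\<^sup>+u. ennreal (?p x * (1 - cos x) * (?p u * (u powr \<alpha> * exp (- x * u)))) \<partial>lborel)"
    proof (cases "0 < x")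
      case True
      have "(\<integral>\<^sup>+u. ennreal (?p x * (1 - cos x) * (?p u * (u powr \<alpha> * exp (- x * u)))) \<partial>lborel) =
          (\<integral>\<^sup>+u. ennreal (1 - cos x) * ennreal (?p u * (u powr ((1 + \<alpha>) - 1) * exp (- x * u))) \<partial>lborel)"
        using True by (simp add: ennreal_mult' mult_ac)
      also have "\<dots> = ennreal (1 - cos x) * ennreal (Gamma (1 + \<alpha>) * x powr (- (1 + \<alpha>)))"
        using \<alpha> True by (subst nn_integral_cmult, simp) (simp only: nn_integral_Gamma_scaled)
      finally show ?thesis using True G by (simp add: ennreal_mult'[symmetric] ennreal_mult''[symmetric] mult_ac)
    qed simp
  qed
  also have "\<dots> = (\<integral>\<^sup>+u. \<integral>\<^sup>+x. ennreal (?p x * (1 - cos x) * (?p u * (u powr \<alpha> * exp (- x * u)))) \<partial>lborel \<partial>lborel)"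
    by (rule lborel_pair.Fubini') measurable
  also have "\<dots> = (\<integral>\<^sup>+u. ennreal (?p u * (u powr (\<alpha> - 1) * (1 / (1 + u\<^sup>2)))) \<partial>lborel)"
  proof (rule nn_integral_cong)
    fix u :: real
    show "(\<integral>\<^sup>+x. ennreal (?p x * (1 - cos x) * (?p u * (u powr \<alpha> * exp (- x * u)))) \<partial>lborel) =
      ennreal (?p u * (u powr (\<alpha> - 1) * (1 / (1 + u\<^sup>2))))"
    proof (cases "0 < u")
      case True
      have "(\<integral>\<^sup>+x. ennreal (?p x * (1 - cos x) * (?p u * (u powr \<alpha> * exp (- x * u)))) \<partial>lborel) =
        (\<integral>\<^sup>+x. ennreal (u powr \<alpha>) * ennreal (?p x * ((1 - cos x) * exp (- x * u))) \<partial>lborel)"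
        using True by (simp add: ennreal_mult'[symmetric] mult_ac)
      also have "\<dots> = ennreal (u powr \<alpha>) * ennreal (1 / (u * (1 + u\<^sup>2)))"
        using True by (subst nn_integral_cmult, simp) (simp only: nn_integral_one_minus_cos_exp)
      also have "\<dots> = ennreal (u powr \<alpha> * (1 / (u * (1 + u\<^sup>2))))" by (rule ennreal_mult'[symmetric]) simp
      also have "u powr \<alpha> * (1 / (u * (1 + u\<^sup>2))) = u powr (\<alpha> - 1) * (1 / (1 + u\<^sup>2))"
        using True by (simp add: powr_diff)
      finally show ?thesis using True by simp
    qed simp
  qed
  also have "\<dots> = (\<integral>\<^sup>+u. \<integral>\<^sup>+v. ennreal (?p u * u powr (\<alpha> - 1) * (?p v * exp (- (1 + u\<^sup>2) * v))) \<partial>lborel \<partial>lborel)"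
  proof (rule nn_integral_cong)
    fix u :: real
    have pos: "0 < 1 + u\<^sup>2" by (simp add: add_pos_nonneg)
    have "(\<integral>\<^sup>+v. ennreal (?p u * u powr (\<alpha> - 1) * (?p v * exp (- (1 + u\<^sup>2) * v))) \<partial>lborel) =
      (\<integral>\<^sup>+v. ennreal (?p u * u powr (\<alpha> - 1)) * ennreal (?p v * (v powr (1 - 1) * exp (- (1 + u\<^sup>2) * v))) \<partial>lborel)"
      by (intro nn_integral_cong) (auto simp: ennreal_mult'[symmetric] split: split_indicator)
    also have "\<dots> = ennreal (?p u * u powr (\<alpha> - 1)) * ennreal (Gamma 1 * (1 + u\<^sup>2) powr (- 1))"
      using pos by (subst nn_integral_cmult, simp) (simp only: nn_integral_Gamma_scaled zero_less_one)
    also have "\<dots> = ennreal (?p u * (u powr (\<alpha> - 1) * (1 / (1 + u\<^sup>2))))"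
      using pos by (simp add: ennreal_mult'[symmetric] powr_minus inverse_eq_divide)
    finally show "ennreal (?p u * (u powr (\<alpha> - 1) * (1 / (1 + u\<^sup>2)))) =
        (\<integral>\<^sup>+v. ennreal (?p u * u powr (\<alpha> - 1) * (?p v * exp (- (1 + u\<^sup>2) * v))) \<partial>lborel)" ..
  qed
  also have "\<dots> = (\<integral>\<^sup>+v. \<integral>\<^sup>+u. ennreal (?p u * u powr (\<alpha> - 1) * (?p v * exp (- (1 + u\<^sup>2) * v))) \<partial>lborel \<partial>lborel)"
    by (rule lborel_pair.Fubini') measurable
  \<comment> \<open>The integral in u is a Gaussian moment proportional to v^(-\<alpha>/2); what is
    left in v is a Gamma integral with parameter 1 - \<alpha>/2, positive as \<alpha> < 2.\<close>
  also have "\<dots> = (\<integral>\<^sup>+v. ennreal (Gamma (\<alpha> / 2) / 2) * ennreal (?p v * (v powr ((1 - \<alpha> / 2) - 1) * exp (- 1 * v))) \<partial>lborel)"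
  proof (rule nn_integral_cong)
    fix v :: real
    show "(\<integral>\<^sup>+u. ennreal (?p u * u powr (\<alpha> - 1) * (?p v * exp (- (1 + u\<^sup>2) * v))) \<partial>lborel) =
       ennreal (Gamma (\<alpha> / 2) / 2) * ennreal (?p v * (v powr ((1 - \<alpha> / 2) - 1) * exp (- 1 * v)))"
    proof (cases "0 < v")
      case True
      have "(\<integral>\<^sup>+u. ennreal (?p u * u powr (\<alpha> - 1) * (?p v * exp (- (1 + u\<^sup>2) * v))) \<partial>lborel) =
        (\<integral>\<^sup>+u. ennreal (exp (- v)) * ennreal (?p u * (u powr (\<alpha> - 1) * exp (- v * u\<^sup>2))) \<partial>lborel)"
        using True by (intro nn_integral_cong)
          (auto simp: ennreal_mult'[symmetric] algebra_simps exp_diff exp_minus exp_add divide_inverse split: split_indicator)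
      also have "\<dots> = ennreal (exp (- v)) * ennreal (Gamma (\<alpha> / 2) / 2 * v powr (- \<alpha> / 2))"
        using True \<alpha> by (subst nn_integral_cmult, simp) (simp only: nn_integral_gaussian_moment)
      finally show ?thesis using True G by (simp add: ennreal_mult'[symmetric] ennreal_mult''[symmetric] mult_ac)
    qed simp
  qed
  also have "\<dots> = ennreal (Gamma (\<alpha> / 2) / 2) * ennreal (Gamma (1 - \<alpha> / 2) * 1 powr (- (1 - \<alpha> / 2)))"
    using \<alpha> by (subst nn_integral_cmult, simp, subst nn_integral_Gamma_scaled) auto
  also have "\<dots> = ennreal (Gamma (\<alpha> / 2) * Gamma (1 - \<alpha> / 2) / 2)"
    using G by (simp add: ennreal_mult'[symmetric])
  also have "Gamma (\<alpha> / 2) * Gamma (1 - \<alpha> / 2) = pi / sin (pi * \<alpha> / 2)"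
    using Gamma_reflection_real[of "\<alpha> / 2"] \<alpha> by simp
  finally have *: "ennreal (Gamma (1 + \<alpha>)) * ?J = ennreal (pi / sin (pi * \<alpha> / 2) / 2)" .
  have "?J = ennreal (1 / Gamma (1 + \<alpha>)) * (ennreal (Gamma (1 + \<alpha>)) * ?J)"
    using G by (simp add: mult.assoc[symmetric] ennreal_mult'[symmetric])
  also have "\<dots> = ennreal (1 / Gamma (1 + \<alpha>) * (pi / sin (pi * \<alpha> / 2) / 2))"
    unfolding * using G by (simp add: ennreal_mult'[symmetric])
  finally show ?thesis by (simp add: mult_ac)
qed

section \<open>The norm of step functions\<close>

text \<open>Scaling by |d| and evenness in x reduce this to d = 1 on the positive axis. A Bochner
  integral is needed because these integrals are later combined with coefficients of either
  sign.\<close>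

lemma has_bochner_integral_one_minus_cos:
  fixes \<alpha> d :: real
  assumes \<alpha>: "0 < \<alpha>" "\<alpha> < 2"
  shows "has_bochner_integral lborel (\<lambda>x. \<bar>x\<bar> powr (- 1 - \<alpha>) * (1 - cos (d * x)))
    (pi / (Gamma (1 + \<alpha>) * sin (pi * \<alpha> / 2)) * \<bar>d\<bar> powr \<alpha>)"
proof (cases "d = 0")
  case False
  define e where "e = \<bar>d\<bar>"
  have e: "0 < e" using False by (simp add: e_def)
  let ?p = "indicator {0<..} :: real \<Rightarrow> real"
  let ?\<kappa> = "pi / (2 * Gamma (1 + \<alpha>) * sin (pi * \<alpha> / 2))"
  let ?f = "\<lambda>x. \<bar>x\<bar> powr (- 1 - \<alpha>) * (1 - cos (d * x))"
  let ?I = "\<integral>\<^sup>+x. ennreal (?p x * ?f x) \<partial>lborel"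
  have "0 < Gamma (1 + \<alpha>)" using \<alpha> by (auto intro: Gamma_real_pos)
  moreover have "0 < sin (pi * \<alpha> / 2)" using \<alpha> by (intro sin_gt_zero) auto
  ultimately have \<kappa>: "0 \<le> ?\<kappa>" by simp
  have cos_e: "cos (d * x) = cos (e * x)" for x
    unfolding e_def by (cases "d \<ge> 0") auto
  have "ennreal ?\<kappa> = (\<integral>\<^sup>+x. ennreal (?p x * (x powr (- 1 - \<alpha>) * (1 - cos x))) \<partial>lborel)"
    by (rule nn_integral_one_minus_cos_powr[OF \<alpha>, symmetric])
  also have "\<dots> = ennreal \<bar>e\<bar> * (\<integral>\<^sup>+x. ennreal (?p (0 + e * x) * ((0 + e * x) powr (- 1 - \<alpha>) * (1 - cos (0 + e * x)))) \<partial>lborel)"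
    using e by (intro nn_integral_real_affine) auto
  also have "\<dots> = (\<integral>\<^sup>+x. ennreal e * ennreal (?p (0 + e * x) * ((0 + e * x) powr (- 1 - \<alpha>) * (1 - cos (0 + e * x)))) \<partial>lborel)"
    using e by (subst nn_integral_cmult) auto
  also have "\<dots> = (\<integral>\<^sup>+x. ennreal (e powr (- \<alpha>)) * ennreal (?p x * ?f x) \<partial>lborel)"
  proof (rule nn_integral_cong)
    fix x :: real
    show "ennreal e * ennreal (?p (0 + e * x) * ((0 + e * x) powr (- 1 - \<alpha>) * (1 - cos (0 + e * x)))) =
      ennreal (e powr (- \<alpha>)) * ennreal (?p x * ?f x)"
    proof (cases "0 < x")
      case True
      have "e * (e * x) powr (- 1 - \<alpha>) = (e powr 1 * e powr (- 1 - \<alpha>)) * x powr (- 1 - \<alpha>)"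
        using True e by (simp add: powr_mult)
      also have "e powr 1 * e powr (- 1 - \<alpha>) = e powr (1 + (- 1 - \<alpha>))" by (simp only: powr_add)
      finally have "e * (e * x) powr (- 1 - \<alpha>) = e powr (- \<alpha>) * x powr (- 1 - \<alpha>)" by simp
      then show ?thesis
        using True e by (simp add: cos_e ennreal_mult'[symmetric] mult.assoc[symmetric])
    next
      case False
      then have "\<not> 0 < e * x" using e by (simp add: zero_less_mult_iff)
      then show ?thesis using False by simp
    qed
  qed
  also have "\<dots> = ennreal (e powr (- \<alpha>)) * ?I" by (rule nn_integral_cmult) auto
  finally have *: "ennreal ?\<kappa> = ennreal (e powr (- \<alpha>)) * ?I" .
  have "?I = ennreal (e powr \<alpha> * e powr (- \<alpha>)) * ?I"
    using e by (simp add: powr_minus)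
  also have "\<dots> = ennreal (e powr \<alpha>) * ennreal ?\<kappa>"
    unfolding * by (simp add: ennreal_mult' mult.assoc)
  also have "\<dots> = ennreal (?\<kappa> * e powr \<alpha>)" by (simp add: ennreal_mult'[symmetric] mult.commute)
  finally have I: "?I = ennreal (?\<kappa> * e powr \<alpha>)" .
  have "(\<integral>\<^sup>+x. ennreal (?f x) \<partial>lborel) =
      (\<integral>\<^sup>+x. ennreal (?p x * ?f x) + ennreal (?p (- x) * ?f (- x)) \<partial>lborel)"
    by (intro nn_integral_cong) (auto split: split_indicator)
  also have "\<dots> = ?I + (\<integral>\<^sup>+x. ennreal (?p (- x) * ?f (- x)) \<partial>lborel)"
    by (rule nn_integral_add) auto
  also have "(\<integral>\<^sup>+x. ennreal (?p (- x) * ?f (- x)) \<partial>lborel) = ?I"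
    by (subst nn_integral_real_affine[of "\<lambda>x. ennreal (?p x * ?f x)" "- 1" 0]) auto
  also have "?I + ?I = ennreal (2 * (?\<kappa> * e powr \<alpha>))"
  proof -
    have "0 \<le> ?\<kappa> * e powr \<alpha>" using \<kappa> by (intro mult_nonneg_nonneg) auto
    then show ?thesis unfolding I by (simp only: ennreal_plus[symmetric] mult_2)
  qed
  also have "2 * (?\<kappa> * e powr \<alpha>) = pi / (Gamma (1 + \<alpha>) * sin (pi * \<alpha> / 2)) * e powr \<alpha>"
    by simp
  finally show ?thesis
    using \<open>0 < Gamma (1 + \<alpha>)\<close> \<open>0 < sin (pi * \<alpha> / 2)\<close> unfolding e_def
    by (intro has_bochner_integral_nn_integral) auto
qed (auto simp: has_bochner_integral_zero)

section \<open>Fourier transforms of step functions and their norm\<close>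

lemma fourier_linear:
  assumes "\<And>t. t \<in> J \<Longrightarrow> integrable lborel (f t)"
  shows "fourier (\<lambda>y. \<Sum>t\<in>J. c t * f t y) x = (\<Sum>t\<in>J. of_real (c t) * fourier (f t) x)"
proof -
  have int: "integrable lborel (\<lambda>y. iexp (x * y) * of_real (f t y))" if "t \<in> J" for t
  proof (rule Bochner_Integration.integrable_bound)
    show "integrable lborel (f t)" by (rule assms[OF that])
    then show "(\<lambda>y. iexp (x * y) * of_real (f t y)) \<in> borel_measurable lborel"
      by (intro borel_measurable_times) auto
  qed (simp add: norm_mult)
  have "(\<integral>y. iexp (x * y) * of_real (\<Sum>t\<in>J. c t * f t y) \<partial>lborel) =
      (\<integral>y. (\<Sum>t\<in>J. of_real (c t) * (iexp (x * y) * of_real (f t y))) \<partial>lborel)"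
    by (simp add: sum_distrib_left mult_ac)
  also have "\<dots> = (\<Sum>t\<in>J. of_real (c t) * (\<integral>y. iexp (x * y) * of_real (f t y) \<partial>lborel))"
    using int by (simp only: Bochner_Integration.integral_sum integrable_mult_right integral_mult_right_zero)
  finally show ?thesis
    by (simp add: fourier_def sum_distrib_left mult_ac)
qed

lemma fourier_indicator:
  assumes "0 \<le> t" "x \<noteq> 0"
  shows "fourier (indicator {0..<t}) x = of_real (1 / sqrt (2 * pi)) * ((iexp (x * t) - 1) / (\<i> * x))"
proof -
  have "(\<integral>y. iexp (x * y) * of_real (indicator {0..<t} y) \<partial>lborel) = (\<integral>y. indicator {0..t} y *\<^sub>R iexp (x * y) \<partial>lborel)"
  proof (rule integral_cong_AE)
    show "AE y in lborel. iexp (x * y) * of_real (indicator {0..<t} y) = indicator {0..t} y *\<^sub>R iexp (x * y)"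
      using AE_lborel_singleton[of t] by eventually_elim (auto split: split_indicator)
  qed auto
  also have "\<dots> = iexp (x * t) / (\<i> * x) - iexp (x * 0) / (\<i> * x)"
  proof (rule integral_FTC_atLeastAtMost[OF assms(1)])
    fix y :: real
    have "((\<lambda>z. exp (\<i> * (of_real x * z)) / (\<i> * x)) has_field_derivative iexp (x * y)) (at (of_real y))"
      using assms(2) by (auto intro!: derivative_eq_intros simp: field_simps)
    from has_vector_derivative_real_field[OF this, of "{0..t}"]
    show "((\<lambda>y. iexp (x * y) / (\<i> * x)) has_vector_derivative iexp (x * y)) (at y within {0..t})" by simp
  qed (intro continuous_intros)
  finally show ?thesis by (simp add: fourier_def diff_divide_distrib)
qed

text \<open>The real part of (exp(ixs) - 1) (exp(-ixt) - 1) is (1 - cos sx) + (1 - cos tx) - (1 -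
  cos (s-t)x). Integrated with weight |x|^(-1-\<alpha>), the three terms become the three powers in
  the covariance, each times \<open>K\<close>; the prefactor of the norm times K / (2 pi) is
  1/2.\<close>

lemma alpha_norm_sq_step:
  fixes \<alpha> :: real
  assumes \<alpha>: "0 < \<alpha>" "\<alpha> < 2" and J: "finite J" "J \<subseteq> {0..}"
  shows "alpha_norm_sq \<alpha> (\<lambda>y. \<Sum>t\<in>J. c t * indicator {0..<t} y) = ennreal (fBm_form \<alpha> J c / 2)"
proof -
  let ?h = "\<lambda>y. \<Sum>t\<in>J. c t * indicator {0..<t} y"
  define K where "K = pi / (Gamma (1 + \<alpha>) * sin (pi * \<alpha> / 2))"
  let ?\<phi> = "\<lambda>d x. \<bar>x\<bar> powr (- 1 - \<alpha>) * (1 - cos (d * x))"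
  have G: "0 < Gamma (1 + \<alpha>)" using \<alpha> by (auto intro: Gamma_real_pos)
  have sn: "0 < sin (pi * \<alpha> / 2)" using \<alpha> by (intro sin_gt_zero) auto
  have \<phi>: "integrable lborel (?\<phi> d)" "(\<integral>x. ?\<phi> d x \<partial>lborel) = K * \<bar>d\<bar> powr \<alpha>" for d
    using has_bochner_integral_one_minus_cos[OF \<alpha>, of d] by (auto simp: has_bochner_integral_iff K_def)
  let ?F = "\<lambda>x. (\<Sum>s\<in>J. \<Sum>t\<in>J. c s * c t * (?\<phi> s x + ?\<phi> t x - ?\<phi> (s - t) x)) / (2 * pi)"
  have eq: "\<bar>x\<bar> powr (1 - \<alpha>) * (cmod (fourier ?h x))\<^sup>2 = ?F x" if x: "x \<noteq> 0" for x
  proof -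
    have "fourier ?h x = (\<Sum>t\<in>J. of_real (c t) * fourier (indicator {0..<t}) x)"
      by (rule fourier_linear) (use J(2) in \<open>auto simp: integrable_indicator_iff subset_eq\<close>)
    also have "\<dots> = (\<Sum>t\<in>J. of_real (c t) * (of_real (1 / sqrt (2 * pi)) * ((iexp (x * t) - 1) / (\<i> * x))))"
      using J x by (intro sum.cong refl) (subst fourier_indicator, auto)
    also have "\<dots> = of_real (1 / sqrt (2 * pi)) / (\<i> * x) * (\<Sum>t\<in>J. of_real (c t) * (iexp (x * t) - 1))"
      by (simp add: sum_distrib_left mult_ac)
    finally have "(cmod (fourier ?h x))\<^sup>2 = (cmod (\<Sum>t\<in>J. of_real (c t) * (iexp (x * t) - 1)))\<^sup>2 / (2 * pi * x\<^sup>2)"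
      by (simp add: norm_mult norm_divide power_mult_distrib power_divide)
    also have "(cmod (\<Sum>t\<in>J. of_real (c t) * (iexp (x * t) - 1)))\<^sup>2 =
        (\<Sum>t\<in>J. c t * (cos (x * t) - 1))\<^sup>2 + (\<Sum>t\<in>J. c t * sin (x * t))\<^sup>2"
      unfolding cmod_power2 by (simp add: Re_exp Im_exp)
    also have "\<dots> = (\<Sum>s\<in>J. \<Sum>t\<in>J. (c s * (cos (x * s) - 1)) * (c t * (cos (x * t) - 1)) +
        (c s * sin (x * s)) * (c t * sin (x * t)))"
      unfolding power2_eq_square sum_product by (simp only: sum.distrib)
    also have "\<dots> = (\<Sum>s\<in>J. \<Sum>t\<in>J. c s * c t * ((1 - cos (s * x)) + (1 - cos (t * x)) - (1 - cos ((s - t) * x))))"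
    proof (intro sum.cong refl)
      fix s t
      have "cos ((s - t) * x) = cos (x * s) * cos (x * t) + sin (x * s) * sin (x * t)"
      proof -
        have "(s - t) * x = x * s - x * t" by (simp add: algebra_simps)
        then show ?thesis by (simp only: cos_diff)
      qed
      then show "(c s * (cos (x * s) - 1)) * (c t * (cos (x * t) - 1)) + (c s * sin (x * s)) * (c t * sin (x * t)) =
          c s * c t * ((1 - cos (s * x)) + (1 - cos (t * x)) - (1 - cos ((s - t) * x)))"
        by (simp add: algebra_simps)
    qed
    finally have A: "(cmod (fourier ?h x))\<^sup>2 =
      (\<Sum>s\<in>J. \<Sum>t\<in>J. c s * c t * ((1 - cos (s * x)) + (1 - cos (t * x)) - (1 - cos ((s - t) * x)))) / (2 * pi * x\<^sup>2)" .
    have B: "\<bar>x\<bar> powr (1 - \<alpha>) / x\<^sup>2 = \<bar>x\<bar> powr (- 1 - \<alpha>)"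
    proof -
      have "\<bar>x\<bar> powr (1 - \<alpha>) / \<bar>x\<bar> powr 2 = \<bar>x\<bar> powr (1 - \<alpha> - 2)" by (simp only: powr_diff)
      then show ?thesis using x by simp
    qed
    have "\<bar>x\<bar> powr (1 - \<alpha>) * (cmod (fourier ?h x))\<^sup>2 = (\<bar>x\<bar> powr (1 - \<alpha>) / x\<^sup>2) *
      (\<Sum>s\<in>J. \<Sum>t\<in>J. c s * c t * ((1 - cos (s * x)) + (1 - cos (t * x)) - (1 - cos ((s - t) * x)))) / (2 * pi)"
      unfolding A by simp
    also have "\<dots> = ?F x"
      unfolding B by (simp add: sum_distrib_left algebra_simps)
    finally show ?thesis .
  qed
  have int: "integrable lborel ?F" using \<phi>(1) by (intro integrable_divide integrable_sum integrable_mult_right integrable_diff integrable_add) auto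
  have "(\<integral>x. ?F x \<partial>lborel) = (\<Sum>s\<in>J. \<Sum>t\<in>J. c s * c t * (K * \<bar>s\<bar> powr \<alpha> + K * \<bar>t\<bar> powr \<alpha> - K * \<bar>s - t\<bar> powr \<alpha>)) / (2 * pi)"
    using \<phi> by (simp add: Bochner_Integration.integral_sum)
  also have "\<dots> = K * fBm_form \<alpha> J c / (2 * pi)"
  proof -
    have "(\<Sum>s\<in>J. \<Sum>t\<in>J. c s * c t * (K * \<bar>s\<bar> powr \<alpha> + K * \<bar>t\<bar> powr \<alpha> - K * \<bar>s - t\<bar> powr \<alpha>)) = K * fBm_form \<alpha> J c"
      unfolding fBm_form_def sum_distrib_left using J(2)
      by (intro sum.cong refl) (auto simp: algebra_simps subset_eq)
    then show ?thesis by simp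
  qed
  finally have IF: "(\<integral>x. ?F x \<partial>lborel) = K * fBm_form \<alpha> J c / (2 * pi)" .
  have ae: "AE x in lborel. x \<noteq> (0::real)" by (rule AE_lborel_singleton)
  have "(\<integral>\<^sup>+x. ennreal (\<bar>x\<bar> powr (1 - \<alpha>) * (cmod (fourier ?h x))\<^sup>2) \<partial>lborel) = (\<integral>\<^sup>+x. ennreal (?F x) \<partial>lborel)"
    by (rule nn_integral_cong_AE, rule eventually_mono[OF ae]) (drule eq, simp only:)
  also have "\<dots> = ennreal (\<integral>x. ?F x \<partial>lborel)"
  proof (rule nn_integral_eq_integral[OF int])
    \<comment> \<open>The summands of \<open>?F\<close> have varying signs; positivity is seen only
      from its equality with a weighted square.\<close>
    show "AE x in lborel. 0 \<le> ?F x"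
      using ae
    proof eventually_elim
      case (elim x)
      show ?case unfolding eq[OF elim, symmetric] by simp
    qed
  qed
  finally have "alpha_norm_sq \<alpha> ?h = ennreal (Gamma (1 + \<alpha>) * sin (pi * \<alpha> / 2)) * ennreal (K * fBm_form \<alpha> J c / (2 * pi))"
    unfolding alpha_norm_sq_def IF by simp
  also have "\<dots> = ennreal (Gamma (1 + \<alpha>) * sin (pi * \<alpha> / 2) * (K * fBm_form \<alpha> J c / (2 * pi)))"
    using G sn by (intro ennreal_mult'[symmetric]) simp
  also have "Gamma (1 + \<alpha>) * sin (pi * \<alpha> / 2) * (K * fBm_form \<alpha> J c / (2 * pi)) = fBm_form \<alpha> J c / 2"
    using G sn by (simp add: K_def)
  finally show ?thesis .
qed

section \<open>Schwartz functions and the pairing\<close>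

lemma higher_deriv_linear:
  fixes f g :: "real \<Rightarrow> real"
  assumes "\<And>n x. (deriv ^^ n) f field_differentiable at x" "\<And>n x. (deriv ^^ n) g field_differentiable at x"
  shows "(deriv ^^ n) (\<lambda>x. a * f x + b * g x) = (\<lambda>x. a * (deriv ^^ n) f x + b * (deriv ^^ n) g x)"
proof (induction n)
  case (Suc n)
  have "deriv (\<lambda>x. a * (deriv ^^ n) f x + b * (deriv ^^ n) g x) x = a * deriv ((deriv ^^ n) f) x + b * deriv ((deriv ^^ n) g) x" for x
    using assms[of n x] by (simp add: field_differentiable_mult)
  then show ?case by (simp add: Suc fun_eq_iff)
qed simp

lemma schwartz_space_linear:
  assumes "f \<in> schwartz_space" "g \<in> schwartz_space"
  shows "(\<lambda>x. a * f x + b * g x) \<in> schwartz_space"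
proof -
  have d: "(deriv ^^ n) f field_differentiable at x" "(deriv ^^ n) g field_differentiable at x" for n x
    using assms by (auto simp: schwartz_space_def)
  have "bounded (range (\<lambda>x. x ^ k * (a * (deriv ^^ n) f x + b * (deriv ^^ n) g x)))" for k n
  proof -
    have "bounded (range (\<lambda>x. x ^ k * (deriv ^^ n) f x))" "bounded (range (\<lambda>x. x ^ k * (deriv ^^ n) g x))"
      using assms by (auto simp: schwartz_space_def)
    then obtain A B where A: "\<And>x. \<bar>x ^ k * (deriv ^^ n) f x\<bar> \<le> A" and B: "\<And>x. \<bar>x ^ k * (deriv ^^ n) g x\<bar> \<le> B"
      by (auto simp: bounded_iff)
    show ?thesis
      unfolding bounded_iff
    proof (intro exI[of _ "\<bar>a\<bar> * A + \<bar>b\<bar> * B"] ballI, elim rangeE)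
      fix y x assume y: "y = x ^ k * (a * (deriv ^^ n) f x + b * (deriv ^^ n) g x)"
      have "y = a * (x ^ k * (deriv ^^ n) f x) + b * (x ^ k * (deriv ^^ n) g x)"
        unfolding y by (simp add: algebra_simps)
      also have "\<bar>\<dots>\<bar> \<le> \<bar>a\<bar> * \<bar>x ^ k * (deriv ^^ n) f x\<bar> + \<bar>b\<bar> * \<bar>x ^ k * (deriv ^^ n) g x\<bar>"
        by (rule order_trans[OF abs_triangle_ineq]) (simp only: abs_mult order_refl)
      also have "\<dots> \<le> \<bar>a\<bar> * A + \<bar>b\<bar> * B" by (intro add_mono mult_left_mono A B) auto
      finally show "norm y \<le> \<bar>a\<bar> * A + \<bar>b\<bar> * B" by simp
    qed
  qed
  then show ?thesis
    unfolding schwartz_space_def higher_deriv_linear[OF d] mem_Collect_eq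
    using d by (auto intro!: field_differentiable_add field_differentiable_mult)
qed

lemma schwartz_space_sum:
  assumes "finite J" "\<And>t. t \<in> J \<Longrightarrow> f t \<in> schwartz_space"
  shows "(\<lambda>x. \<Sum>t\<in>J. c t * f t x) \<in> schwartz_space"
  using assms
proof (induction J rule: finite_induct)
  case empty
  then show ?case using zero_in_schwartz_space by simp
next
  case (insert s J)
  then show ?case
    using schwartz_space_linear[of "f s" "\<lambda>x. \<Sum>t\<in>J. c t * f t x" "c s" 1] by simp
qed

lemma schwartz_integrable:
  assumes "f \<in> schwartz_space"
  shows "integrable lborel f"
proof -
  have b: "bounded (range (\<lambda>x. x ^ k * (deriv ^^ 0) f x))" for k
    using assms unfolding schwartz_space_def by blast
  \<comment> \<open>The bounds for the powers 0 and 2 together dominate f by a multiple of 1 / (1 +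
    x^2).\<close>
  obtain A B where A: "\<And>x. \<bar>f x\<bar> \<le> A" and B: "\<And>x. \<bar>x\<^sup>2 * f x\<bar> \<le> B"
    using b[of 0] b[of 2] by (auto simp: bounded_iff)
  have "(deriv ^^ 0) f field_differentiable at x" for x
    using assms unfolding schwartz_space_def by blast
  then have "continuous_on UNIV f"
    by (auto intro!: continuous_at_imp_continuous_on field_differentiable_imp_continuous_at)
  then have meas: "f \<in> borel_measurable lborel"
    using borel_measurable_continuous_onI by simp
  show ?thesis
  proof (rule Bochner_Integration.integrable_bound[OF _ meas])
    show "integrable lborel (\<lambda>x. (A + B) * (1 / (1 + x\<^sup>2)))"
      using integrable_inverse_1_plus_square
      by (intro integrable_mult_right) (simp add: set_integrable_def einterval_eq_UNIV inverse_eq_divide)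
    show "AE x in lborel. norm (f x) \<le> norm ((A + B) * (1 / (1 + x\<^sup>2)))"
    proof (rule AE_I2)
      fix x :: real
      have pos: "0 < 1 + x\<^sup>2" by (simp add: add_pos_nonneg)
      have "\<bar>f x\<bar> * (1 + x\<^sup>2) \<le> A + B"
        using A[of x] B[of x] by (simp add: abs_mult algebra_simps)
      then have "\<bar>f x\<bar> \<le> (A + B) * (1 / (1 + x\<^sup>2))" using pos by (simp add: field_simps)
      then show "norm (f x) \<le> norm ((A + B) * (1 / (1 + x\<^sup>2)))"
        unfolding real_norm_def by (rule order_trans[OF _ abs_ge_self])
    qed
  qed
qed

lemma tempered_linear:
  assumes w: "\<omega> \<in> tempered_distributions" and "finite J" "\<And>t. t \<in> J \<Longrightarrow> f t \<in> schwartz_space"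
  shows "\<omega> (\<lambda>x. \<Sum>t\<in>J. c t * f t x) = (\<Sum>t\<in>J. c t * \<omega> (f t))"
  using assms(2,3)
proof (induction J rule: finite_induct)
  case empty
  have "\<forall>c. \<forall>f\<in>schwartz_space. \<omega> (\<lambda>x. c * f x) = c * \<omega> f"
    using w unfolding tempered_distributions_def by blast
  from this[rule_format, of "\<lambda>x. 0" 0] show ?case using zero_in_schwartz_space by simp
next
  case (insert s J)
  have add: "\<omega> (\<lambda>x. g x + h x) = \<omega> g + \<omega> h" if "g \<in> schwartz_space" "h \<in> schwartz_space" for g h
    using w that unfolding tempered_distributions_def by blast
  have scale: "\<omega> (\<lambda>x. a * g x) = a * \<omega> g" if "g \<in> schwartz_space" for a g
    using w that unfolding tempered_distributions_def by blast
  have "(\<lambda>x. c s * f s x) \<in> schwartz_space"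
    using schwartz_space_linear[of "f s" "f s" "c s" 0] insert.prems by simp
  then have "\<omega> (\<lambda>x. c s * f s x + (\<Sum>t\<in>J. c t * f t x)) = c s * \<omega> (f s) + \<omega> (\<lambda>x. \<Sum>t\<in>J. c t * f t x)"
    using insert by (subst add) (auto intro!: schwartz_space_sum simp: scale)
  then show ?case using insert by simp
qed

lemma measurable_tempered_eval:
  assumes \<mu>: "sets \<mu> = sets tempered_borel" and "\<xi> \<in> schwartz_space"
  shows "(\<lambda>\<omega>. \<omega> \<xi>) \<in> borel_measurable \<mu>"
proof (rule borel_measurableI)
  fix U :: "real set" assume "open U"
  have sp: "space \<mu> = tempered_distributions"
    using sets_eq_imp_space_eq[OF \<mu>] space_tempered_borel by simp
  have "openin weak_topology {\<omega> \<in> tempered_distributions. \<omega> \<xi> \<in> U}"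
    unfolding weak_topology_def by (rule topology_generated_by_Basis) (use assms(2) \<open>open U\<close> in blast)
  moreover have "(\<lambda>\<omega>. \<omega> \<xi>) -` U \<inter> space \<mu> = {\<omega> \<in> tempered_distributions. \<omega> \<xi> \<in> U}"
    unfolding sp by auto
  ultimately show "(\<lambda>\<omega>. \<omega> \<xi>) -` U \<inter> space \<mu> \<in> sets \<mu>"
    unfolding \<mu> sets_tempered_borel by auto
qed

section \<open>Perturbation estimates for the norm\<close>

lemma measurable_fourier:
  assumes "integrable lborel f"
  shows "fourier f \<in> borel_measurable borel"
proof -
  have [measurable]: "f \<in> borel_measurable borel" using assms by auto
  show ?thesis unfolding fourier_def by measurable
qed

text \<open>A substitute for the triangle inequality that works with squares and possibly infinite
  values: it holds pointwise for the Fourier transforms and then integrates, without square roots.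
  Both directions are needed for convergence.\<close>

lemma alpha_norm_sq_perturb:
  assumes f: "integrable lborel f" and g: "integrable lborel g" and e: "0 < e"
  shows "alpha_norm_sq \<alpha> f \<le> ennreal (1 + e) * alpha_norm_sq \<alpha> g + ennreal (1 + 1 / e) * alpha_norm_sq \<alpha> (\<lambda>x. f x - g x)"
    and "alpha_norm_sq \<alpha> g \<le> ennreal (1 + e) * alpha_norm_sq \<alpha> f + ennreal (1 + 1 / e) * alpha_norm_sq \<alpha> (\<lambda>x. f x - g x)"
proof -
  have [measurable]: "fourier f \<in> borel_measurable borel" "fourier g \<in> borel_measurable borel"
    "fourier (\<lambda>x. f x - g x) \<in> borel_measurable borel"
    using f g by (auto intro!: measurable_fourier)
  have lin: "fourier (\<lambda>x. f x - g x) x = fourier f x - fourier g x" for x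
    using fourier_linear[of "{True, False}" "\<lambda>b. if b then f else g" "\<lambda>b. if b then 1 else - 1" x] f g
    by simp
  have key: "(cmod a)\<^sup>2 \<le> (1 + e) * (cmod b)\<^sup>2 + (1 + 1 / e) * (cmod (a - b))\<^sup>2" for a b :: complex
  proof -
    \<comment> \<open>This weighted square bounds the mixed term in the expansion of (|b| + |a -
      b|)^2.\<close>
    have "0 \<le> (sqrt e * cmod b - cmod (a - b) / sqrt e)\<^sup>2" by simp
    also have "\<dots> = e * (cmod b)\<^sup>2 + (cmod (a - b))\<^sup>2 / e - 2 * cmod b * cmod (a - b)"
      using e by (simp add: power2_diff power_mult_distrib power_divide)
    finally have "2 * cmod b * cmod (a - b) \<le> e * (cmod b)\<^sup>2 + (cmod (a - b))\<^sup>2 / e" by simp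
    moreover have "(cmod a)\<^sup>2 \<le> (cmod b + cmod (a - b))\<^sup>2"
      using norm_triangle_ineq[of b "a - b"] by (intro power_mono) auto
    ultimately show ?thesis by (simp add: power2_sum algebra_simps)
  qed
  have main: "alpha_norm_sq \<alpha> p \<le> ennreal (1 + e) * alpha_norm_sq \<alpha> q + ennreal (1 + 1 / e) * alpha_norm_sq \<alpha> r"
    if [measurable]: "fourier p \<in> borel_measurable borel" "fourier q \<in> borel_measurable borel" "fourier r \<in> borel_measurable borel"
      and le: "\<And>x. (cmod (fourier p x))\<^sup>2 \<le> (1 + e) * (cmod (fourier q x))\<^sup>2 + (1 + 1 / e) * (cmod (fourier r x))\<^sup>2" for p q r
  proof -
    let ?n = "\<lambda>h x. ennreal (\<bar>x\<bar> powr (1 - \<alpha>) * (cmod (fourier h x))\<^sup>2)"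
    have "(\<integral>\<^sup>+x. ?n p x \<partial>lborel) \<le> (\<integral>\<^sup>+x. ennreal (1 + e) * ?n q x + ennreal (1 + 1 / e) * ?n r x \<partial>lborel)"
    proof (rule nn_integral_mono)
      fix x :: real
      have "\<bar>x\<bar> powr (1 - \<alpha>) * (cmod (fourier p x))\<^sup>2 \<le>
          \<bar>x\<bar> powr (1 - \<alpha>) * ((1 + e) * (cmod (fourier q x))\<^sup>2 + (1 + 1 / e) * (cmod (fourier r x))\<^sup>2)"
        by (intro mult_left_mono le) auto
      also have "\<dots> = (1 + e) * (\<bar>x\<bar> powr (1 - \<alpha>) * (cmod (fourier q x))\<^sup>2) + (1 + 1 / e) * (\<bar>x\<bar> powr (1 - \<alpha>) * (cmod (fourier r x))\<^sup>2)"
        by (simp only: distrib_left mult.left_commute)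
      finally show "?n p x \<le> ennreal (1 + e) * ?n q x + ennreal (1 + 1 / e) * ?n r x"
        using e by (simp only: ennreal_mult'[symmetric] ennreal_plus[symmetric] ennreal_leI add_nonneg_nonneg mult_nonneg_nonneg
            less_imp_le zero_le_one zero_le_power2 powr_ge_zero divide_nonneg_nonneg)
    qed
    also have "\<dots> = ennreal (1 + e) * (\<integral>\<^sup>+x. ?n q x \<partial>lborel) + ennreal (1 + 1 / e) * (\<integral>\<^sup>+x. ?n r x \<partial>lborel)"
      by (subst nn_integral_add) (auto simp: nn_integral_cmult)
    finally have "(\<integral>\<^sup>+x. ?n p x \<partial>lborel) \<le> \<dots>" .
    from mult_left_mono[OF this, of "ennreal (Gamma (1 + \<alpha>) * sin (pi * \<alpha> / 2))"]
    show ?thesis unfolding alpha_norm_sq_def by (simp add: distrib_left mult_ac)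
  qed
  show "alpha_norm_sq \<alpha> f \<le> ennreal (1 + e) * alpha_norm_sq \<alpha> g + ennreal (1 + 1 / e) * alpha_norm_sq \<alpha> (\<lambda>x. f x - g x)"
    by (rule main) (auto simp: lin key)
  show "alpha_norm_sq \<alpha> g \<le> ennreal (1 + e) * alpha_norm_sq \<alpha> f + ennreal (1 + 1 / e) * alpha_norm_sq \<alpha> (\<lambda>x. f x - g x)"
  proof (rule main)
    fix x
    show "(cmod (fourier g x))\<^sup>2 \<le> (1 + e) * (cmod (fourier f x))\<^sup>2 + (1 + 1 / e) * (cmod (fourier (\<lambda>x. f x - g x) x))\<^sup>2"
      using key[of "fourier g x" "fourier f x"] by (simp add: lin norm_minus_commute)
  qed auto
qed

text \<open>Cauchy-Schwarz for a sum of \<open>card J\<close> terms. The constant is crude, but only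
  convergence to 0 is drawn from it.\<close>

lemma alpha_norm_sq_sum_le:
  fixes c :: "'i \<Rightarrow> real"
  assumes "finite J" and f: "\<And>t. t \<in> J \<Longrightarrow> integrable lborel (f t)"
  shows "alpha_norm_sq \<alpha> (\<lambda>x. \<Sum>t\<in>J. c t * f t x) \<le> (\<Sum>t\<in>J. ennreal (card J * (c t)\<^sup>2) * alpha_norm_sq \<alpha> (f t))"
proof -
  have m: "fourier (f t) \<in> borel_measurable borel" if "t \<in> J" for t using measurable_fourier[OF f[OF that]] .
  let ?n = "\<lambda>h x. ennreal (\<bar>x\<bar> powr (1 - \<alpha>) * (cmod (fourier h x))\<^sup>2)"
  have "(\<integral>\<^sup>+x. ?n (\<lambda>x. \<Sum>t\<in>J. c t * f t x) x \<partial>lborel) \<le> (\<integral>\<^sup>+x. (\<Sum>t\<in>J. ennreal (card J * (c t)\<^sup>2) * ?n (f t) x) \<partial>lborel)"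
  proof (rule nn_integral_mono)
    fix x :: real
    have "cmod (fourier (\<lambda>x. \<Sum>t\<in>J. c t * f t x) x) \<le> (\<Sum>t\<in>J. \<bar>c t\<bar> * cmod (fourier (f t) x))"
      by (subst fourier_linear[OF f], assumption, rule order_trans[OF norm_sum]) (simp add: norm_mult)
    then have "(cmod (fourier (\<lambda>x. \<Sum>t\<in>J. c t * f t x) x))\<^sup>2 \<le> (\<Sum>t\<in>J. \<bar>c t\<bar> * cmod (fourier (f t) x))\<^sup>2"
      by (intro power_mono) auto
    also have "\<dots> \<le> (\<Sum>t\<in>J. (\<bar>c t\<bar> * cmod (fourier (f t) x))\<^sup>2) * card J"
      by (rule sum_squared_le_sum_of_squares)
    finally have "\<bar>x\<bar> powr (1 - \<alpha>) * (cmod (fourier (\<lambda>x. \<Sum>t\<in>J. c t * f t x) x))\<^sup>2 \<le>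
        \<bar>x\<bar> powr (1 - \<alpha>) * ((\<Sum>t\<in>J. (\<bar>c t\<bar> * cmod (fourier (f t) x))\<^sup>2) * card J)"
      by (rule mult_left_mono) auto
    also have "\<dots> = (\<Sum>t\<in>J. card J * (c t)\<^sup>2 * (\<bar>x\<bar> powr (1 - \<alpha>) * (cmod (fourier (f t) x))\<^sup>2))"
      by (simp add: sum_distrib_left sum_distrib_right power_mult_distrib mult_ac)
    finally have "?n (\<lambda>x. \<Sum>t\<in>J. c t * f t x) x \<le> ennreal (\<Sum>t\<in>J. card J * (c t)\<^sup>2 * (\<bar>x\<bar> powr (1 - \<alpha>) * (cmod (fourier (f t) x))\<^sup>2))"
      by (rule ennreal_leI)
    also have "\<dots> = (\<Sum>t\<in>J. ennreal (card J * (c t)\<^sup>2 * (\<bar>x\<bar> powr (1 - \<alpha>) * (cmod (fourier (f t) x))\<^sup>2)))"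
      by (rule sum_ennreal[symmetric]) simp
    also have "\<dots> = (\<Sum>t\<in>J. ennreal (card J * (c t)\<^sup>2) * ?n (f t) x)"
      by (rule sum.cong[OF refl]) (rule ennreal_mult, simp_all)
    finally show "?n (\<lambda>x. \<Sum>t\<in>J. c t * f t x) x \<le> (\<Sum>t\<in>J. ennreal (card J * (c t)\<^sup>2) * ?n (f t) x)" .
  qed
  also have "\<dots> = (\<Sum>t\<in>J. ennreal (card J * (c t)\<^sup>2) * (\<integral>\<^sup>+x. ?n (f t) x \<partial>lborel))"
    using m by (subst nn_integral_sum) (auto intro!: sum.cong nn_integral_cmult)
  finally have "(\<integral>\<^sup>+x. ?n (\<lambda>x. \<Sum>t\<in>J. c t * f t x) x \<partial>lborel) \<le> \<dots>" .
  from mult_left_mono[OF this, of "ennreal (Gamma (1 + \<alpha>) * sin (pi * \<alpha> / 2))"]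
  show ?thesis unfolding alpha_norm_sq_def by (simp add: sum_distrib_left mult_ac)
qed

text \<open>For each target y, e is fixed first, small enough that the factor 1 + e does not close
  the gap between a and y; then n makes the term with 1 + 1/e small.\<close>

lemma tendsto_of_perturbation_bounds:
  fixes x d :: "nat \<Rightarrow> real"
  assumes bounds: "\<And>e. 0 < e \<Longrightarrow> \<forall>\<^sub>F n in sequentially. x n \<le> (1 + e) * a + (1 + 1 / e) * d n \<and> a \<le> (1 + e) * x n + (1 + 1 / e) * d n"
    and d: "d \<longlonglongrightarrow> 0" and a: "0 \<le> a"
  shows "x \<longlonglongrightarrow> a"
proof (rule order_tendstoI)
  fix y assume y: "y < a"
  \<comment> \<open>With this e, the product e |y| is at most half the gap, so (1 + e) y < a; y may
    be negative or 0, hence |y| + 1.\<close>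
  define e where "e = (a - y) / (2 * (\<bar>y\<bar> + 1))"
  have e: "0 < e" using y by (simp add: e_def)
  have "e * \<bar>y\<bar> \<le> (a - y) / 2" using y by (simp add: e_def field_simps)
  moreover have "e * y \<le> e * \<bar>y\<bar>" using e by simp
  ultimately have "0 < a - (1 + e) * y" using y by (simp add: algebra_simps)
  moreover have "(\<lambda>n. (1 + 1 / e) * d n) \<longlonglongrightarrow> (1 + 1 / e) * 0" by (intro tendsto_intros d)
  ultimately have "\<forall>\<^sub>F n in sequentially. (1 + 1 / e) * d n < a - (1 + e) * y"
    by (intro order_tendstoD(2)) auto
  then show "\<forall>\<^sub>F n in sequentially. y < x n"
    using bounds[OF e]
  proof eventually_elim
    case (elim n)
    then have "(1 + e) * y < (1 + e) * x n" by linarith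
    then show ?case using e by simp
  qed
next
  fix y assume y: "a < y"
  define e where "e = (y - a) / (2 * (a + 1))"
  have e: "0 < e" using y a by (simp add: e_def)
  have "e * a \<le> e * (a + 1)" using e by simp
  also have "e * (a + 1) = (y - a) / 2" using a by (simp add: e_def field_simps)
  finally have "e * a < y - a" using y by simp
  then have "0 < y - (1 + e) * a" by (simp add: algebra_simps)
  moreover have "(\<lambda>n. (1 + 1 / e) * d n) \<longlonglongrightarrow> (1 + 1 / e) * 0" by (intro tendsto_intros d)
  ultimately have "\<forall>\<^sub>F n in sequentially. (1 + 1 / e) * d n < y - (1 + e) * a"
    by (intro order_tendstoD(2)) auto
  then show "\<forall>\<^sub>F n in sequentially. x n < y"
    using bounds[OF e] by eventually_elim linarith
qed

section \<open>The canonical process\<close>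

lemma alpha_norm_sq_tendsto:
  assumes f: "\<And>n. integrable lborel (f n)" and h: "integrable lborel h"
    and a: "alpha_norm_sq \<alpha> h = ennreal a" "0 \<le> a"
    and lim: "(\<lambda>n. alpha_norm_sq \<alpha> (\<lambda>x. f n x - h x)) \<longlonglongrightarrow> 0"
  shows "(\<lambda>n. enn2real (alpha_norm_sq \<alpha> (f n))) \<longlonglongrightarrow> a"
proof (rule tendsto_of_perturbation_bounds[OF _ _ a(2)])
  let ?d = "\<lambda>n. alpha_norm_sq \<alpha> (\<lambda>x. f n x - h x)"
  show "(\<lambda>n. enn2real (?d n)) \<longlonglongrightarrow> 0"
    using lim by (intro tendsto_enn2real) auto
  fix e :: real assume e: "0 < e"
  \<comment> \<open>Finite distance to h makes the norm of \<open>f n\<close> finite; otherwise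
    \<open>enn2real\<close> would return the default value 0.\<close>
  have "\<forall>\<^sub>F n in sequentially. ?d n < 1" using lim by (rule order_tendstoD(2)) simp
  then show "\<forall>\<^sub>F n in sequentially. enn2real (alpha_norm_sq \<alpha> (f n)) \<le> (1 + e) * a + (1 + 1 / e) * enn2real (?d n) \<and>
      a \<le> (1 + e) * enn2real (alpha_norm_sq \<alpha> (f n)) + (1 + 1 / e) * enn2real (?d n)"
  proof eventually_elim
    case (elim n)
    then have "?d n < top" by (rule less_trans) simp
    then obtain d where d: "?d n = ennreal d" "0 \<le> d" by (cases "?d n") auto
    note P = alpha_norm_sq_perturb[where \<alpha> = \<alpha>, OF f[of n] h e, unfolded a(1) d(1)]
    have *: "ennreal (1 + e) * ennreal u + ennreal (1 + 1 / e) * ennreal d = ennreal ((1 + e) * u + (1 + 1 / e) * d)"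
      if "0 \<le> u" for u
      using that e d(2) by (simp add: ennreal_mult ennreal_plus)
    have "alpha_norm_sq \<alpha> (f n) < top"
      using P(1) unfolding *[OF a(2)] by (rule le_less_trans) simp
    then obtain x where x: "alpha_norm_sq \<alpha> (f n) = ennreal x" "0 \<le> x" by (cases "alpha_norm_sq \<alpha> (f n)") auto
    have nn: "0 \<le> (1 + e) * u + (1 + 1 / e) * d" if "0 \<le> u" for u using that e d(2) by simp
    have "x \<le> (1 + e) * a + (1 + 1 / e) * d"
      using P(1) unfolding x(1) *[OF a(2)] ennreal_le_iff[OF nn[OF a(2)]] .
    moreover have "a \<le> (1 + e) * x + (1 + 1 / e) * d"
      using P(2) unfolding x(1) *[OF x(2)] ennreal_le_iff[OF nn[OF x(2)]] .
    ultimately show ?case unfolding x(1) d(1) using x d by simp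
  qed
qed

text \<open>The map x to exp (i x) is 1-Lipschitz, and |z| \<le> e + z^2 / e replaces
  Cauchy-Schwarz, so that mean-square distances suffice and no integrability of U or V is
  assumed.\<close>

lemma iexp_integral_diff_bound:
  fixes U V :: "'i \<Rightarrow> 'a \<Rightarrow> real"
  assumes M: "prob_space M" and J: "finite J" and e: "0 < e"
    and [measurable]: "\<And>t. t \<in> J \<Longrightarrow> U t \<in> borel_measurable M" "\<And>t. t \<in> J \<Longrightarrow> V t \<in> borel_measurable M"
  shows "ennreal (norm ((\<integral>x. iexp (\<Sum>t\<in>J. c t * U t x) \<partial>M) - (\<integral>x. iexp (\<Sum>t\<in>J. c t * V t x) \<partial>M))) \<le>
    (\<Sum>t\<in>J. ennreal \<bar>c t\<bar> * (ennreal e + ennreal (1 / e) * (\<integral>\<^sup>+x. ennreal ((U t x - V t x)\<^sup>2) \<partial>M)))"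
proof -
  interpret prob_space M by fact
  let ?u = "\<lambda>x. \<Sum>t\<in>J. c t * U t x" and ?v = "\<lambda>x. \<Sum>t\<in>J. c t * V t x"
  have [measurable]: "?u \<in> borel_measurable M" "?v \<in> borel_measurable M" by measurable
  have I: "integrable M (\<lambda>x. iexp (?u x))" "integrable M (\<lambda>x. iexp (?v x))"
    by (auto intro!: integrable_const_bound[of _ 1] simp del: of_real_sum)
  have "ennreal (norm ((\<integral>x. iexp (?u x) \<partial>M) - (\<integral>x. iexp (?v x) \<partial>M))) = ennreal (norm (\<integral>x. iexp (?u x) - iexp (?v x) \<partial>M))"
    using I by simp
  also have "\<dots> \<le> (\<integral>\<^sup>+x. ennreal (norm (iexp (?u x) - iexp (?v x))) \<partial>M)"
    using I by (intro integral_norm_bound_ennreal Bochner_Integration.integrable_diff)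
  also have "\<dots> \<le> (\<integral>\<^sup>+x. (\<Sum>t\<in>J. ennreal \<bar>c t\<bar> * (ennreal e + ennreal (1 / e) * ennreal ((U t x - V t x)\<^sup>2))) \<partial>M)"
  proof (rule nn_integral_mono)
    fix x
    have "iexp (?u x) - iexp (?v x) = iexp (?v x) * (iexp (?u x - ?v x) - 1)"
      by (simp add: right_diff_distrib exp_add[symmetric] del: of_real_sum)
    then have "norm (iexp (?u x) - iexp (?v x)) = norm (iexp (?u x - ?v x) - 1)"
      by (simp only: norm_mult norm_exp_i_times mult_1)
    also have "\<dots> \<le> \<bar>?u x - ?v x\<bar>" using iexp_approx1[of "?u x - ?v x" 0] by simp
    also have "?u x - ?v x = (\<Sum>t\<in>J. c t * (U t x - V t x))" by (simp add: sum_subtractf right_diff_distrib)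
    also have "\<bar>\<dots>\<bar> \<le> (\<Sum>t\<in>J. \<bar>c t\<bar> * \<bar>U t x - V t x\<bar>)" by (rule order_trans[OF sum_abs]) (simp add: abs_mult)
    also have "\<dots> \<le> (\<Sum>t\<in>J. \<bar>c t\<bar> * (e + 1 / e * (U t x - V t x)\<^sup>2))"
    proof (intro sum_mono mult_left_mono)
      fix t
      \<comment> \<open>Either |z| is at most e, or |z| / e exceeds 1 and z^2 / e exceeds
        |z|.\<close>
      have "\<bar>z\<bar> \<le> e + 1 / e * z\<^sup>2" for z :: real
      proof (cases "\<bar>z\<bar> \<le> e")
        case False
        then have "\<bar>z\<bar> * e \<le> \<bar>z\<bar> * \<bar>z\<bar>" by (intro mult_left_mono) auto
        then have "\<bar>z\<bar> \<le> 1 / e * z\<^sup>2" using e by (simp add: field_simps power2_eq_square)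
        then show ?thesis using e by linarith
      qed (use e in \<open>simp add: add_increasing2\<close>)
      then show "\<bar>U t x - V t x\<bar> \<le> e + 1 / e * (U t x - V t x)\<^sup>2" .
    qed auto
    finally have "ennreal (norm (iexp (?u x) - iexp (?v x))) \<le> ennreal (\<Sum>t\<in>J. \<bar>c t\<bar> * (e + 1 / e * (U t x - V t x)\<^sup>2))"
      by (rule ennreal_leI)
    also have "\<dots> = (\<Sum>t\<in>J. ennreal (\<bar>c t\<bar> * (e + 1 / e * (U t x - V t x)\<^sup>2)))"
      using e by (intro sum_ennreal[symmetric]) simp
    also have "\<dots> = (\<Sum>t\<in>J. ennreal \<bar>c t\<bar> * (ennreal e + ennreal (1 / e) * ennreal ((U t x - V t x)\<^sup>2)))"
    proof (rule sum.cong[OF refl])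
      fix t
      have "ennreal (e + 1 / e * (U t x - V t x)\<^sup>2) = ennreal e + ennreal (1 / e) * ennreal ((U t x - V t x)\<^sup>2)"
        using e by (subst ennreal_plus) (simp_all add: ennreal_mult[symmetric])
      moreover have "ennreal (\<bar>c t\<bar> * (e + 1 / e * (U t x - V t x)\<^sup>2)) = ennreal \<bar>c t\<bar> * ennreal (e + 1 / e * (U t x - V t x)\<^sup>2)"
        using e by (intro ennreal_mult) auto
      ultimately show "ennreal (\<bar>c t\<bar> * (e + 1 / e * (U t x - V t x)\<^sup>2)) = ennreal \<bar>c t\<bar> * (ennreal e + ennreal (1 / e) * ennreal ((U t x - V t x)\<^sup>2))"
        by simp
    qed
    finally show "ennreal (norm (iexp (?u x) - iexp (?v x))) \<le> \<dots>" .
  qed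
  also have "\<dots> = (\<Sum>t\<in>J. ennreal \<bar>c t\<bar> * (ennreal e + ennreal (1 / e) * (\<integral>\<^sup>+x. ennreal ((U t x - V t x)\<^sup>2) \<partial>M)))"
  proof (subst nn_integral_sum)
    show "(\<Sum>t\<in>J. \<integral>\<^sup>+x. ennreal \<bar>c t\<bar> * (ennreal e + ennreal (1 / e) * ennreal ((U t x - V t x)\<^sup>2)) \<partial>M) =
      (\<Sum>t\<in>J. ennreal \<bar>c t\<bar> * (ennreal e + ennreal (1 / e) * (\<integral>\<^sup>+x. ennreal ((U t x - V t x)\<^sup>2) \<partial>M)))"
      by (intro sum.cong refl)
         (simp add: nn_integral_cmult nn_integral_add emeasure_space_1)
  qed measurable
  finally show ?thesis .
qed

text \<open>Approximating each indicator by Schwartz functions makes the combination a single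
  pairing, whose characteristic function is given; norms and mean squares then pass to the limit.
  Continuity of the Mittag-Leffler function and positivity of the form are hypotheses because both
  are established through L and the fractional Brownian motion.\<close>

lemma canonical_ggBm_char:
  assumes \<alpha>: "0 < \<alpha>" "\<alpha> < 2" and B: "canonical_ggBm \<alpha> \<beta> \<mu> C" and J: "finite J" "J \<subseteq> {0..}"
    and cont: "\<And>s s0. (\<And>n. 0 \<le> s n) \<Longrightarrow> s \<longlonglongrightarrow> s0 \<Longrightarrow> (\<lambda>n. mittag_leffler \<beta> (- s n)) \<longlonglongrightarrow> mittag_leffler \<beta> (- s0)"
    and nonneg: "0 \<le> fBm_form \<alpha> J c"
  shows "(\<integral>\<omega>. iexp (\<Sum>t\<in>J. c t * C t \<omega>) \<partial>\<mu>) = of_real (mittag_leffler \<beta> (- (fBm_form \<alpha> J c / 2)))"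
proof -
  have grey: "grey_noise_measure \<alpha> \<beta> \<mu>" and ext: "\<And>t. t \<in> J \<Longrightarrow> grey_extension \<alpha> \<mu> (indicator {0..<t}) (C t)"
    using B J(2) by (auto simp: canonical_ggBm_def)
  then have \<mu>: "prob_space \<mu>" and sets: "sets \<mu> = sets tempered_borel" by (auto simp: grey_noise_measure_def)
  interpret prob_space \<mu> by fact
  have sp: "space \<mu> = tempered_distributions"
    using sets_eq_imp_space_eq[OF sets] space_tempered_borel by simp
  have Cm: "C t \<in> borel_measurable \<mu>" if "t \<in> J" for t using ext[OF that] by (simp add: grey_extension_def)
  have "\<forall>t\<in>J. \<exists>\<xi>. (\<forall>n. \<xi> n \<in> schwartz_space) \<and>
        (\<lambda>n. alpha_norm_sq \<alpha> (\<lambda>x. \<xi> n x - indicator {0..<t} x)) \<longlonglongrightarrow> 0 \<and>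
        (\<lambda>n. \<integral>\<^sup>+\<omega>. ennreal ((\<omega> (\<xi> n) - C t \<omega>)\<^sup>2) \<partial>\<mu>) \<longlonglongrightarrow> 0"
    using ext by (auto simp: grey_extension_def)
  from bchoice[OF this] obtain \<xi> where *: "\<forall>t\<in>J. (\<forall>n. \<xi> t n \<in> schwartz_space) \<and>
        (\<lambda>n. alpha_norm_sq \<alpha> (\<lambda>x. \<xi> t n x - indicator {0..<t} x)) \<longlonglongrightarrow> 0 \<and>
        (\<lambda>n. \<integral>\<^sup>+\<omega>. ennreal ((\<omega> (\<xi> t n) - C t \<omega>)\<^sup>2) \<partial>\<mu>) \<longlonglongrightarrow> 0" by blast
  then have \<xi>: "\<xi> t n \<in> schwartz_space"
    and \<xi>_norm: "(\<lambda>n. alpha_norm_sq \<alpha> (\<lambda>x. \<xi> t n x - indicator {0..<t} x)) \<longlonglongrightarrow> 0"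
    and \<xi>_L2: "(\<lambda>n. \<integral>\<^sup>+\<omega>. ennreal ((\<omega> (\<xi> t n) - C t \<omega>)\<^sup>2) \<partial>\<mu>) \<longlonglongrightarrow> 0" if "t \<in> J" for t n
    using that by auto
  define h where "h x = (\<Sum>t\<in>J. c t * indicator {0..<t} x)" for x :: real
  \<comment> \<open>The same coefficients are applied to the approximants of all times, so that by
    linearity the pairing with \<open>\<eta> n\<close> is the combination of the pairings.\<close>
  define \<eta> where "\<eta> n x = (\<Sum>t\<in>J. c t * \<xi> t n x)" for n x
  let ?a = "fBm_form \<alpha> J c / 2"
  let ?x = "\<lambda>n. enn2real (alpha_norm_sq \<alpha> (\<eta> n))"
  have \<eta>S: "\<eta> n \<in> schwartz_space" for n
    unfolding \<eta>_def[abs_def] by (rule schwartz_space_sum[OF J(1) \<xi>])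
  have ind_int: "integrable lborel (indicator {0..<t} :: real \<Rightarrow> real)" if "t \<in> J" for t
    using J(2) that by (auto simp: integrable_indicator_iff subset_eq)
  have h_int: "integrable lborel h" unfolding h_def[abs_def] using ind_int by (intro Bochner_Integration.integrable_sum integrable_mult_right)
  have x_lim: "?x \<longlonglongrightarrow> ?a"
  proof (rule alpha_norm_sq_tendsto[OF schwartz_integrable[OF \<eta>S] h_int])
    show "alpha_norm_sq \<alpha> h = ennreal ?a" unfolding h_def[abs_def] by (rule alpha_norm_sq_step[OF \<alpha> J])
    show "0 \<le> ?a" using nonneg by simp
    have le: "alpha_norm_sq \<alpha> (\<lambda>x. \<eta> n x - h x) \<le>
        (\<Sum>t\<in>J. ennreal (card J * (c t)\<^sup>2) * alpha_norm_sq \<alpha> (\<lambda>x. \<xi> t n x - indicator {0..<t} x))" for n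
    proof -
      have "(\<lambda>x. \<eta> n x - h x) = (\<lambda>x. \<Sum>t\<in>J. c t * (\<xi> t n x - indicator {0..<t} x))"
        by (simp add: \<eta>_def h_def sum_subtractf right_diff_distrib fun_eq_iff)
      then show ?thesis
        using alpha_norm_sq_sum_le[OF J(1), of "\<lambda>t x. \<xi> t n x - indicator {0..<t} x" \<alpha> c]
          schwartz_integrable[OF \<xi>] ind_int by auto
    qed
    have "(\<lambda>n. \<Sum>t\<in>J. ennreal (card J * (c t)\<^sup>2) * alpha_norm_sq \<alpha> (\<lambda>x. \<xi> t n x - indicator {0..<t} x)) \<longlonglongrightarrow>
        (\<Sum>t\<in>J. ennreal (card J * (c t)\<^sup>2) * 0)"
      by (intro tendsto_sum ennreal_tendsto_cmult \<xi>_norm) auto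
    then have "(\<lambda>n. \<Sum>t\<in>J. ennreal (card J * (c t)\<^sup>2) * alpha_norm_sq \<alpha> (\<lambda>x. \<xi> t n x - indicator {0..<t} x)) \<longlonglongrightarrow> 0"
      by simp
    from tendsto_sandwich[OF _ _ tendsto_const this]
    show "(\<lambda>n. alpha_norm_sq \<alpha> (\<lambda>x. \<eta> n x - h x)) \<longlonglongrightarrow> 0"
      using le by simp
  qed
  have char_n: "(\<integral>\<omega>. iexp (\<Sum>t\<in>J. c t * \<omega> (\<xi> t n)) \<partial>\<mu>) = of_real (mittag_leffler \<beta> (- ?x n))" for n
  proof -
    have "(\<integral>\<omega>. iexp (\<Sum>t\<in>J. c t * \<omega> (\<xi> t n)) \<partial>\<mu>) = (\<integral>\<omega>. iexp (\<omega> (\<eta> n)) \<partial>\<mu>)"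
    proof (rule Bochner_Integration.integral_cong[OF refl])
      fix \<omega> assume "\<omega> \<in> space \<mu>"
      then have "\<omega> (\<eta> n) = (\<Sum>t\<in>J. c t * \<omega> (\<xi> t n))"
        unfolding sp \<eta>_def[abs_def] using tempered_linear[OF _ J(1), of \<omega> "\<lambda>t. \<xi> t n" c] \<xi> by simp
      then show "iexp (\<Sum>t\<in>J. c t * \<omega> (\<xi> t n)) = iexp (\<omega> (\<eta> n))" by simp
    qed
    then show ?thesis using grey \<eta>S by (simp add: grey_noise_measure_def)
  qed
  let ?I = "\<integral>\<omega>. iexp (\<Sum>t\<in>J. c t * C t \<omega>) \<partial>\<mu>"
  define K where "K = (\<Sum>t\<in>J. \<bar>c t\<bar>)"
  have bound: "norm (of_real (mittag_leffler \<beta> (- ?a)) - ?I) \<le> K * e" if e: "0 < e" for e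
  proof -
    have lhs: "(\<lambda>n. ennreal (norm (of_real (mittag_leffler \<beta> (- ?x n)) - ?I))) \<longlonglongrightarrow>
        ennreal (norm (of_real (mittag_leffler \<beta> (- ?a)) - ?I))"
      by (intro tendsto_ennrealI tendsto_norm tendsto_diff tendsto_of_real tendsto_const cont x_lim) auto
    have rhs: "(\<lambda>n. \<Sum>t\<in>J. ennreal \<bar>c t\<bar> * (ennreal e + ennreal (1 / e) * (\<integral>\<^sup>+\<omega>. ennreal ((\<omega> (\<xi> t n) - C t \<omega>)\<^sup>2) \<partial>\<mu>)))
        \<longlonglongrightarrow> (\<Sum>t\<in>J. ennreal \<bar>c t\<bar> * (ennreal e + ennreal (1 / e) * 0))"
      by (intro tendsto_sum ennreal_tendsto_cmult tendsto_add tendsto_const \<xi>_L2) auto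
    have le: "ennreal (norm (of_real (mittag_leffler \<beta> (- ?x n)) - ?I)) \<le>
        (\<Sum>t\<in>J. ennreal \<bar>c t\<bar> * (ennreal e + ennreal (1 / e) * (\<integral>\<^sup>+\<omega>. ennreal ((\<omega> (\<xi> t n) - C t \<omega>)\<^sup>2) \<partial>\<mu>)))" for n
      unfolding char_n[symmetric]
      using measurable_tempered_eval[OF sets \<xi>] Cm
      by (intro iexp_integral_diff_bound[OF \<mu> J(1) e, of "\<lambda>t \<omega>. \<omega> (\<xi> t n)" C]) auto
    have "ennreal (norm (of_real (mittag_leffler \<beta> (- ?a)) - ?I)) \<le> (\<Sum>t\<in>J. ennreal \<bar>c t\<bar> * (ennreal e + ennreal (1 / e) * 0))"
      by (rule LIMSEQ_le[OF lhs rhs]) (use le in blast)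
    also have "\<dots> = (\<Sum>t\<in>J. ennreal (\<bar>c t\<bar> * e))" by (simp add: ennreal_mult')
    also have "\<dots> = ennreal (\<Sum>t\<in>J. \<bar>c t\<bar> * e)" using e by (intro sum_ennreal) simp
    also have "(\<Sum>t\<in>J. \<bar>c t\<bar> * e) = K * e" by (simp add: K_def sum_distrib_right)
    finally show ?thesis using e by (subst (asm) ennreal_le_iff) (auto simp: K_def sum_nonneg)
  qed
  have "0 \<le> K" by (simp add: K_def sum_nonneg)
  have "norm (of_real (mittag_leffler \<beta> (- ?a)) - ?I) \<le> 0"
  proof (rule field_le_epsilon)
    fix e :: real assume "0 < e"
    \<comment> \<open>Dividing by K + 1 rather than K allows all coefficients to be 0.\<close>
    then have "norm (of_real (mittag_leffler \<beta> (- ?a)) - ?I) \<le> K * (e / (K + 1))"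
      using \<open>0 \<le> K\<close> by (intro bound) auto
    also have "\<dots> \<le> 0 + e" using \<open>0 \<le> K\<close> \<open>0 < e\<close> by (simp add: field_simps)
    finally show "norm (of_real (mittag_leffler \<beta> (- ?a)) - ?I) \<le> 0 + e" .
  qed
  then show ?thesis by simp
qed

theorem proposition3:
  fixes \<alpha> \<beta> :: real
    and M :: "'a measure" and B :: "real \<Rightarrow> 'a \<Rightarrow> real"
    and N :: "'b measure" and X :: "real \<Rightarrow> 'b \<Rightarrow> real" and L :: "'b \<Rightarrow> real"
  assumes "0 < \<beta>" and "\<beta> \<le> 1" and "0 < \<alpha>" and "\<alpha> < 2"
    and "ggBm \<alpha> \<beta> M B"
    and "prob_space N" and "standard_fBm \<alpha> N X"
    and "AE \<omega> in N. 0 \<le> L \<omega>" and "M_law N \<beta> L"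
    and "indep_of_process N L X"
  shows "same_fdd M B N (\<lambda>t \<omega>. sqrt (L \<omega>) * X t \<omega>)"
proof -
  obtain \<mu> C where C: "canonical_ggBm \<alpha> \<beta> \<mu> C" and fdd: "same_fdd M B \<mu> C"
    using assms(5) by (auto simp: ggBm_def)
  have "distr \<mu> (Pi\<^sub>M J (\<lambda>_. borel)) (\<lambda>\<omega>. \<lambda>t\<in>J. C t \<omega>) =
      distr N (Pi\<^sub>M J (\<lambda>_. borel)) (\<lambda>\<omega>. \<lambda>t\<in>J. sqrt (L \<omega>) * X t \<omega>)" if J: "finite J" "J \<subseteq> {0..}" for J
  proof (rule Cramer_Wold[OF _ assms(6) J(1)])
    show "prob_space \<mu>" using C by (simp add: canonical_ggBm_def grey_noise_measure_def)
    show "C t \<in> borel_measurable \<mu>" if "t \<in> J" for t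
      using C J(2) that by (auto simp: canonical_ggBm_def grey_extension_def)
    show "(\<lambda>\<omega>. sqrt (L \<omega>) * X t \<omega>) \<in> borel_measurable N" if "t \<in> J" for t
      using assms(7,9) J(2) that
      by (auto simp: M_law_def standard_fBm_def gaussian_process_def intro!: borel_measurable_times borel_measurable_sqrt)
    show "(\<integral>\<omega>. iexp (\<Sum>t\<in>J. c t * C t \<omega>) \<partial>\<mu>) = (\<integral>\<omega>. iexp (\<Sum>t\<in>J. c t * (sqrt (L \<omega>) * X t \<omega>)) \<partial>N)" for c
    proof -
      have "0 \<le> fBm_form \<alpha> J c"
        unfolding standard_fBm_linear_combination(3)[OF assms(7) J, symmetric] by simp
      then show ?thesis
        unfolding scaled_fBm_char[OF assms(6,1,2,7,8,9,10) J]
        \<comment> \<open>Here the law of L on N supplies the continuity that the computation on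
          \<mu> requires.\<close>
        using M_law_mittag_leffler_continuous[OF assms(6,1,2,9,8)]
        by (intro canonical_ggBm_char[OF assms(3,4) C J]) auto
    qed
  qed
  then show ?thesis using fdd by (simp add: same_fdd_def)
qed

end
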